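(* Let $l>0$ and $b\in\mathbb{R}$ with $|b|<l$, let $Q$, $S_N$, $\Pi_N$, $\xi_N$, $G(\xi_N)$, $X$ and $\mathcal{G}$ be as in the context, with $\alpha:Q\to[0,\infty)$ continuous, and set $$\mathcal{G}^*=\sup_{y\in X}\mathcal{G}(y).$$ Then $G(\xi_N)\to\mathcal{G}^*$ almost surely as $N\to\infty$. Moreover, for every $\delta>0$ there are constants $c,C>0$ such that $$P\bigl(|G(\xi_N)-\mathcal{G}^*|>\delta\bigr)<Ce^{-cN}\quad\text{for all }N\in\mathbb{N}.$$
   Context: Inhomogeneous last passage percolation. Fix $l>0$ and $b\in\mathbb{R}$ with $|b|<l$, and let $Q=\{(x,y)\in\mathbb{R}^2: 0\le x\le l,\ |y|\le x,\ |b-y|\le l-x\}$. This is the closed rectangle with sides of slope $\pm1$ having $(0,0)$ and $(l,b)$ as opposite vertices. Let $\widetilde{\mathbb{Z}}^2=\{(x,y)\in\mathbb{Z}^2: x+y\in 2\mathbb{Z}\}$, and for $N\in\mathbb{N}$ let $S_N=Q\cap\frac1N\widetilde{\mathbb{Z}}^2$. Let $\alpha:Q\to[0,\infty)$ be continuous. For each $N$, let $\xi_N=(\xi_p)_{p\in S_N}$ be independent random variables with $\xi_p$ distributed as $\frac{\alpha(p)}{N}E_p$, where $E_p$ is exponential with mean $1$. $\Pi_N$ is the set of oriented lattice paths $\pi=(p_0,\dots,p_k)$ with $p_0=(0,0)$, $p_i\in S_N$, $p_i-p_{i-1}=\frac1N(1,\pm1)$ for each $i$, and $p_k$ the rightmost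 point of $S_N$. For $\pi\in\Pi_N$, define $\xi_N\cdot\pi=\sum_{p\in\pi}\xi_p$. Let $G(\xi_N)=\max_{\pi\in\Pi_N}\xi_N\cdot\pi$. Let $\gamma(w)=1+\sqrt{1-w^2}$ for $|w|\le1$. Let $X$ be the set of functions $y:[0,l]\to\mathbb{R}$ that are Lipschitz with constant $1$ and satisfy $y(0)=0$ and $y(l)=b$. For $y\in X$, define $$\mathcal{G}(y)=\int_0^l\alpha\bigl(x,y(x)\bigr)\,\gamma\bigl(\dot y(x)\bigr)\,dx,$$ where $\dot y=dy/dx$, which exists almost everywhere. *)

theory Defs
  imports "HOL-Probability.Probability"
begin

text \<open>The closed tilted rectangle Q with opposite vertices (0,0) and (l,b).\<close>
definition rectQ :: "real \<Rightarrow> real \<Rightarrow> (real \<times> real) set" where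
  "rectQ l b = {(x, y). 0 \<le> x \<and> x \<le> l \<and> \<bar>y\<bar> \<le> x \<and> \<bar>b - y\<bar> \<le> l - x}"

definition latS :: "real \<Rightarrow> real \<Rightarrow> nat \<Rightarrow> (real \<times> real) set" where
  "latS l b N = {p \<in> rectQ l b. \<exists>i j :: int. even (i + j) \<and> p = (real_of_int i / real N, real_of_int j / real N)}"

definition rightmost :: "real \<Rightarrow> real \<Rightarrow> nat \<Rightarrow> (real \<times> real) set" where
  "rightmost l b N = {p \<in> latS l b N. \<forall>q \<in> latS l b N. fst q \<le> fst p}"

definition paths :: "real \<Rightarrow> real \<Rightarrow> nat \<Rightarrow> (real \<times> real) list set" where
  "paths l b N = {\<pi>. \<pi> \<noteq> [] \<and> hd \<pi> = (0, 0) \<and> set \<pi> \<subseteq> latS l b N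
      \<and> (\<forall>i. Suc i < length \<pi> \<longrightarrow>
            (\<pi> ! Suc i = (fst (\<pi> ! i) + 1 / real N, snd (\<pi> ! i) + 1 / real N)
           \<or> \<pi> ! Suc i = (fst (\<pi> ! i) + 1 / real N, snd (\<pi> ! i) - 1 / real N)))
      \<and> last \<pi> \<in> rightmost l b N}"

definition lpp :: "real \<Rightarrow> real \<Rightarrow> nat \<Rightarrow> (real \<times> real \<Rightarrow> real) \<Rightarrow> real" where
  "lpp l b N w = Max ((\<lambda>\<pi>. \<Sum>p\<leftarrow>\<pi>. w p) ` paths l b N)"

definition gamma_fn :: "real \<Rightarrow> real" where
  "gamma_fn w = 1 + sqrt (1 - w\<^sup>2)"

definition admissible :: "real \<Rightarrow> real \<Rightarrow> (real \<Rightarrow> real) set" where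
  "admissible l b = {y. 1-lipschitz_on {0..l} y \<and> y 0 = 0 \<and> y l = b}"

definition functional :: "(real \<times> real \<Rightarrow> real) \<Rightarrow> real \<Rightarrow> (real \<Rightarrow> real) \<Rightarrow> real" where
  "functional \<alpha> l y = (LINT x:{0..l}|lebesgue. \<alpha> (x, y x) * gamma_fn (deriv y x))"

definition Gstar :: "(real \<times> real \<Rightarrow> real) \<Rightarrow> real \<Rightarrow> real \<Rightarrow> real" where
  "Gstar \<alpha> l b = (SUP y \<in> admissible l b. functional \<alpha> l y)"

definition scaled_exp_distributed :: "'a measure \<Rightarrow> ('a \<Rightarrow> real) \<Rightarrow> real \<Rightarrow> bool" where
  "scaled_exp_distributed M X a \<longleftrightarrow> X \<in> borel_measurable M \<and>
     distr M borel X = distr (density lborel (\<lambda>x. ennreal (exponential_density 1 x))) borel (\<lambda>x. a * x)"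

end

theory Submission
  imports Defs
begin

text \<open>
  In the coordinates \<open>i = N (x + y) / 2\<close>, \<open>j = N (x - y) / 2\<close> the set \<open>S\<^sub>N\<close> is a rectangular grid and the
  paths are up-right paths.

  For i.i.d. exponential weights of mean 1, the passage time through an \<open>m \<times> n\<close> box is
  \<open>(sqrt m + sqrt n)\<^sup>2 + o(N)\<close> up to probability \<open>exp (- c N)\<close>, uniformly in \<open>m, n = O(N)\<close>.
  Put independent exponential weights of rates \<open>1 - q\<close> and \<open>q\<close> on the two axes. By Burke's theorem the
  passage time of this stationary model is a sum of two sums of i.i.d. exponentials, with
  mean \<open>m / (1 - q) + n / q\<close>, so that Chernoff's bound applies. It dominates the original passage time, and
  minimising over \<open>q\<close> gives the upper tail. At the minimising \<open>q\<close>, the upper tail shows that a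
  path which stays on an axis for a macroscopic time is suboptimal, which gives the lower tail.

  On the event that all boxes of the grid behave in this way, the rest is deterministic. Cutting an
  optimal path at finitely many levels and interpolating linearly gives an admissible function
  whose value is almost the passage time. Conversely, sampling an almost optimal \<open>y\<close> at finitely many
  points loses little, because \<open>gamma_fn\<close> is concave. Jensen's inequality needs that \<open>y\<close> is the integral of its
  derivative, hence the almost everywhere differentiability of Lipschitz functions, which
  is obtained from Vitali's covering theorem.
\<close>

section \<open>Almost everywhere differentiability of Lipschitz functions\<close>

text \<open>The limit shape \<open>(sqrt m + sqrt n)^2\<close> equals
  \<open>(m + n) * gamma_fn ((m - n) / (m + n))\<close>, and under \<open>emb\<close> the numbers
  \<open>m + n\<close> and \<open>m - n\<close> are \<open>N\<close> times the displacements in x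
  and y; this is where \<open>gamma_fn\<close> comes from. The minimising \<open>q\<close> is
  \<open>sqrt n / (sqrt m + sqrt n)\<close>. For thin boxes it approaches 0 or 1, where the Chernoff
  constants degenerate. The upper tail is therefore proved with both sides enlarged by
  \<open>\<eta> * N\<close>, and the lower tail of a thin box comes from a single row or column. The
  accuracy \<epsilon> of the boxes has to be chosen after the number of pieces, because every piece
  contributes an error. This is affordable since a grid has only of the order of \<open>N^4\<close>
  sub-boxes, and the exponential rate absorbs the union bound. The tail bounds depend only on the
  law of the field for each single \<open>N\<close>. One field of exponentials thus serves all
  \<open>N\<close>, and the Borel-Cantelli lemma gives almost sure convergence whatever the joint
  law of different \<open>N\<close> is.\<close>

lemma vitali_intervals:
  fixes E :: "real set" and Q :: "real \<Rightarrow> real \<Rightarrow> bool"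
  assumes "\<forall>x\<in>E. \<forall>d>0. \<exists>u v. u \<le> x \<and> x \<le> v \<and> u < v \<and> v - u < d \<and> Q u v" and U: "open U" "E \<subseteq> U"
  obtains C where "countable C" "\<forall>u v. (u, v) \<in> C \<longrightarrow> u < v \<and> {u..v} \<subseteq> U \<and> Q u v"
    "disjoint_family_on (\<lambda>(u, v). {u..v}) C" "negligible (E - (\<Union>(u, v)\<in>C. {u..v}))"
proof -
  let ?K = "{(u, v). u < v \<and> {u..v} \<subseteq> U \<and> Q u v}"
  let ?a = "\<lambda>(u, v). (u + v) / 2 :: real" and ?r = "\<lambda>(u, v). (v - u) / 2 :: real"
  have cb: "cball (?a (u, v)) (?r (u, v)) = {u..v}" for u v :: real
  proof -
    have "(u + v) / 2 - (v - u) / 2 = u" "(u + v) / 2 + (v - u) / 2 = v" by (simp_all add: field_simps)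
    then show ?thesis by (simp add: cball_eq_atLeastAtMost)
  qed
  have cover: "\<exists>i. i \<in> ?K \<and> x \<in> cball (?a i) (?r i) \<and> ?r i < d" if "x \<in> E" and d: "0 < d" for x d
  proof -
    obtain e where e: "e > 0" "cball x e \<subseteq> U" using U \<open>x \<in> E\<close> open_contains_cball by blast
    obtain u v where uv: "u \<le> x" "x \<le> v" "u < v" "v - u < min d e" "Q u v"
      using assms(1)[rule_format, OF \<open>x \<in> E\<close>, of "min d e"] d e by simp blast
    have "{u..v} \<subseteq> cball x e" using uv by (auto simp: cball_eq_atLeastAtMost)
    then have "(u, v) \<in> ?K" using uv e by auto
    moreover have "x \<in> cball (?a (u, v)) (?r (u, v))" unfolding cb using uv by simp
    moreover have "?r (u, v) < d" using uv by auto
    ultimately show ?thesis by blast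
  qed
  have pos: "0 < ?r i" if "i \<in> ?K" for i using that by (cases i) simp
  obtain C where C: "countable C" "C \<subseteq> ?K" "pairwise (\<lambda>i j. disjnt (cball (?a i) (?r i)) (cball (?a j) (?r j))) C"
    "negligible (E - (\<Union>i\<in>C. cball (?a i) (?r i)))"
    by (rule Vitali_covering_theorem_cballs[of ?K ?r E ?a, OF pos cover]) (assumption | rule that)+
  have cb': "cball (?a i) (?r i) = (\<lambda>(u, v). {u..v}) i" for i using cb by (cases i) simp
  show ?thesis
  proof (rule that[OF C(1)])
    show "disjoint_family_on (\<lambda>(u, v). {u..v}) C"
      using C(3) unfolding cb' by (auto simp: pairwise_def disjnt_def disjoint_family_on_def)
    show "negligible (E - (\<Union>(u, v)\<in>C. {u..v}))" using C(4) unfolding cb' .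
  qed (use C(2) in auto)
qed

lemma emeasure_UN_intervals:
  assumes "countable C" "disjoint_family_on (\<lambda>(u, v). {u..v}) C" "sets M = sets borel"
  shows "emeasure M (\<Union>(u, v)\<in>C. {u..v :: real}) = (\<integral>\<^sup>+ i. emeasure M {fst i..snd i} \<partial>count_space C)"
  using assms by (subst emeasure_UN_countable) (auto simp: case_prod_unfold)

text \<open>The Stieltjes measure \<open>mu\<close> of \<open>F\<close> compares two coverings.
  Closed intervals of slope below \<open>p\<close> are chosen inside \<open>U\<close>, then
  intervals of slope above \<open>q\<close> inside those, and the chain reads
  \<open>q * |V| <= mu V <= mu W <= p * |W| <= p * |U|\<close>.\<close>

lemma dini_cover_shrink:
  fixes F :: "real \<Rightarrow> real"
  assumes F: "mono F" "continuous_on UNIV F" and pq: "0 < p" "p < q"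
    and lo: "\<forall>x\<in>E. \<forall>d>0. \<exists>u v. u \<le> x \<and> x \<le> v \<and> u < v \<and> v - u < d \<and> F v - F u < p * (v - u)"
    and hi: "\<forall>x\<in>E. \<forall>d>0. \<exists>u v. u \<le> x \<and> x \<le> v \<and> u < v \<and> v - u < d \<and> F v - F u > q * (v - u)"
    and U: "open U" "E \<subseteq> U"
  obtains V where "V \<in> sets borel" "V \<subseteq> U" "negligible (E - V)" "ennreal q * emeasure lborel V \<le> ennreal p * emeasure lborel U"
proof -
  let ?\<mu> = "interval_measure F"
  have mu: "emeasure ?\<mu> {u..v} = ennreal (F v - F u)" if "u \<le> v" for u v
    using that F by (intro emeasure_interval_measure_Icc) (auto simp: mono_def)
  obtain C1 where C1: "countable C1" "\<forall>u v. (u, v) \<in> C1 \<longrightarrow> u < v \<and> {u..v} \<subseteq> U \<and> F v - F u < p * (v - u)"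
    "disjoint_family_on (\<lambda>(u, v). {u..v}) C1" "negligible (E - (\<Union>(u, v)\<in>C1. {u..v}))"
    by (rule vitali_intervals[OF lo U], rule that)
  \<comment> \<open>The second covering needs an open set, so it is taken inside the interiors
    \<open>?O\<close>; the endpoints lost in this way form a countable, hence null, set.\<close>
  let ?W = "\<Union>(u, v)\<in>C1. {u..v}" and ?O = "\<Union>(u, v)\<in>C1. {u<..<v}"
  let ?E = "E \<inter> ?O"
  have openO: "open ?O" by auto
  obtain C2 where C2: "countable C2" "\<forall>u v. (u, v) \<in> C2 \<longrightarrow> u < v \<and> {u..v} \<subseteq> ?O \<and> F v - F u > q * (v - u)"
    "disjoint_family_on (\<lambda>(u, v). {u..v}) C2" "negligible (?E - (\<Union>(u, v)\<in>C2. {u..v}))"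
  proof -
    have "\<forall>x\<in>?E. \<forall>d>0. \<exists>u v. u \<le> x \<and> x \<le> v \<and> u < v \<and> v - u < d \<and> F v - F u > q * (v - u)" using hi by blast
    from vitali_intervals[OF this openO Int_lower2] that show thesis by metis
  qed
  let ?V = "\<Union>(u, v)\<in>C2. {u..v}"
  have mW: "?W \<in> sets borel" "?V \<in> sets borel"
    using C1(1) C2(1) by (auto intro!: sets.countable_UN')
  have "?V \<subseteq> ?O" using C2(2) by (intro UN_least) (simp add: case_prod_unfold)
  moreover have "?O \<subseteq> ?W" by (intro UN_mono) auto
  ultimately have VW: "?V \<subseteq> ?W" by (rule order_trans)
  have WU: "?W \<subseteq> U" using C1(2) by (intro UN_least) (simp add: case_prod_unfold)
  have "ennreal q * emeasure lborel ?V = (\<integral>\<^sup>+ i. ennreal q * emeasure lborel {fst i..snd i} \<partial>count_space C2)"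
    using C2(1,3) by (subst emeasure_UN_intervals) (auto simp: nn_integral_cmult)
  also have "\<dots> \<le> (\<integral>\<^sup>+ i. emeasure ?\<mu> {fst i..snd i} \<partial>count_space C2)"
  proof (rule nn_integral_mono)
    fix i assume "i \<in> space (count_space C2)"
    then have "fst i < snd i" "F (snd i) - F (fst i) > q * (snd i - fst i)" using C2(2)[rule_format, of "fst i" "snd i"] by auto
    then show "ennreal q * emeasure lborel {fst i..snd i} \<le> emeasure ?\<mu> {fst i..snd i}"
      using pq by (simp add: mu ennreal_mult[symmetric] ennreal_leI)
  qed
  also have "\<dots> = emeasure ?\<mu> ?V" using C2(1,3) by (subst emeasure_UN_intervals) auto
  also have "\<dots> \<le> emeasure ?\<mu> ?W" using VW mW by (intro emeasure_mono) auto
  also have "\<dots> = (\<integral>\<^sup>+ i. emeasure ?\<mu> {fst i..snd i} \<partial>count_space C1)" using C1(1,3) by (subst emeasure_UN_intervals) auto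
  also have "\<dots> \<le> (\<integral>\<^sup>+ i. ennreal p * emeasure lborel {fst i..snd i} \<partial>count_space C1)"
  proof (rule nn_integral_mono)
    fix i assume "i \<in> space (count_space C1)"
    then have "fst i < snd i" "F (snd i) - F (fst i) < p * (snd i - fst i)" using C1(2)[rule_format, of "fst i" "snd i"] by auto
    then show "emeasure ?\<mu> {fst i..snd i} \<le> ennreal p * emeasure lborel {fst i..snd i}"
      using pq by (simp add: mu ennreal_mult[symmetric] ennreal_leI)
  qed
  also have "\<dots> = ennreal p * emeasure lborel ?W"
    using C1(1,3) by (subst emeasure_UN_intervals) (auto simp: nn_integral_cmult)
  also have "\<dots> \<le> ennreal p * emeasure lborel U"
    using WU U by (intro mult_left_mono emeasure_mono) auto
  finally have le: "ennreal q * emeasure lborel ?V \<le> ennreal p * emeasure lborel U" .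
  show ?thesis
  proof (rule that[OF mW(2) _ _ le])
    show "?V \<subseteq> U" using VW WU by blast
    have "E - ?V \<subseteq> (E - ?W) \<union> (?E - ?V) \<union> (fst ` C1 \<union> snd ` C1)"
    proof
      fix x assume x: "x \<in> E - ?V"
      show "x \<in> (E - ?W) \<union> (?E - ?V) \<union> (fst ` C1 \<union> snd ` C1)"
      proof (cases "x \<in> ?W")
        case True
        then obtain u v where uv: "(u, v) \<in> C1" "u \<le> x" "x \<le> v" by auto
        show ?thesis
        proof (cases "u < x \<and> x < v")
          case True
          then have "x \<in> ?O" using uv(1) by (intro UN_I[of "(u, v)"]) auto
          then show ?thesis using x by blast
        next
          case False
          then have "x = fst (u, v) \<or> x = snd (u, v)" using uv by auto
          then show ?thesis using uv(1) by blast
        qed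
      qed (use x in blast)
    qed
    moreover have "negligible (fst ` C1 \<union> snd ` C1)" using C1(1) countable_imp_null_set_lborel[of "fst ` C1 \<union> snd ` C1"]
      by (simp add: negligible_iff_null_sets null_sets_completionI)
    ultimately show "negligible (E - ?V)"
      using C1(4) C2(4) by (meson negligible_Un negligible_subset)
  qed
qed

text \<open>\<open>dini_cover_shrink\<close> applied to a nearly optimal open cover \<open>U\<close>
  yields a cover of \<open>E\<close> up to a null set, smaller by the factor
  \<open>p / q < 1\<close>. Hence the outer measure of \<open>E\<close> is 0.\<close>

lemma dini_gap_negligible:
  fixes F :: "real \<Rightarrow> real"
  assumes F: "mono F" "continuous_on UNIV F" and pq: "0 < p" "p < q"
    and lo: "\<forall>x\<in>E. \<forall>d>0. \<exists>u v. u \<le> x \<and> x \<le> v \<and> u < v \<and> v - u < d \<and> F v - F u < p * (v - u)"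
    and hi: "\<forall>x\<in>E. \<forall>d>0. \<exists>u v. u \<le> x \<and> x \<le> v \<and> u < v \<and> v - u < d \<and> F v - F u > q * (v - u)"
    and bdd: "E \<subseteq> {a<..<b}"
  shows "negligible E"
proof -
  \<comment> \<open>The infimum of these numbers is the outer measure of \<open>E\<close>; staying
    inside \<open>{a<..<b}\<close> keeps them finite.\<close>
  let ?S = "{measure lebesgue U | U. open U \<and> E \<subseteq> U \<and> U \<subseteq> {a<..<b}}"
  define s where "s = Inf ?S"
  have "measure lebesgue {a<..<b} \<in> ?S" using bdd by (intro CollectI exI[of _ "{a<..<b}"] conjI) auto
  then have ne: "?S \<noteq> {}" by (metis empty_iff)
  have bb: "bdd_below ?S" by (rule bdd_belowI[of _ 0]) auto
  have fin: "U \<in> lmeasurable" if "open U" "U \<subseteq> {a<..<b}" for U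
    using that by (intro lmeasurable_open) (auto intro: bounded_subset[OF bounded_Ioo])
  have s0: "0 \<le> s" unfolding s_def using ne by (intro cInf_greatest) auto
  have step: "q * s \<le> p * s + (p + q) * e" if e: "e > 0" for e
  proof -
    obtain U where U: "open U" "E \<subseteq> U" "U \<subseteq> {a<..<b}" "measure lebesgue U < s + e"
      using cInf_lessD[OF ne, of "s + e"] e unfolding s_def by auto
    obtain V where V: "V \<in> sets borel" "V \<subseteq> U" "negligible (E - V)" "ennreal q * emeasure lborel V \<le> ennreal p * emeasure lborel U"
      by (rule dini_cover_shrink[OF F pq lo hi U(1,2)], rule that)
    have Vl: "V \<in> lmeasurable" by (rule fmeasurableI2[OF fin[OF U(1,3)] V(2)]) (use V(1) in auto)
    have em: "emeasure lborel X = ennreal (measure lebesgue X)" if "X \<in> lmeasurable" "X \<in> sets borel" for X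
      using emeasure_eq_measure2[OF that(1)] that(2) by simp
    have qV: "q * measure lebesgue V \<le> p * measure lebesgue U"
      using V(4) pq em[OF Vl V(1)] em[OF fin[OF U(1,3)]] U(1)
      by (simp add: ennreal_mult[symmetric])
    have VEl: "V \<union> (E - V) \<in> lmeasurable" by (rule fmeasurable.Un[OF Vl negligible_imp_measurable[OF V(3)]])
    \<comment> \<open>\<open>V\<close> with the null remainder covers \<open>E\<close> but need not
      be open, so it is enlarged to an open \<open>T\<close> at cost \<open>e\<close> before it
      competes in the infimum.\<close>
    then obtain T where T: "open T" "V \<union> (E - V) \<subseteq> T" "T - (V \<union> (E - V)) \<in> lmeasurable" "emeasure lebesgue (T - (V \<union> (E - V))) < ennreal e"
      using sets_lebesgue_outer_open[of "V \<union> (E - V)" e] e by (auto simp: fmeasurableD)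
    have Te: "measure lebesgue (T - (V \<union> (E - V))) < e"
      using T(3,4) e by (simp add: emeasure_eq_measure2 ennreal_less_iff)
    have Teq: "T = (V \<union> (E - V)) \<union> (T - (V \<union> (E - V)))" using T(2) by blast
    have Tl: "T \<in> lmeasurable" by (subst Teq) (intro fmeasurable.Un T VEl)
    have TV: "measure lebesgue T \<le> measure lebesgue (V \<union> (E - V)) + measure lebesgue (T - (V \<union> (E - V)))"
      by (subst (1) Teq) (intro measure_Un_le fmeasurableD T(3) VEl)
    have VE: "measure lebesgue (V \<union> (E - V)) = measure lebesgue V"
      using V(3) Vl by (intro measure_negligible_symdiff) (auto intro: negligible_subset)
    have "s \<le> measure lebesgue (T \<inter> {a<..<b})"
      unfolding s_def by (intro cInf_lower[OF _ bb] CollectI exI[of _ "T \<inter> {a<..<b}"] conjI) (use T bdd in auto)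
    also have "\<dots> \<le> measure lebesgue T" using Tl T(1) by (intro measure_mono_fmeasurable) auto
    also have "\<dots> \<le> measure lebesgue V + e" using TV Te VE by linarith
    finally have "q * s \<le> q * measure lebesgue V + q * e" using pq by (simp flip: distrib_left)
    also have "\<dots> \<le> p * (s + e) + q * e" using qV U(4) pq mult_left_mono[of "measure lebesgue U" "s + e" p] by linarith
    finally show ?thesis by (simp add: algebra_simps)
  qed
  have "q * s \<le> p * s"
  proof (rule field_le_epsilon)
    fix e :: real assume "e > 0"
    then show "q * s \<le> p * s + e" using step[of "e / (p + q)"] pq by simp
  qed
  then have "s = 0" using pq s0 mult_le_cancel_right[of q s p] by auto
  show ?thesis unfolding negligible_outer
  proof (intro allI impI)
    fix e :: real assume "e > 0"
    then obtain U where "open U" "E \<subseteq> U" "U \<subseteq> {a<..<b}" "measure lebesgue U < e"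
      using cInf_lessD[OF ne, of e] \<open>s = 0\<close> unfolding s_def by auto
    then show "\<exists>T. E \<subseteq> T \<and> T \<in> lmeasurable \<and> measure lebesgue T < e" using fin by blast
  qed
qed

text \<open>Vitali's theorem wants intervals containing \<open>x\<close>, whereas a derivative
  concerns increments of either sign; for \<open>h < 0\<close> the interval is
  \<open>[x + h, x]\<close>, with the same quotient.\<close>

lemma frequently_difference_quotient:
  fixes F :: "real \<Rightarrow> real"
  assumes "\<exists>\<^sub>F h in at 0. Q ((F (x + h) - F x) / h)" "d > 0"
  shows "\<exists>u v. u \<le> x \<and> x \<le> v \<and> u < v \<and> v - u < d \<and> Q ((F v - F u) / (v - u))"
proof -
  have "\<not> (\<forall>\<^sub>F h in at 0. \<not> Q ((F (x + h) - F x) / h))" using assms by (simp add: frequently_def)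
  then obtain h where h: "h \<noteq> 0" "dist h 0 < d" "Q ((F (x + h) - F x) / h)"
    using assms(2) unfolding eventually_at by auto
  show ?thesis
  proof (cases "h > 0")
    case True
    then show ?thesis using h by (intro exI[of _ x] exI[of _ "x + h"]) auto
  next
    case False
    have "(F x - F (x + h)) / (x - (x + h)) = (F (x + h) - F x) / h"
      using h(1) by (simp add: field_simps)
    then show ?thesis using False h by (rule_tac exI[of _ "x + h"], rule_tac exI[of _ x]) auto
  qed
qed

text \<open>By boundedness liminf and limsup are finite, so they agree or leave room for two
  rationals. Rationality later makes the exceptional set a countable union.\<close>

lemma real_convergent_or_gap:
  fixes \<Phi> :: "'a \<Rightarrow> real"
  assumes bd: "\<forall>\<^sub>F h in G. \<bar>\<Phi> h\<bar> \<le> B" and nb: "G \<noteq> bot"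
  shows "(\<exists>D. (\<Phi> \<longlongrightarrow> D) G) \<or> (\<exists>p q. p \<in> \<rat> \<and> q \<in> \<rat> \<and> p < q \<and> (\<exists>\<^sub>F h in G. \<Phi> h < p) \<and> (\<exists>\<^sub>F h in G. \<Phi> h > q))"
proof -
  let ?f = "\<lambda>h. ereal (\<Phi> h)"
  let ?li = "Liminf G ?f" and ?ls = "Limsup G ?f"
  have le: "?li \<le> ?ls" using nb by (rule Liminf_le_Limsup)
  have lo: "ereal (- B) \<le> ?li"
    by (rule Liminf_bounded, rule eventually_mono[OF bd]) auto
  have hi: "?ls \<le> ereal B"
    by (rule Limsup_bounded, rule eventually_mono[OF bd]) auto
  show ?thesis
  proof (cases "?li = ?ls")
    case True
    have "?li \<noteq> \<infinity>" "?li \<noteq> - \<infinity>" using lo hi le by auto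
    then obtain D where "?li = ereal D" by (cases ?li) auto
    then have "(?f \<longlongrightarrow> ereal D) G" using True nb tendsto_iff_Liminf_eq_Limsup[of G ?f "ereal D"] by metis
    then show ?thesis by auto
  next
    case False
    then have "?li < ?ls" using le by simp
    then obtain p0 where p0: "?li < ereal p0" "ereal p0 < ?ls" using ereal_dense2 by blast
    then obtain q0 where q0: "ereal p0 < ereal q0" "ereal q0 < ?ls" using ereal_dense2 by blast
    obtain p where p: "p \<in> \<rat>" "p0 < p" "p < (p0 + q0) / 2" using Rats_dense_in_real[of p0 "(p0 + q0) / 2"] q0 by auto
    obtain q where q: "q \<in> \<rat>" "(p0 + q0) / 2 < q" "q < q0" using Rats_dense_in_real[of "(p0 + q0) / 2" q0] q0 by auto
    have "\<exists>\<^sub>F h in G. \<Phi> h < p"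
    proof (rule ccontr)
      assume "\<not> (\<exists>\<^sub>F h in G. \<Phi> h < p)"
      then have "\<forall>\<^sub>F h in G. ereal p \<le> ?f h" by (simp add: frequently_def not_less)
      then have "ereal p \<le> ?li" by (rule Liminf_bounded)
      then show False using p0 p by (metis ereal_less_eq(3) less_le_not_le order_trans less_eq_real_def)
    qed
    moreover have "\<exists>\<^sub>F h in G. \<Phi> h > q"
    proof (rule ccontr)
      assume "\<not> (\<exists>\<^sub>F h in G. \<Phi> h > q)"
      then have "\<forall>\<^sub>F h in G. ?f h \<le> ereal q" by (simp add: frequently_def not_less)
      then have "?ls \<le> ereal q" by (rule Limsup_bounded)
      then show False using q0 q by (metis ereal_less_eq(3) less_le_not_le order_trans less_eq_real_def)
    qed
    moreover have "p < q" using p q by simp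
    ultimately show ?thesis using p(1) q(1) by blast
  qed
qed

text \<open>Adding \<open>2 * x\<close> makes the function increasing with all difference quotients
  in \<open>[1, 3]\<close>. It then has a Stieltjes measure, and a point without derivative shows a
  rational gap between its lower and upper quotients.\<close>

theorem lipschitz_differentiable_AE:
  fixes f :: "real \<Rightarrow> real"
  assumes lip: "\<And>x y. \<bar>f x - f y\<bar> \<le> \<bar>x - y\<bar>"
  shows "negligible {x. \<not> (\<exists>D. (f has_real_derivative D) (at x))}"
proof -
  define F where "F x = f x + 2 * x" for x
  have Fb: "(y - x) \<le> F y - F x \<and> F y - F x \<le> 3 * (y - x)" if "x \<le> y" for x y
    using lip[of y x] that by (auto simp: F_def)
  have mono: "mono F" using Fb by (force simp: mono_def)
  have cont: "continuous_on UNIV F"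
  proof -
    have "1-lipschitz_on UNIV f" using lip by (auto simp: lipschitz_on_def dist_real_def)
    then have "continuous_on UNIV f" by (rule lipschitz_on_continuous_on)
    then show ?thesis unfolding F_def by (intro continuous_intros)
  qed
  let ?\<Phi> = "\<lambda>x h. (F (x + h) - F x) / h"
  have Phi: "1 \<le> ?\<Phi> x h" "?\<Phi> x h \<le> 3" if "h \<noteq> 0" for x h
    using Fb[of x "x + h"] Fb[of "x + h" x] that by (cases "h > 0"; simp add: field_simps)+
  let ?E = "\<lambda>p q n. {x. (\<exists>\<^sub>F h in at 0. ?\<Phi> x h < p) \<and> (\<exists>\<^sub>F h in at 0. ?\<Phi> x h > q)} \<inter> {- real n<..<real n}"
  have null: "negligible (?E p q n)" if "p < q" for p q :: real and n
  proof (cases "p > 0")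
    case True
    show ?thesis
    proof (rule dini_gap_negligible[OF mono cont True \<open>p < q\<close>])
      show "\<forall>x\<in>?E p q n. \<forall>d>0. \<exists>u v. u \<le> x \<and> x \<le> v \<and> u < v \<and> v - u < d \<and> F v - F u < p * (v - u)"
      proof (intro ballI allI impI)
        fix x d :: real assume "x \<in> ?E p q n" "d > 0"
        then have "\<exists>\<^sub>F h in at 0. ?\<Phi> x h < p" by blast
        from frequently_difference_quotient[of "\<lambda>t. t < p", OF this \<open>d > 0\<close>]
        obtain u v where "u \<le> x" "x \<le> v" "u < v" "v - u < d" "(F v - F u) / (v - u) < p" by blast
        then show "\<exists>u v. u \<le> x \<and> x \<le> v \<and> u < v \<and> v - u < d \<and> F v - F u < p * (v - u)"
          by (intro exI[of _ u] exI[of _ v]) (auto simp: divide_less_eq)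
      qed
      show "\<forall>x\<in>?E p q n. \<forall>d>0. \<exists>u v. u \<le> x \<and> x \<le> v \<and> u < v \<and> v - u < d \<and> F v - F u > q * (v - u)"
      proof (intro ballI allI impI)
        fix x d :: real assume "x \<in> ?E p q n" "d > 0"
        then have "\<exists>\<^sub>F h in at 0. ?\<Phi> x h > q" by blast
        from frequently_difference_quotient[of "\<lambda>t. t > q", OF this \<open>d > 0\<close>]
        obtain u v where "u \<le> x" "x \<le> v" "u < v" "v - u < d" "(F v - F u) / (v - u) > q" by blast
        then show "\<exists>u v. u \<le> x \<and> x \<le> v \<and> u < v \<and> v - u < d \<and> F v - F u > q * (v - u)"
          by (intro exI[of _ u] exI[of _ v]) (auto simp: less_divide_eq)
      qed
      show "?E p q n \<subseteq> {- real n<..<real n}" by blast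
    qed
  next
    case False
    have "\<forall>\<^sub>F h in at 0. \<not> ?\<Phi> x h < p" for x
      unfolding eventually_at using Phi(1)[of _ x] False by (intro exI[of _ 1]) (force simp: not_less)
    \<comment> \<open>All quotients are at least 1, so for \<open>p <= 0\<close> none lies below
      \<open>p\<close>.\<close>
    then have "?E p q n = {}" by (auto simp: frequently_def)
    then show ?thesis by simp
  qed
  let ?I = "{(p, q, n). p \<in> \<rat> \<and> q \<in> \<rat> \<and> p < q \<and> n \<in> (UNIV :: nat set)}"
  have "countable ?I"
    by (rule countable_subset[of _ "\<rat> \<times> \<rat> \<times> UNIV"]) (auto intro!: countable_SIGMA countable_rat)
  then have "negligible (\<Union>(p, q, n)\<in>?I. ?E p q n)"
    using null by (intro negligible_countable_Union) auto
  moreover have "{x. \<not> (\<exists>D. (f has_real_derivative D) (at x))} \<subseteq> (\<Union>(p, q, n)\<in>?I. ?E p q n)"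
  proof
    fix x assume x: "x \<in> {x. \<not> (\<exists>D. (f has_real_derivative D) (at x))}"
    have "\<forall>\<^sub>F h in at 0. \<bar>?\<Phi> x h\<bar> \<le> 3"
      unfolding eventually_at using Phi[of _ x] by (intro exI[of _ 1]) (force simp: abs_le_iff)
    from real_convergent_or_gap[OF this] consider D where "(?\<Phi> x \<longlongrightarrow> D) (at 0)"
      | p q where "p \<in> \<rat>" "q \<in> \<rat>" "p < q" "\<exists>\<^sub>F h in at 0. ?\<Phi> x h < p" "\<exists>\<^sub>F h in at 0. ?\<Phi> x h > q" by auto
    then show "x \<in> (\<Union>(p, q, n)\<in>?I. ?E p q n)"
    proof cases
      case 1
      then have "(F has_real_derivative D) (at x)" by (simp add: DERIV_def)
      then have "((\<lambda>x. F x - 2 * x) has_real_derivative (D - 2)) (at x)"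
        by (auto intro!: derivative_eq_intros)
      then have "(f has_real_derivative (D - 2)) (at x)" by (simp add: F_def)
      then show ?thesis using x by blast
    next
      case 2
      obtain n where "\<bar>x\<bar> < real n" using reals_Archimedean2 by blast
      then show ?thesis using 2 by (intro UN_I[of "(p, q, n)"]) auto
    qed
  qed
  ultimately show ?thesis by (rule negligible_subset)
qed

lemma difference_quotient_LIMSEQ:
  fixes F :: "real \<Rightarrow> real"
  assumes "(F has_real_derivative D) (at x)"
  shows "(\<lambda>n. real (Suc n) * (F (x + 1 / real (Suc n)) - F x)) \<longlonglongrightarrow> D"
proof -
  have "filterlim (\<lambda>n. 1 / real (Suc n)) (at 0) sequentially"
    using LIMSEQ_inverse_real_of_nat by (intro filterlim_atI) (auto simp: inverse_eq_divide)
  moreover have "((\<lambda>h. (F (x + h) - F x) / h) \<longlongrightarrow> D) (at 0)" using assms by (simp add: DERIV_def)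
  ultimately have "(\<lambda>n. (F (x + 1 / real (Suc n)) - F x) / (1 / real (Suc n))) \<longlonglongrightarrow> D"
    by (rule filterlim_compose[rotated])
  then show ?thesis by (simp add: mult.commute)
qed

lemma integrable_indicator_Icc: "integrable lebesgue (indicat_real {a..c :: real})"
  by (rule integrable_real_indicator) (auto simp: emeasure_lborel_Icc_eq)

lemma integrable_indicator_bounded:
  fixes g :: "real \<Rightarrow> real"
  assumes "g \<in> borel_measurable lebesgue" "\<And>x. \<bar>g x\<bar> \<le> B"
  shows "integrable lebesgue (\<lambda>x. indicator {a..c} x * g x)"
proof (rule Bochner_Integration.integrable_bound)
  show "integrable lebesgue (\<lambda>x. B * indicator {a..c} x)" by (intro integrable_mult_right integrable_indicator_Icc)
  show "AE x in lebesgue. norm (indicator {a..c} x * g x) \<le> norm (B * indicator {a..c} x)"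
    using assms(2) by (intro AE_I2) (force simp: indicator_def intro: order_trans)
  show "(\<lambda>x. indicator {a..c} x * g x) \<in> borel_measurable lebesgue"
    by (intro borel_measurable_times borel_measurable_indicator assms(1)) auto
qed

text \<open>\<open>d\<close> is a bounded measurable version of \<open>deriv y\<close> defined
  everywhere. The fundamental theorem for it follows by dominated convergence from the integrals of
  difference quotients.\<close>

lemma lipschitz_derivative:
  fixes y :: "real \<Rightarrow> real"
  assumes lip: "1-lipschitz_on {0..l} y" and l: "l > 0"
  obtains d where "d \<in> borel_measurable lebesgue" "\<And>x. \<bar>d x\<bar> \<le> 1"
    "AE x in lebesgue. x \<in> {0..l} \<longrightarrow> deriv y x = d x"
    "\<And>a c. 0 \<le> a \<Longrightarrow> a \<le> c \<Longrightarrow> c \<le> l \<Longrightarrow> (\<integral>x. indicator {a..c} x * d x \<partial>lebesgue) = y c - y a"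
proof -
  \<comment> \<open>Constant extension beyond \<open>[0, l]\<close>, so that forward quotients near
    \<open>l\<close> make sense and differentiability can be quoted on the whole line.\<close>
  define f where "f x = y (max 0 (min l x))" for x
  have flip: "\<bar>f x - f z\<bar> \<le> \<bar>x - z\<bar>" for x z
  proof -
    have "\<bar>f x - f z\<bar> \<le> \<bar>max 0 (min l x) - max 0 (min l z)\<bar>"
      using lipschitz_onD[OF lip, of "max 0 (min l x)" "max 0 (min l z)"] l by (auto simp: f_def dist_real_def)
    also have "\<dots> \<le> \<bar>x - z\<bar>" by (auto simp: max_def min_def)
    finally show ?thesis .
  qed
  have fy: "f x = y x" if "x \<in> {0..l}" for x using that by (simp add: f_def)
  have cont: "continuous_on A f" for A
  proof -
    have "1-lipschitz_on UNIV f" using flip by (auto simp: lipschitz_on_def dist_real_def)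
    then show ?thesis using lipschitz_on_continuous_on continuous_on_subset by blast
  qed
  have fm [measurable]: "f \<in> borel_measurable borel" using cont by (rule borel_measurable_continuous_onI)
  define g where "g n x = real (Suc n) * (f (x + 1 / real (Suc n)) - f x)" for n x
  have gm [measurable]: "g n \<in> borel_measurable borel" for n unfolding g_def by measurable
  have gb: "\<bar>g n x\<bar> \<le> 1" for n x
  proof -
    have "\<bar>g n x\<bar> = real (Suc n) * \<bar>f (x + 1 / real (Suc n)) - f x\<bar>" by (simp add: g_def abs_mult)
    also have "\<dots> \<le> real (Suc n) * (1 / real (Suc n))"
      using flip[of "x + 1 / real (Suc n)" x] by (intro mult_left_mono) auto
    finally show ?thesis by simp
  qed
  \<comment> \<open>Where the quotients have no limit, \<open>lim\<close> is arbitrary; clamping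
    keeps \<open>|d| <= 1\<close> there too.\<close>
  define d where "d x = max (-1) (min 1 (lim (\<lambda>n. g n x)))" for x
  have dm [measurable]: "d \<in> borel_measurable borel" unfolding d_def by measurable
  have db: "\<bar>d x\<bar> \<le> 1" for x by (auto simp: d_def)
  have dD: "d x = D \<and> (\<lambda>n. g n x) \<longlonglongrightarrow> D" if "(f has_real_derivative D) (at x)" for x D
  proof -
    have lim: "(\<lambda>n. g n x) \<longlonglongrightarrow> D" unfolding g_def by (rule difference_quotient_LIMSEQ[OF that])
    have "\<bar>D\<bar> \<le> 1" by (rule tendsto_upperbound[OF tendsto_rabs[OF lim]]) (use gb in auto)
    then show ?thesis using lim limI[OF lim] by (auto simp: d_def)
  qed
  have AEdiff: "AE x in lebesgue. \<exists>D. (f has_real_derivative D) (at x)"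
    by (rule AE_I'[OF lipschitz_differentiable_AE[of f, OF flip, unfolded negligible_iff_null_sets]]) simp
  \<comment> \<open>At 0 and \<open>l\<close> the value of \<open>deriv y\<close> also depends on
    \<open>y\<close> outside the interval, where it is unrelated to \<open>f\<close>.\<close>
  have AEends: "AE x in lebesgue. x \<noteq> 0 \<and> x \<noteq> l"
    by (rule AE_I'[of "{0, l}"]) (auto intro!: null_sets_completionI countable_imp_null_set_lborel)
  show ?thesis
  proof (rule that[of d])
    show "d \<in> borel_measurable lebesgue" by (rule measurable_completion) measurable
    show "\<bar>d x\<bar> \<le> 1" for x by (rule db)
    show "AE x in lebesgue. x \<in> {0..l} \<longrightarrow> deriv y x = d x"
      using AEdiff AEends
    proof eventually_elim
      case (elim x)
      then obtain D where D: "(f has_real_derivative D) (at x)" by blast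
      show ?case
      proof
        assume "x \<in> {0..l}"
        then have x: "x \<in> {0<..<l}" using elim by auto
        have "(y has_real_derivative D) (at x)"
          by (rule has_field_derivative_transform_within_open[OF D, of "{0<..<l}"]) (use x fy in auto)
        then show "deriv y x = d x" using dD[OF D] DERIV_imp_deriv by blast
      qed
    qed
    fix a c assume ac: "0 \<le> a" "a \<le> c" "c \<le> l"
    \<comment> \<open>The interval is larger than \<open>[0, l]\<close> so that
      \<open>x + 1 / (n + 1)\<close> is still an interior point for every \<open>x\<close> up to
      \<open>l\<close>.\<close>
    obtain \<Phi> where Phi0: "\<And>x. x \<in> {-1..l + 2} \<Longrightarrow> (\<Phi> has_vector_derivative f x) (at x within {-1..l + 2})"
      using antiderivative_continuous[OF cont] by blast
    have Phi: "(\<Phi> has_real_derivative f x) (at x)" if "x \<in> {0..l + 1}" for x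
      using Phi0[of x] at_within_Icc_at[of "-1" x "l + 2"] that
      by (simp add: has_real_derivative_iff_has_vector_derivative)
    \<comment> \<open>The integral of a difference quotient of \<open>f\<close> is a difference of
      two difference quotients of \<open>\<Phi>\<close>, which tends to \<open>f c - f a\<close>
      because \<open>\<Phi>\<close> has derivative \<open>f\<close>.\<close>
    define G where "G n x = real (Suc n) * (\<Phi> (x + 1 / real (Suc n)) - \<Phi> x)" for n x
    have int: "(\<integral>x. indicator {a..c} x * g n x \<partial>lebesgue) = G n c - G n a" for n
    proof -
      have "(\<integral>x. indicator {a..c} x * g n x \<partial>lebesgue) = (\<integral>x. g n x * indicator {a..c} x \<partial>lborel)"
        by (subst integral_completion) (auto simp: mult.commute)
      also have "\<dots> = G n c - G n a"
      proof (rule integral_FTC_Icc_real[OF ac(2)])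
        fix x assume x: "a \<le> x" "x \<le> c"
        have "1 / real (Suc n) \<le> 1" by simp
        then have xs: "x \<in> {0..l + 1}" "x + 1 / real (Suc n) \<in> {0..l + 1}" using x ac l by (simp_all add: add_mono)
        have "((\<lambda>x. \<Phi> (x + 1 / real (Suc n))) has_real_derivative f (x + 1 / real (Suc n))) (at x)"
          using Phi[OF xs(2)] by (simp add: DERIV_shift)
        then show "(G n has_real_derivative g n x) (at x)"
          unfolding G_def g_def using Phi[OF xs(1)] by (auto intro!: derivative_eq_intros)
        have "continuous_on UNIV (g n)"
          unfolding g_def by (intro continuous_intros continuous_on_compose2[OF cont[of UNIV]]) auto
        then show "isCont (g n) x" by (simp add: continuous_on_eq_continuous_at)
      qed
      finally show ?thesis .
    qed
    have lim1: "(\<lambda>n. G n c - G n a) \<longlonglongrightarrow> f c - f a"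
      unfolding G_def using Phi ac by (intro tendsto_diff difference_quotient_LIMSEQ) auto
    have lim2: "(\<lambda>n. \<integral>x. indicator {a..c} x * g n x \<partial>lebesgue) \<longlonglongrightarrow> (\<integral>x. indicator {a..c} x * d x \<partial>lebesgue)"
    proof (rule integral_dominated_convergence[where w = "indicator {a..c}"])
      show "AE x in lebesgue. (\<lambda>n. indicator {a..c} x * g n x) \<longlonglongrightarrow> indicator {a..c} x * d x"
        using AEdiff by eventually_elim (metis dD tendsto_mult_left)
      show "AE x in lebesgue. norm (indicator {a..c} x * g n x) \<le> indicator {a..c} x" for n
        using gb[of n] by (intro AE_I2) (auto simp: indicator_def)
    qed (auto intro!: measurable_completion integrable_indicator_Icc)
    have "(\<integral>x. indicator {a..c} x * d x \<partial>lebesgue) = f c - f a"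
      by (rule LIMSEQ_unique[OF lim2[unfolded int] lim1])
    then show "(\<integral>x. indicator {a..c} x * d x \<partial>lebesgue) = y c - y a"
      using fy[of c] fy[of a] ac by simp
  qed
qed

section \<open>Jensen's inequality for \<open>gamma_fn\<close>\<close>

lemma sqrt_tangent:
  fixes t w :: real
  assumes "\<bar>t\<bar> < 1" "\<bar>w\<bar> \<le> 1"
  shows "sqrt (1 - w\<^sup>2) \<le> (1 - t * w) / sqrt (1 - t\<^sup>2)"
proof -
  have t: "t\<^sup>2 < 1" using assms by (simp add: abs_square_less_1)
  have "\<bar>t * w\<bar> \<le> 1" using assms by (simp add: abs_mult mult_le_one)
  then have nn: "0 \<le> 1 - t * w" by auto
  \<comment> \<open>The difference of the two sides is \<open>(t - w)^2\<close>.\<close>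
  have "(1 - w\<^sup>2) * (1 - t\<^sup>2) \<le> (1 - t * w)\<^sup>2"
    using zero_le_power2[of "t - w"] by (simp add: power2_eq_square algebra_simps)
  then have "sqrt ((1 - w\<^sup>2) * (1 - t\<^sup>2)) \<le> sqrt ((1 - t * w)\<^sup>2)" by (rule real_sqrt_le_mono)
  then have "sqrt (1 - w\<^sup>2) * sqrt (1 - t\<^sup>2) \<le> 1 - t * w" using nn by (simp add: real_sqrt_mult)
  then show ?thesis using t by (simp add: pos_le_divide_eq)
qed

lemma gamma_fn_bounds: "\<bar>w\<bar> \<le> 1 \<Longrightarrow> 0 \<le> gamma_fn w" "gamma_fn w \<le> 2"
proof -
  show "gamma_fn w \<le> 2" using real_sqrt_le_mono[of "1 - w\<^sup>2" 1] by (simp add: gamma_fn_def)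
  show "\<bar>w\<bar> \<le> 1 \<Longrightarrow> 0 \<le> gamma_fn w" by (simp add: gamma_fn_def abs_square_le_1)
qed

text \<open>Integrating the tangent line at the mean slope replaces the general Jensen inequality.
  At slope 1 or -1 the tangent is vertical, and the bound is the limit of those from tangents at
  \<open>t -> 1\<close> or \<open>t -> -1\<close>.\<close>

lemma jensen_gamma:
  fixes d :: "real \<Rightarrow> real"
  assumes d [measurable]: "d \<in> borel_measurable lebesgue" and db: "\<And>x. \<bar>d x\<bar> \<le> 1" and ac: "a \<le> c"
    and int: "(\<integral>x. indicator {a..c} x * d x \<partial>lebesgue) = D" and D: "\<bar>D\<bar> \<le> c - a"
  shows "(\<integral>x. indicator {a..c} x * gamma_fn (d x) \<partial>lebesgue) \<le> (c - a) * gamma_fn (D / (c - a))"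
proof (cases "a = c")
  case True
  have "AE x in lebesgue. indicator {a..c} x * gamma_fn (d x) = 0"
    by (rule AE_I'[of "{a}"]) (use True in \<open>auto simp: indicator_def intro!: null_sets_completionI countable_imp_null_set_lborel\<close>)
  then show ?thesis using True integral_eq_zero_AE[of "\<lambda>x. indicator {a..c} x * gamma_fn (d x)" lebesgue] by simp
next
  case False
  then have pos: "c - a > 0" using ac by simp
  define s where "s = D / (c - a)"
  have s: "\<bar>s\<bar> \<le> 1" "D = s * (c - a)" using D pos by (auto simp: s_def abs_le_iff field_simps)
  let ?I = "\<integral>x. indicator {a..c} x * gamma_fn (d x) \<partial>lebesgue"
  have gm [measurable]: "(\<lambda>x. gamma_fn (d x)) \<in> borel_measurable lebesgue" unfolding gamma_fn_def by measurable
  have gb: "\<bar>gamma_fn (d x)\<bar> \<le> 2" for x using gamma_fn_bounds[of "d x"] db[of x] by auto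
  have ind: "(\<integral>x. indicator {a..c} x \<partial>lebesgue) = c - a" using ac by simp
  have bound: "?I \<le> (c - a) * (1 + (1 - t * s) / sqrt (1 - t\<^sup>2))" if t: "\<bar>t\<bar> < 1" for t
  proof -
    let ?k = "1 / sqrt (1 - t\<^sup>2)"
    have "?I \<le> (\<integral>x. (1 + ?k) * indicator {a..c} x - t * ?k * (indicator {a..c} x * d x) \<partial>lebesgue)"
    proof (rule integral_mono)
      show "integrable lebesgue (\<lambda>x. indicator {a..c} x * gamma_fn (d x))"
        by (rule integrable_indicator_bounded[OF gm gb])
      show "integrable lebesgue (\<lambda>x. (1 + ?k) * indicator {a..c} x - t * ?k * (indicator {a..c} x * d x))"
        by (intro Bochner_Integration.integrable_diff integrable_mult_right integrable_indicator_bounded[OF d db] integrable_indicator_Icc)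
      show "indicator {a..c} x * gamma_fn (d x) \<le> (1 + ?k) * indicator {a..c} x - t * ?k * (indicator {a..c} x * d x)" for x
        using sqrt_tangent[OF t db[of x]] by (auto simp: indicator_def gamma_fn_def diff_divide_distrib)
    qed
    also have "\<dots> = (1 + ?k) * (c - a) - t * ?k * D"
      using integrable_indicator_bounded[OF d db, of a c] integrable_indicator_Icc[of a c] ind int
      by (subst Bochner_Integration.integral_diff) auto
    also have "\<dots> = (c - a) * (1 + (1 - t * s) / sqrt (1 - t\<^sup>2))" unfolding s(2)
      by (simp add: algebra_simps diff_divide_distrib)
    finally show ?thesis .
  qed
  show ?thesis
  proof (cases "\<bar>s\<bar> < 1")
    case True
    have "(1 - s * s) / sqrt (1 - s\<^sup>2) = sqrt (1 - s\<^sup>2)"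
      using real_div_sqrt[of "1 - s\<^sup>2"] s(1) by (simp add: power2_eq_square[of s] abs_square_le_1[unfolded power2_eq_square])
    then show ?thesis using bound[OF True] unfolding s_def[symmetric] by (simp add: gamma_fn_def)
  next
    case False
    then have s1: "s = 1 \<or> s = -1" using s(1) by auto
    \<comment> \<open>\<open>(1 - t) / sqrt (1 - t^2)\<close> is
      \<open>sqrt ((1 - t) / (1 + t))\<close>, which vanishes as \<open>t\<close> tends to
      1.\<close>
    have lim: "((\<lambda>t. (c - a) * (1 + (1 - t) / sqrt (1 - t\<^sup>2))) \<longlongrightarrow> (c - a) * (1 + 0)) (at_left 1)"
    proof (intro tendsto_intros)
      have ev: "\<forall>\<^sub>F t in at_left (1::real). sqrt (1 - t) / sqrt (1 + t) = (1 - t) / sqrt (1 - t\<^sup>2)"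
        unfolding eventually_at_left_field
      proof (intro exI[of _ 0] conjI allI impI)
        fix t :: real assume t: "0 < t" "t < 1"
        have e: "1 - t\<^sup>2 = (1 - t) * (1 + t)" by (simp add: power2_eq_square algebra_simps)
        have "sqrt (1 - t) * sqrt (1 - t) = 1 - t" using t by simp
        then show "sqrt (1 - t) / sqrt (1 + t) = (1 - t) / sqrt (1 - t\<^sup>2)"
          unfolding e real_sqrt_mult using t by (metis diff_gt_0_iff_gt less_irrefl mult_divide_mult_cancel_left real_sqrt_gt_zero)
      qed simp
      have "((\<lambda>t. sqrt (1 - t) / sqrt (1 + t)) \<longlongrightarrow> sqrt (1 - 1) / sqrt (1 + 1)) (at_left (1::real))"
        by (intro tendsto_intros) auto
      then show "((\<lambda>t. (1 - t) / sqrt (1 - t\<^sup>2)) \<longlongrightarrow> 0) (at_left (1::real))"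
        using ev by (auto intro: Lim_transform_eventually)
    qed
    have ev: "\<forall>\<^sub>F t in at_left (1::real). ?I \<le> (c - a) * (1 + (1 - t) / sqrt (1 - t\<^sup>2))"
      unfolding eventually_at_left_field
    proof (intro exI[of _ 0] conjI allI impI)
      fix t :: real assume t: "0 < t" "t < 1"
      show "?I \<le> (c - a) * (1 + (1 - t) / sqrt (1 - t\<^sup>2))"
        using s1 bound[of t] bound[of "-t"] t by auto
    qed simp
    have "?I \<le> (c - a) * (1 + 0)" by (rule tendsto_lowerbound[OF lim ev]) simp
    moreover have "gamma_fn s = 1" using s1 by (auto simp: gamma_fn_def)
    ultimately show ?thesis unfolding s_def[symmetric] by simp
  qed
qed

section \<open>Last passage times on the integer grid\<close>

text \<open>
  For nonnegative weights, \<open>lpt w m n\<close> is the last passage time through the box with \<open>m\<close> columns and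
  \<open>n\<close> rows, from \<open>(0, 0)\<close> to \<open>(m - 1, n - 1)\<close>; an empty box has value 0.
\<close>

fun lpt :: "(nat \<times> nat \<Rightarrow> real) \<Rightarrow> nat \<Rightarrow> nat \<Rightarrow> real" where
  "lpt w 0 n = 0"
| "lpt w (Suc m) 0 = 0"
| "lpt w (Suc m) (Suc n) = w (m, n) + max (lpt w m (Suc n)) (lpt w (Suc m) n)"

definition shiftw :: "nat \<times> nat \<Rightarrow> (nat \<times> nat \<Rightarrow> real) \<Rightarrow> nat \<times> nat \<Rightarrow> real" where
  "shiftw p w = (\<lambda>(i, j). w (fst p + i, snd p + j))"

lemma shiftw_apply [simp]: "shiftw p w (i, j) = w (fst p + i, snd p + j)"
  by (simp add: shiftw_def)

lemma shiftw_zero [simp]: "shiftw (0, 0) w = w"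
  by (auto simp: shiftw_def)

lemma shiftw_shiftw: "shiftw p (shiftw q w) = shiftw (fst q + fst p, snd q + snd p) w"
  by (auto simp: shiftw_def add.assoc)

lemma lpt_0_right [simp]: "lpt w m 0 = 0"
  by (cases m) auto

lemma lpt_nonneg: "(\<And>i j. i < m \<Longrightarrow> j < n \<Longrightarrow> w (i, j) \<ge> 0) \<Longrightarrow> lpt w m n \<ge> 0"
  by (induction w m n rule: lpt.induct) (auto intro!: add_nonneg_nonneg simp: le_max_iff_disj)

lemma lpt_cong: "(\<And>i j. i < m \<Longrightarrow> j < n \<Longrightarrow> w (i, j) = v (i, j)) \<Longrightarrow> lpt w m n = lpt v m n"
  by (induction w m n rule: lpt.induct) auto

lemma lpt_mono: "(\<And>i j. i < m \<Longrightarrow> j < n \<Longrightarrow> w (i, j) \<le> v (i, j)) \<Longrightarrow> lpt w m n \<le> lpt v m n"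
proof (induction w m n rule: lpt.induct)
  case (3 w m n)
  have "lpt w m (Suc n) \<le> lpt v m (Suc n)" "lpt w (Suc m) n \<le> lpt v (Suc m) n" "w (m, n) \<le> v (m, n)"
    using 3 by auto
  then show ?case by (simp add: max.coboundedI1 max.coboundedI2 add_mono)
qed auto

lemma lpt_scale: "c \<ge> 0 \<Longrightarrow> lpt (\<lambda>p. c * w p) m n = c * lpt w m n"
  by (induction w m n rule: lpt.induct) (auto simp: distrib_left max_mult_distrib_left)

lemma lpt_one_row: "(\<And>i. i < m \<Longrightarrow> w (i, 0) \<ge> 0) \<Longrightarrow> lpt w m (Suc 0) = (\<Sum>i<m. w (i, 0))"
proof (induction m)
  case (Suc m)
  then have "(\<Sum>i<m. w (i, 0)) \<ge> 0" by (intro sum_nonneg) auto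
  with Suc show ?case by auto
qed simp

lemma lpt_one_col: "(\<And>j. j < n \<Longrightarrow> w (0, j) \<ge> 0) \<Longrightarrow> lpt w (Suc 0) n = (\<Sum>j<n. w (0, j))"
proof (induction n)
  case (Suc n)
  then have "(\<Sum>j<n. w (0, j)) \<ge> 0" by (intro sum_nonneg) auto
  with Suc show ?case by auto
qed simp

lemma lpt_step_left:
  assumes "\<And>i j. i \<le> m \<Longrightarrow> j < n \<Longrightarrow> w (i, j) \<ge> 0"
  shows "lpt w m n \<le> lpt w (Suc m) n"
proof (cases n)
  case (Suc k)
  then show ?thesis using assms[of m k] by (auto simp: max_def)
qed simp

lemma lpt_step_right:
  assumes "\<And>i j. i < m \<Longrightarrow> j \<le> n \<Longrightarrow> w (i, j) \<ge> 0"
  shows "lpt w m n \<le> lpt w m (Suc n)"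
proof (cases m)
  case (Suc k)
  then show ?thesis using assms[of k n] by (auto simp: max_def)
qed simp

lemma lpt_size_mono:
  assumes "\<And>i j. i < m' \<Longrightarrow> j < n' \<Longrightarrow> w (i, j) \<ge> 0" "m \<le> m'" "n \<le> n'"
  shows "lpt w m n \<le> lpt w m' n'"
proof -
  have "lpt w m n \<le> lpt w (m + k) n" if "m + k \<le> m'" for k
    using that
  proof (induction k)
    case (Suc k)
    then show ?case
      using lpt_step_left[of "m + k" n w] assms by (force intro: order_trans)
  qed simp
  from this[of "m' - m"] have 1: "lpt w m n \<le> lpt w m' n" using assms by simp
  have "lpt w m' n \<le> lpt w m' (n + k)" if "n + k \<le> n'" for k
    using that
  proof (induction k)
    case (Suc k)
    then show ?case
      using lpt_step_right[of m' "n + k" w] assms by (force intro: order_trans)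
  qed simp
  from this[of "n' - n"] 1 show ?thesis using assms by simp
qed

text \<open>Two optimal paths are joined at \<open>(m, n)\<close>, the last site of the first box
  and the first site of the second; the left side counts it twice.\<close>

lemma lpt_superadditive:
  assumes "\<And>p. w p \<ge> 0"
  shows "i > 0 \<Longrightarrow> j > 0 \<Longrightarrow>
    lpt w (Suc m) (Suc n) + lpt (shiftw (m, n) w) i j \<le> lpt w (m + i) (n + j) + w (m, n)"
proof (induction "shiftw (m, n) w" i j rule: lpt.induct)
  case (3 i j)
  let ?v = "shiftw (m, n) w"
  have nn: "lpt u a b \<ge> 0" if "u = w \<or> u = ?v" for u a b
    using that assms by (intro lpt_nonneg) auto
  show ?case
  proof (cases "i = 0 \<and> j = 0")
    case False
    have l: "lpt ?v i (Suc j) = 0" if "i = 0" using that by simp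
    have r: "lpt ?v (Suc i) j = 0" if "j = 0" using that by simp
    have A: "lpt w (Suc m) (Suc n) + lpt ?v i (Suc j) \<le> lpt w (m + i) (n + Suc j) + w (m, n)" if "i > 0"
      using "3.hyps"(1) that by simp
    have B: "lpt w (Suc m) (Suc n) + lpt ?v (Suc i) j \<le> lpt w (m + Suc i) (n + j) + w (m, n)" if "j > 0"
      using "3.hyps"(2) that by simp
    have "lpt w (Suc m) (Suc n) + max (lpt ?v i (Suc j)) (lpt ?v (Suc i) j)
        \<le> max (lpt w (m + i) (n + Suc j)) (lpt w (m + Suc i) (n + j)) + w (m, n)"
      using A B l r False nn[of ?v i "Suc j"] nn[of ?v "Suc i" j]
      by (cases "i = 0"; cases "j = 0") (auto simp: max_def)
    then show ?thesis by (simp add: algebra_simps)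
  qed auto
qed auto

text \<open>An up-right path meets the antidiagonal \<open>i + j = t\<close> exactly once. Cutting
  an optimal path there counts the cut site twice, which only helps for nonnegative weights.\<close>

lemma lpt_cut:
  assumes "\<And>p. w p \<ge> 0"
  shows "t \<le> m + n \<Longrightarrow> \<exists>i j. i \<le> m \<and> j \<le> n \<and> i + j = t \<and>
    lpt w (Suc m) (Suc n) \<le> lpt w (Suc i) (Suc j) + lpt (shiftw (i, j) w) (Suc (m - i)) (Suc (n - j))"
proof (induction "m + n - t" arbitrary: m n)
  case 0
  then have "t = m + n" by simp
  have "lpt (shiftw (m, n) w) (Suc 0) (Suc 0) \<ge> 0" using assms by (intro lpt_nonneg) auto
  then show ?case using \<open>t = m + n\<close> by (intro exI[of _ m] exI[of _ n]) auto
next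
  case (Suc d)
  note le = max.cobounded1 max.cobounded2
  have nn: "lpt w a b \<ge> 0" for a b using assms by (intro lpt_nonneg) auto
  have A: ?case if m: "m = Suc m'" and max: "lpt w (Suc m) (Suc n) = w (m, n) + lpt w (Suc m') (Suc n)" for m'
  proof -
    have "d = m' + n - t" "t \<le> m' + n" using Suc m by auto
    from Suc(1)[OF this] obtain i j where ij: "i \<le> m'" "j \<le> n" "i + j = t" 
       "lpt w (Suc m') (Suc n) \<le> lpt w (Suc i) (Suc j) + lpt (shiftw (i, j) w) (Suc (m' - i)) (Suc (n - j))" by blast
    have "lpt (shiftw (i, j) w) (Suc (m' - i)) (Suc (n - j)) + w (m, n) \<le> lpt (shiftw (i, j) w) (Suc (m - i)) (Suc (n - j))"
      using ij m by (simp add: Suc_diff_le)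
    with ij max m show ?thesis by (intro exI[of _ i] exI[of _ j]) (auto simp del: lpt.simps)
  qed
  have B: ?case if m: "n = Suc n'" and max: "lpt w (Suc m) (Suc n) = w (m, n) + lpt w (Suc m) (Suc n')" for n'
  proof -
    have "d = m + n' - t" "t \<le> m + n'" using Suc m by auto
    from Suc(1)[OF this] obtain i j where ij: "i \<le> m" "j \<le> n'" "i + j = t" 
       "lpt w (Suc m) (Suc n') \<le> lpt w (Suc i) (Suc j) + lpt (shiftw (i, j) w) (Suc (m - i)) (Suc (n' - j))" by blast
    have "lpt (shiftw (i, j) w) (Suc (m - i)) (Suc (n' - j)) + w (m, n) \<le> lpt (shiftw (i, j) w) (Suc (m - i)) (Suc (n - j))"
      using ij m by (simp add: Suc_diff_le)
    with ij max m show ?thesis by (intro exI[of _ i] exI[of _ j]) (auto simp del: lpt.simps)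
  qed
  \<comment> \<open>On an axis the missing predecessor is an empty box of value 0 and may tie with
    the true one; the condition makes sure that an existing predecessor is chosen.\<close>
  show ?case
  proof (cases "m > 0 \<and> (n = 0 \<or> lpt w m (Suc n) \<ge> lpt w (Suc m) n)")
    case True
    then obtain m' where "m = Suc m'" using gr0_implies_Suc by blast
    moreover have "lpt w (Suc m) (Suc n) = w (m, n) + lpt w m (Suc n)"
      using True nn[of m "Suc n"] by auto
    ultimately show ?thesis using A by simp
  next
    case False
    then have "n > 0" using Suc(2) by (cases "m = 0") auto
    then obtain n' where "n = Suc n'" using gr0_implies_Suc by blast
    moreover have "lpt w (Suc m) (Suc n) = w (m, n) + lpt w (Suc m) n"
      using False nn[of "Suc m" n] \<open>n > 0\<close> by auto
    ultimately show ?thesis using B by simp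
  qed
qed


section \<open>The lattice in grid coordinates\<close>

definition emb :: "nat \<Rightarrow> nat \<times> nat \<Rightarrow> real \<times> real" where
  "emb N p = ((real (fst p) + real (snd p)) / real N, (real (fst p) - real (snd p)) / real N)"

text \<open>The largest column index of the grid. The largest row index is the same expression with
  \<open>-b\<close>, by reflection in the x-axis.\<close>

definition gwidth :: "real \<Rightarrow> real \<Rightarrow> nat \<Rightarrow> nat" where
  "gwidth l b N = nat \<lfloor>real N * (l + b) / 2\<rfloor>"

lemma emb_inj: "N \<ge> 1 \<Longrightarrow> emb N p = emb N q \<longleftrightarrow> p = q"
  by (cases p; cases q) (auto simp: emb_def divide_simps)

lemma le_gwidth_iff:
  assumes "\<bar>b\<bar> < l"
  shows "i \<le> gwidth l b N \<longleftrightarrow> 2 * real i \<le> real N * (l + b)"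
proof -
  have "0 \<le> real N * (l + b) / 2" using assms by simp
  then have "i \<le> gwidth l b N \<longleftrightarrow> real i \<le> real N * (l + b) / 2"
    unfolding gwidth_def by (simp add: le_floor_iff le_nat_iff)
  then show ?thesis by auto
qed

lemma emb_in_rectQ_iff:
  assumes "N \<ge> 1" "\<bar>b\<bar> < l"
  shows "emb N (i, j) \<in> rectQ l b \<longleftrightarrow> i \<le> gwidth l b N \<and> j \<le> gwidth l (-b) N"
proof -
  have "emb N (i, j) \<in> rectQ l b \<longleftrightarrow> 2 * real i \<le> real N * (l + b) \<and> 2 * real j \<le> real N * (l - b)"
    using assms by (auto simp: emb_def rectQ_def abs_le_iff divide_simps algebra_simps)
  also have "\<dots> \<longleftrightarrow> i \<le> gwidth l b N \<and> j \<le> gwidth l (-b) N"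
    using le_gwidth_iff[of b l i N] le_gwidth_iff[of "-b" l j N] assms by simp
  finally show ?thesis .
qed

text \<open>Even parity of \<open>i + j\<close> makes the half sum and half difference integers, and
  \<open>|y| <= x\<close> makes them natural numbers.\<close>

lemma latS_eq:
  assumes "N \<ge> 1" "\<bar>b\<bar> < l"
  shows "latS l b N = emb N ` ({..gwidth l b N} \<times> {..gwidth l (-b) N})"
proof (intro equalityI subsetI)
  fix p assume p: "p \<in> latS l b N"
  then obtain i j :: int where ij: "even (i + j)" "p = (real_of_int i / real N, real_of_int j / real N)" "p \<in> rectQ l b"
    by (auto simp: latS_def)
  then have "\<bar>real_of_int j\<bar> / real N \<le> real_of_int i / real N" using assms by (simp add: rectQ_def)
  then have "\<bar>real_of_int j\<bar> \<le> real_of_int i" using assms by (simp add: divide_le_cancel)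
  then have ji: "\<bar>j\<bar> \<le> i" by linarith
  obtain a where a: "i + j = 2 * a" using ij(1) by (blast elim: evenE)
  have c: "i - j = 2 * (i - a)" using a by simp
  have "p = emb N (nat a, nat (i - a))"
    using ij(2) a c ji by (auto simp: emb_def)
  moreover from this have "(nat a, nat (i - a)) \<in> {..gwidth l b N} \<times> {..gwidth l (-b) N}"
    using emb_in_rectQ_iff[OF assms] ij(3) by simp
  ultimately show "p \<in> emb N ` ({..gwidth l b N} \<times> {..gwidth l (-b) N})" by blast
next
  fix p assume "p \<in> emb N ` ({..gwidth l b N} \<times> {..gwidth l (-b) N})"
  then obtain i j where ij: "p = emb N (i, j)" "i \<le> gwidth l b N" "j \<le> gwidth l (-b) N" by auto
  then have "p \<in> rectQ l b" using emb_in_rectQ_iff[OF assms] by simp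
  moreover have "even ((int i + int j) + (int i - int j))" by simp
  moreover have "p = (real_of_int (int i + int j) / real N, real_of_int (int i - int j) / real N)"
    using ij by (simp add: emb_def)
  ultimately show "p \<in> latS l b N" unfolding latS_def by blast
qed

lemma rightmost_eq:
  assumes "N \<ge> 1" "\<bar>b\<bar> < l"
  shows "rightmost l b N = {emb N (gwidth l b N, gwidth l (-b) N)}"
proof -
  let ?A = "gwidth l b N" and ?B = "gwidth l (-b) N"
  have "(i, j) = (?A, ?B)" if "i \<le> ?A" "j \<le> ?B" "\<forall>q\<in>{..?A} \<times> {..?B}. fst (emb N q) \<le> fst (emb N (i, j))" for i j
    using that(3)[rule_format, of "(?A, ?B)"] that(1,2) assms by (auto simp: emb_def divide_le_cancel)
  moreover have "fst (emb N (i, j)) \<le> fst (emb N (?A, ?B))" if "i \<le> ?A" "j \<le> ?B" for i j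
    using that assms by (auto simp: emb_def divide_le_cancel)
  ultimately show ?thesis
    unfolding rightmost_def latS_eq[OF assms] by (fastforce)
qed

lemma emb_step:
  assumes "N \<ge> 1"
  shows "emb N (Suc i, j) = (fst (emb N (i, j)) + 1 / real N, snd (emb N (i, j)) + 1 / real N)"
    "emb N (i, Suc j) = (fst (emb N (i, j)) + 1 / real N, snd (emb N (i, j)) - 1 / real N)"
  using assms by (auto simp: emb_def field_simps)

text \<open>The induction follows the path site by site, so it needs the bound for every prefix.
  Locating site \<open>k\<close> on the antidiagonal \<open>i + j = k\<close> also bounds the length
  of a path.\<close>

lemma path_prefix:
  assumes N: "N \<ge> 1" and b: "\<bar>b\<bar> < l" and pi: "\<pi> \<in> paths l b N" and k: "k < length \<pi>"
  shows "\<exists>i j. \<pi> ! k = emb N (i, j) \<and> i + j = k \<and> i \<le> gwidth l b N \<and> j \<le> gwidth l (-b) N \<and>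
    (\<Sum>p\<leftarrow>take (Suc k) \<pi>. w p) \<le> lpt (w \<circ> emb N) (Suc i) (Suc j)"
  using k
proof (induction k)
  case 0
  then have "\<pi> ! 0 = emb N (0, 0)" "take (Suc 0) \<pi> = [emb N (0, 0)]"
    using pi by (cases \<pi>; auto simp: paths_def emb_def)+
  then show ?case by (intro exI[of _ 0]) auto
next
  case (Suc k)
  then obtain i j where ij: "\<pi> ! k = emb N (i, j)" "i + j = k"
    "(\<Sum>p\<leftarrow>take (Suc k) \<pi>. w p) \<le> lpt (w \<circ> emb N) (Suc i) (Suc j)" using Suc_lessD by blast
  have take: "(\<Sum>p\<leftarrow>take (Suc (Suc k)) \<pi>. w p) = (\<Sum>p\<leftarrow>take (Suc k) \<pi>. w p) + w (\<pi> ! Suc k)"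
    using Suc.prems by (simp add: take_Suc_conv_app_nth)
  have "\<pi> ! Suc k \<in> latS l b N" using pi Suc.prems nth_mem[of "Suc k" \<pi>]
    unfolding paths_def by blast
  then have in_lat: "\<pi> ! Suc k \<in> rectQ l b" by (simp add: latS_def)
  consider "\<pi> ! Suc k = emb N (Suc i, j)" | "\<pi> ! Suc k = emb N (i, Suc j)"
    using pi Suc.prems ij(1) emb_step[OF N, of i j] by (auto simp: paths_def)
  then show ?case
  proof cases
    case 1
    have "(\<Sum>p\<leftarrow>take (Suc (Suc k)) \<pi>. w p) \<le> lpt (w \<circ> emb N) (Suc (Suc i)) (Suc j)"
      using ij(3) take 1 by (auto simp: max_def)
    moreover have "Suc i \<le> gwidth l b N \<and> j \<le> gwidth l (-b) N"
      using in_lat 1 emb_in_rectQ_iff[OF N b] by simp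
    ultimately show ?thesis using 1 ij(2) by (rule_tac exI[where x = "Suc i"], rule_tac exI[where x = j]) (auto simp del: lpt.simps simp: comp_def)
  next
    case 2
    have "(\<Sum>p\<leftarrow>take (Suc (Suc k)) \<pi>. w p) \<le> lpt (w \<circ> emb N) (Suc i) (Suc (Suc j))"
      using ij(3) take 2 by (auto simp: max_def)
    moreover have "i \<le> gwidth l b N \<and> Suc j \<le> gwidth l (-b) N"
      using in_lat 2 emb_in_rectQ_iff[OF N b] by simp
    ultimately show ?thesis using 2 ij(2) by (rule_tac exI[where x = i], rule_tac exI[where x = "Suc j"]) (auto simp del: lpt.simps simp: comp_def)
  qed
qed

definition gstep :: "nat \<times> nat \<Rightarrow> nat \<times> nat \<Rightarrow> bool" where
  "gstep p q \<longleftrightarrow> q = (Suc (fst p), snd p) \<or> q = (fst p, Suc (snd p))"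

text \<open>The path is built backwards from \<open>(m, n)\<close>, always through the predecessor
  with the larger passage time.\<close>

lemma lpt_attained:
  assumes "\<And>i j. i \<le> m \<Longrightarrow> j \<le> n \<Longrightarrow> v (i, j) \<ge> 0"
  shows "\<exists>q. q \<noteq> [] \<and> hd q = (0, 0) \<and> last q = (m, n) \<and> set q \<subseteq> {..m} \<times> {..n} \<and>
    (\<forall>k. Suc k < length q \<longrightarrow> gstep (q ! k) (q ! Suc k)) \<and> (\<Sum>p\<leftarrow>q. v p) = lpt v (Suc m) (Suc n)"
  using assms
proof (induction "m + n" arbitrary: m n)
  case 0
  then show ?case by (intro exI[of _ "[(0, 0)]"]) auto
next
  case (Suc d)
  have ext: ?case if IH: "q \<noteq> []" "hd q = (0, 0)" "last q = (m', n')" "set q \<subseteq> {..m'} \<times> {..n'}"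
      "\<forall>k. Suc k < length q \<longrightarrow> gstep (q ! k) (q ! Suc k)" "(\<Sum>p\<leftarrow>q. v p) = lpt v (Suc m') (Suc n')"
    and s: "gstep (m', n') (m, n)" "lpt v (Suc m) (Suc n) = v (m, n) + lpt v (Suc m') (Suc n')" for q m' n'
  proof (intro exI[of _ "q @ [(m, n)]"] conjI)
    show "\<forall>k. Suc k < length (q @ [(m, n)]) \<longrightarrow> gstep ((q @ [(m, n)]) ! k) ((q @ [(m, n)]) ! Suc k)"
    proof (intro allI impI)
      fix k assume "Suc k < length (q @ [(m, n)])"
      then consider "Suc k < length q" | "Suc k = length q" by fastforce
      then show "gstep ((q @ [(m, n)]) ! k) ((q @ [(m, n)]) ! Suc k)"
      proof cases
        case 2
        then have "q ! k = (m', n')" using IH(1,3) by (metis diff_Suc_1 last_conv_nth)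
        then show ?thesis using 2 s(1) by (simp add: nth_append)
      qed (use IH(5) in \<open>auto simp: nth_append\<close>)
    qed
    have "m' \<le> m" "n' \<le> n" using s(1) by (auto simp: gstep_def)
    then show "set (q @ [(m, n)]) \<subseteq> {..m} \<times> {..n}" using IH(4) by auto
  qed (use IH s in auto)
  show ?case
  proof (cases "m > 0 \<and> (n = 0 \<or> lpt v m (Suc n) \<ge> lpt v (Suc m) n)")
    case True
    then obtain m' where m: "m = Suc m'" using gr0_implies_Suc by blast
    have "d = m' + n" using Suc m by simp
    from Suc(1)[OF this] Suc(3) m obtain q where "q \<noteq> []" "hd q = (0, 0)" "last q = (m', n)" "set q \<subseteq> {..m'} \<times> {..n}"
      "\<forall>k. Suc k < length q \<longrightarrow> gstep (q ! k) (q ! Suc k)" "(\<Sum>p\<leftarrow>q. v p) = lpt v (Suc m') (Suc n)" by fastforce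
    moreover have "lpt v (Suc m) (Suc n) = v (m, n) + lpt v m (Suc n)"
      using True lpt_nonneg[of m "Suc n" v] Suc(3) by auto
    ultimately show ?thesis using m by (intro ext[of q m' n]) (auto simp: gstep_def)
  next
    case False
    then have "n > 0" using Suc(2) by (cases "m = 0") auto
    then obtain n' where n: "n = Suc n'" using gr0_implies_Suc by blast
    have "d = m + n'" using Suc n by simp
    from Suc(1)[OF this] Suc(3) n obtain q where "q \<noteq> []" "hd q = (0, 0)" "last q = (m, n')" "set q \<subseteq> {..m} \<times> {..n'}"
      "\<forall>k. Suc k < length q \<longrightarrow> gstep (q ! k) (q ! Suc k)" "(\<Sum>p\<leftarrow>q. v p) = lpt v (Suc m) (Suc n')" by fastforce
    moreover have "lpt v (Suc m) (Suc n) = v (m, n) + lpt v (Suc m) n"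
      using False lpt_nonneg[of "Suc m" n v] Suc(3) \<open>n > 0\<close> by auto
    ultimately show ?thesis using n by (intro ext[of q m n']) (auto simp: gstep_def)
  qed
qed

lemma finite_paths:
  assumes N: "N \<ge> 1" and b: "\<bar>b\<bar> < l"
  shows "finite (paths l b N)"
proof (rule finite_subset)
  let ?A = "gwidth l b N" and ?B = "gwidth l (-b) N"
  show "finite {xs. set xs \<subseteq> latS l b N \<and> length xs \<le> Suc (?A + ?B)}"
    using latS_eq[OF N b] by (intro finite_lists_length_le) auto
  have "length \<pi> \<le> Suc (?A + ?B)" if "\<pi> \<in> paths l b N" for \<pi>
  proof (cases "length \<pi>")
    case (Suc k)
    then show ?thesis using path_prefix[OF N b that, of k] by force
  qed simp
  then show "paths l b N \<subseteq> {xs. set xs \<subseteq> latS l b N \<and> length xs \<le> Suc (?A + ?B)}"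
    by (auto simp: paths_def)
qed

lemma lpp_eq_lpt:
  assumes N: "N \<ge> 1" and b: "\<bar>b\<bar> < l" and w: "\<And>p. p \<in> latS l b N \<Longrightarrow> w p \<ge> 0"
  shows "lpp l b N w = lpt (w \<circ> emb N) (Suc (gwidth l b N)) (Suc (gwidth l (-b) N))"
proof -
  let ?A = "gwidth l b N" and ?B = "gwidth l (-b) N"
  show ?thesis unfolding lpp_def
  proof (rule Max_eqI)
    fix s assume "s \<in> (\<lambda>\<pi>. \<Sum>p\<leftarrow>\<pi>. w p) ` paths l b N"
    then obtain \<pi> where pi: "\<pi> \<in> paths l b N" "s = (\<Sum>p\<leftarrow>\<pi>. w p)" by auto
    then have ne: "\<pi> \<noteq> []" "last \<pi> = emb N (?A, ?B)" using rightmost_eq[OF N b] by (auto simp: paths_def)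
    then obtain k where k: "length \<pi> = Suc k" by (cases \<pi>) auto
    then have "\<pi> ! k = emb N (?A, ?B)" using ne by (simp add: last_conv_nth)
    then show "s \<le> lpt (w \<circ> emb N) (Suc ?A) (Suc ?B)"
      using path_prefix[OF N b pi(1), of k w] k pi(2) emb_inj[OF N] by (auto simp del: lpt.simps)
  next
    have "(w \<circ> emb N) (i, j) \<ge> 0" if "i \<le> ?A" "j \<le> ?B" for i j
      using that w latS_eq[OF N b] by auto
    from lpt_attained[of ?A ?B "w \<circ> emb N", OF this] obtain q where q: "q \<noteq> []" "hd q = (0, 0)" "last q = (?A, ?B)" "set q \<subseteq> {..?A} \<times> {..?B}"
      "\<forall>k. Suc k < length q \<longrightarrow> gstep (q ! k) (q ! Suc k)" "(\<Sum>p\<leftarrow>q. (w \<circ> emb N) p) = lpt (w \<circ> emb N) (Suc ?A) (Suc ?B)"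
      by blast
    have "map (emb N) q \<in> paths l b N"
      unfolding paths_def mem_Collect_eq
    proof (intro conjI allI impI)
      fix k assume "Suc k < length (map (emb N) q)"
      then show "map (emb N) q ! Suc k = (fst (map (emb N) q ! k) + 1 / real N, snd (map (emb N) q ! k) + 1 / real N) \<or>
        map (emb N) q ! Suc k = (fst (map (emb N) q ! k) + 1 / real N, snd (map (emb N) q ! k) - 1 / real N)"
        using q(5) emb_step[OF N, of "fst (q ! k)" "snd (q ! k)"] by (auto simp: gstep_def)
    qed (use q in \<open>auto simp: hd_map last_map rightmost_eq[OF N b] latS_eq[OF N b] emb_def\<close>)
    then show "lpt (w \<circ> emb N) (Suc ?A) (Suc ?B) \<in> (\<lambda>\<pi>. \<Sum>p\<leftarrow>\<pi>. w p) ` paths l b N"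
      using q(6) by (intro image_eqI[of _ _ "map (emb N) q"]) (auto simp: comp_def)
  qed (use finite_paths[OF N b] in auto)
qed

section \<open>Burke's theorem\<close>

abbreviation expm :: "real \<Rightarrow> real measure" where
  "expm r \<equiv> density lborel (\<lambda>x. ennreal (exponential_density r x))"

text \<open>The exponents agree because \<open>p + q = 1\<close>, and for \<open>x >= w\<close> both
  products are supported on \<open>w >= 0\<close>, \<open>y >= 0\<close>.\<close>

lemma expm_shift:
  fixes p q :: real
  assumes "p + q = 1" "x \<ge> w" "p > 0" "q > 0"
  shows "exponential_density p (x - w + y) * exponential_density q y * exponential_density 1 w
       = exponential_density p x * exponential_density q w * exponential_density 1 y"
proof -
  have "w = w * (p + q)" "y = y * (p + q)" using assms by simp_all
  then have "- (x - w + y) * p + - y * q + - w = - x * p + - w * q + - y"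
    by (simp add: algebra_simps)
  then have "exp (- (x - w + y) * p) * exp (- y * q) * exp (- w) = exp (- x * p) * exp (- w * q) * exp (- y)"
    by (simp only: exp_add[symmetric])
  then show ?thesis using assms(2)
    by (auto simp: exponential_density_def)
qed

lemma measurable_curried3:
  assumes "(\<lambda>(x, y, z). g x y z) \<in> borel_measurable (borel \<Otimes>\<^sub>M borel \<Otimes>\<^sub>M borel)"
    and [measurable]: "f1 \<in> borel_measurable M" "f2 \<in> borel_measurable M" "f3 \<in> borel_measurable M"
  shows "(\<lambda>x. g (f1 x) (f2 x) (f3 x)) \<in> borel_measurable M"
proof -
  have "(\<lambda>x. (f1 x, f2 x, f3 x)) \<in> measurable M (borel \<Otimes>\<^sub>M borel \<Otimes>\<^sub>M borel)" by measurable
  from measurable_compose[OF this assms(1)] show ?thesis by simp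
qed

lemma nn_integral_expm3:
  fixes g :: "real \<Rightarrow> real \<Rightarrow> real \<Rightarrow> ennreal"
  assumes g [measurable]: "(\<lambda>(x, y, z). g x y z) \<in> borel_measurable (borel \<Otimes>\<^sub>M borel \<Otimes>\<^sub>M borel)"
  shows "(\<integral>\<^sup>+ w. \<integral>\<^sup>+ y. \<integral>\<^sup>+ x. g x y w \<partial>expm p \<partial>expm q \<partial>expm r) =
    (\<integral>\<^sup>+ w. \<integral>\<^sup>+ y. \<integral>\<^sup>+ x. ennreal (exponential_density p x) * ennreal (exponential_density q y) *
       ennreal (exponential_density r w) * g x y w \<partial>lborel \<partial>lborel \<partial>lborel)"
proof -
  note [measurable (raw)] = measurable_curried3[OF g]
  show ?thesis
    by (simp add: nn_integral_density nn_integral_cmult[symmetric] mult_ac)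
qed

text \<open>
  On either side of the diagonal \<open>x = y\<close> the three-variable map is a translation in one variable
  followed by a permutation of the variables.
\<close>

lemma nn_integral_burke:
  fixes g :: "real \<Rightarrow> real \<Rightarrow> real \<Rightarrow> ennreal"
  assumes g [measurable]: "(\<lambda>(x, y, z). g x y z) \<in> borel_measurable (borel \<Otimes>\<^sub>M borel \<Otimes>\<^sub>M borel)"
    and pq: "p + q = 1" "p > 0" "q > 0"
  shows "(\<integral>\<^sup>+ w. \<integral>\<^sup>+ y. \<integral>\<^sup>+ x. g (w + max (x - y) 0) (w + max (y - x) 0) (min x y) \<partial>expm p \<partial>expm q \<partial>expm 1)
       = (\<integral>\<^sup>+ w. \<integral>\<^sup>+ y. \<integral>\<^sup>+ x. g x y w \<partial>expm p \<partial>expm q \<partial>expm 1)"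
proof -
  note [measurable (raw)] = measurable_curried3[OF g]
  let ?e = "\<lambda>r x. ennreal (exponential_density r x)"
  let ?D = "\<lambda>x y w. ?e p x * ?e q y * ?e 1 w"
  have D: "?e p (x - w + y) * ?e q y * ?e 1 w = ?e p x * ?e q w * ?e 1 y" if "x \<ge> w" for x y w
    using expm_shift[OF pq(1) that pq(2,3), of y] pq exponential_density_nonneg
    by (simp add: ennreal_mult[symmetric])
  have D': "?e p y * ?e q (x - w + y) * ?e 1 w = ?e p w * ?e q x * ?e 1 y" if "x \<ge> w" for x y w
    using expm_shift[of q p w x y] pq exponential_density_nonneg that
    by (simp add: ennreal_mult[symmetric] mult_ac)
  let ?g = "\<lambda>x y w. g (w + max (x - y) 0) (w + max (y - x) 0) (min x y)"
  have 1: "(\<integral>\<^sup>+ w. \<integral>\<^sup>+ y. \<integral>\<^sup>+ x. ?D x y w * ?g x y w * (if y < x then 1 else 0) \<partial>lborel \<partial>lborel \<partial>lborel)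
    = (\<integral>\<^sup>+ w. \<integral>\<^sup>+ y. \<integral>\<^sup>+ x. ?D x y w * g x y w * (if y < x then 1 else 0) \<partial>lborel \<partial>lborel \<partial>lborel)"
  proof -
    have "(\<integral>\<^sup>+ x. ?D x y w * ?g x y w * (if y < x then 1 else 0) \<partial>lborel)
      = (\<integral>\<^sup>+ x. ?D x w y * g x w y * (if w < x then 1 else 0) \<partial>lborel)" for w y
    proof -
      have "(\<integral>\<^sup>+ x. ?D x y w * ?g x y w * (if y < x then 1 else 0) \<partial>lborel)
        = (\<integral>\<^sup>+ x. ?D (y - w + 1 * x) y w * ?g (y - w + 1 * x) y w * (if y < y - w + 1 * x then 1 else 0) \<partial>lborel)"
        by (subst nn_integral_real_affine[where c = 1 and t = "y - w"]) auto
      also have "\<dots> = (\<integral>\<^sup>+ x. ?D x w y * g x w y * (if w < x then 1 else 0) \<partial>lborel)"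
        using D by (intro nn_integral_cong) (auto simp: indicator_def algebra_simps)
      finally show ?thesis .
    qed
    then have "(\<integral>\<^sup>+ w. \<integral>\<^sup>+ y. \<integral>\<^sup>+ x. ?D x y w * ?g x y w * (if y < x then 1 else 0) \<partial>lborel \<partial>lborel \<partial>lborel)
      = (\<integral>\<^sup>+ w. \<integral>\<^sup>+ y. \<integral>\<^sup>+ x. ?D x w y * g x w y * (if w < x then 1 else 0) \<partial>lborel \<partial>lborel \<partial>lborel)" by simp
    also have "\<dots> = (\<integral>\<^sup>+ y. \<integral>\<^sup>+ w. \<integral>\<^sup>+ x. ?D x w y * g x w y * (if w < x then 1 else 0) \<partial>lborel \<partial>lborel \<partial>lborel)"
      by (rule lborel_pair.Fubini') measurable
    finally show ?thesis .
  qed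
  have 2: "(\<integral>\<^sup>+ w. \<integral>\<^sup>+ y. \<integral>\<^sup>+ x. ?D x y w * ?g x y w * (if x \<le> y then 1 else 0) \<partial>lborel \<partial>lborel \<partial>lborel)
    = (\<integral>\<^sup>+ w. \<integral>\<^sup>+ y. \<integral>\<^sup>+ x. ?D x y w * g x y w * (if x \<le> y then 1 else 0) \<partial>lborel \<partial>lborel \<partial>lborel)"
  proof -
    have a: "(\<integral>\<^sup>+ y. ?D x y w * ?g x y w * (if x \<le> y then 1 else 0) \<partial>lborel)
      = (\<integral>\<^sup>+ y. ?D w y x * g w y x * (if w \<le> y then 1 else 0) \<partial>lborel)" for w x
    proof -
      have "(\<integral>\<^sup>+ y. ?D x y w * ?g x y w * (if x \<le> y then 1 else 0) \<partial>lborel)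
        = (\<integral>\<^sup>+ y. ?D x (x - w + 1 * y) w * ?g x (x - w + 1 * y) w * (if x \<le> x - w + 1 * y then 1 else 0) \<partial>lborel)"
        by (subst nn_integral_real_affine[where c = 1 and t = "x - w"]) auto
      also have "\<dots> = (\<integral>\<^sup>+ y. ?D w y x * g w y x * (if w \<le> y then 1 else 0) \<partial>lborel)"
        using D' by (intro nn_integral_cong) (auto simp: indicator_def algebra_simps)
      finally show ?thesis .
    qed
    have "(\<integral>\<^sup>+ w. \<integral>\<^sup>+ y. \<integral>\<^sup>+ x. ?D x y w * ?g x y w * (if x \<le> y then 1 else 0) \<partial>lborel \<partial>lborel \<partial>lborel)
      = (\<integral>\<^sup>+ w. \<integral>\<^sup>+ x. \<integral>\<^sup>+ y. ?D x y w * ?g x y w * (if x \<le> y then 1 else 0) \<partial>lborel \<partial>lborel \<partial>lborel)"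
      by (intro nn_integral_cong lborel_pair.Fubini') measurable
    also have "\<dots> = (\<integral>\<^sup>+ w. \<integral>\<^sup>+ x. \<integral>\<^sup>+ y. ?D w y x * g w y x * (if w \<le> y then 1 else 0) \<partial>lborel \<partial>lborel \<partial>lborel)"
      by (simp only: a)
    also have "\<dots> = (\<integral>\<^sup>+ x. \<integral>\<^sup>+ w. \<integral>\<^sup>+ y. ?D w y x * g w y x * (if w \<le> y then 1 else 0) \<partial>lborel \<partial>lborel \<partial>lborel)"
      by (rule lborel_pair.Fubini') measurable
    also have "\<dots> = (\<integral>\<^sup>+ x. \<integral>\<^sup>+ y. \<integral>\<^sup>+ w. ?D w y x * g w y x * (if w \<le> y then 1 else 0) \<partial>lborel \<partial>lborel \<partial>lborel)"
      by (intro nn_integral_cong lborel_pair.Fubini') measurable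
    finally show ?thesis .
  qed
  have split: "(\<integral>\<^sup>+ w. \<integral>\<^sup>+ y. \<integral>\<^sup>+ x. ?D x y w * f x y w \<partial>lborel \<partial>lborel \<partial>lborel)
    = (\<integral>\<^sup>+ w. \<integral>\<^sup>+ y. \<integral>\<^sup>+ x. ?D x y w * f x y w * (if y < x then 1 else 0) \<partial>lborel \<partial>lborel \<partial>lborel)
    + (\<integral>\<^sup>+ w. \<integral>\<^sup>+ y. \<integral>\<^sup>+ x. ?D x y w * f x y w * (if x \<le> y then 1 else 0) \<partial>lborel \<partial>lborel \<partial>lborel)"
    if [measurable]: "(\<lambda>(x, y, z). f x y z) \<in> borel_measurable (borel \<Otimes>\<^sub>M borel \<Otimes>\<^sub>M borel)" for f :: "real \<Rightarrow> real \<Rightarrow> real \<Rightarrow> ennreal"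
  proof -
    note [measurable (raw)] = measurable_curried3[OF that]
    show ?thesis
      by (subst nn_integral_add[symmetric], measurable)+
        (intro nn_integral_cong, auto simp: indicator_def)
  qed
  have m: "(\<lambda>(x, y, z). ?g x y z) \<in> borel_measurable (borel \<Otimes>\<^sub>M borel \<Otimes>\<^sub>M borel)"
    by measurable
  show ?thesis
    unfolding nn_integral_expm3[OF g] nn_integral_expm3[OF m] split[OF g] split[OF m] 1 2 ..
qed

text \<open>Slots \<open>a\<close>, \<open>b\<close>, \<open>c\<close> hold the horizontal
  increment, the vertical increment and the weight of a unit cell. The update gives the increments
  across the opposite sides; the minimum stored in \<open>c\<close> is the weight of the reversed
  process and, for distinct slots, makes the map an involution.\<close>

definition burke :: "'i \<Rightarrow> 'i \<Rightarrow> 'i \<Rightarrow> ('i \<Rightarrow> real) \<Rightarrow> 'i \<Rightarrow> real" where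
  "burke a b c x = x(c := min (x a) (x b), b := x c + max (x b - x a) 0, a := x c + max (x a - x b) 0)"

lemma prob_space_expm: "r > 0 \<Longrightarrow> prob_space (expm r)"
  by (rule prob_space_exponential_density)

text \<open>Freezing the coordinates outside \<open>a\<close>, \<open>b\<close>, \<open>c\<close>
  and integrating them last reduces the claim to the identity in
  \<open>nn_integral_burke\<close>.\<close>

lemma distr_burke:
  assumes K: "finite K" "a \<in> K" "b \<in> K" "c \<in> K" "a \<noteq> b" "a \<noteq> c" "b \<noteq> c"
    and r: "\<And>k. r k > 0" "r a + r b = 1" "r c = 1"
  shows "burke a b c \<in> measurable (PiM K (\<lambda>k. expm (r k))) (PiM K (\<lambda>k. expm (r k)))"
    "distr (PiM K (\<lambda>k. expm (r k))) (PiM K (\<lambda>k. expm (r k))) (burke a b c) = PiM K (\<lambda>k. expm (r k))"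
proof -
  let ?M = "\<lambda>k. expm (r k)"
  interpret P: product_prob_space ?M
    by (intro product_prob_space.intro product_prob_space_axioms.intro product_sigma_finite.intro prob_space_imp_sigma_finite prob_space_expm r)
  show meas [measurable]: "burke a b c \<in> measurable (PiM K ?M) (PiM K ?M)"
  proof (rule measurable_PiM_single')
    fix k assume "k \<in> K"
    have [measurable]: "(\<lambda>x. x i) \<in> borel_measurable (PiM K ?M)" if "i \<in> K" for i
      using measurable_component_singleton[OF that, of ?M] by simp
    show "(\<lambda>x. burke a b c x k) \<in> measurable (PiM K ?M) (?M k)"
      unfolding burke_def fun_upd_apply by (cases "k = a"; cases "k = b"; cases "k = c") (use \<open>k \<in> K\<close> K in simp_all)
  next
    show "(\<lambda>x i. burke a b c x i) \<in> space (PiM K ?M) \<rightarrow> (\<Pi>\<^sub>E i\<in>K. space (?M i))"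
      using K by (auto simp: burke_def space_PiM PiE_def extensional_def)
  qed
  define K' where "K' = K - {a, b, c}"
  have K': "K = insert a (insert b (insert c K'))" "finite K'" "c \<notin> K'" "b \<notin> insert c K'" "a \<notin> insert b (insert c K')"
    using K by (auto simp: K'_def)
  have fold: "(\<integral>\<^sup>+ x. f x \<partial>PiM K ?M) = (\<integral>\<^sup>+ x. \<integral>\<^sup>+ w. \<integral>\<^sup>+ v. \<integral>\<^sup>+ u. f (x(c := w, b := v, a := u)) \<partial>?M a \<partial>?M b \<partial>?M c \<partial>PiM K' ?M)"
    if f: "f \<in> borel_measurable (PiM K ?M)" for f :: "_ \<Rightarrow> ennreal"
  proof -
    interpret A: sigma_finite_measure "?M a" by (rule P.sigma_finite_measures)
    interpret B: sigma_finite_measure "?M b" by (rule P.sigma_finite_measures)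
    have f1: "(\<lambda>x. \<integral>\<^sup>+ u. f (x(a := u)) \<partial>?M a) \<in> borel_measurable (PiM (insert b (insert c K')) ?M)"
      using f unfolding K'(1) by measurable
    have f2: "(\<lambda>x. \<integral>\<^sup>+ v. \<integral>\<^sup>+ u. f (x(b := v, a := u)) \<partial>?M a \<partial>?M b) \<in> borel_measurable (PiM (insert c K') ?M)"
      using f1 by measurable
    show ?thesis
      unfolding K'(1)
      using f f1 f2 K' by (simp add: P.product_nn_integral_insert)
  qed
  show "distr (PiM K ?M) (PiM K ?M) (burke a b c) = PiM K ?M"
  proof (rule measure_eqI)
    fix A assume "A \<in> sets (distr (PiM K ?M) (PiM K ?M) (burke a b c))"
    then have A [measurable]: "A \<in> sets (PiM K ?M)" by simp
    let ?f = "indicator A :: _ \<Rightarrow> ennreal"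
    have "emeasure (distr (PiM K ?M) (PiM K ?M) (burke a b c)) A = (\<integral>\<^sup>+ x. ?f (burke a b c x) \<partial>PiM K ?M)"
      by (subst nn_integral_indicator[symmetric], simp, subst nn_integral_distr) auto
    also have "\<dots> = (\<integral>\<^sup>+ x. \<integral>\<^sup>+ w. \<integral>\<^sup>+ v. \<integral>\<^sup>+ u. ?f (burke a b c (x(c := w, b := v, a := u))) \<partial>?M a \<partial>?M b \<partial>?M c \<partial>PiM K' ?M)"
      by (rule fold) measurable
    also have "\<dots> = (\<integral>\<^sup>+ x. \<integral>\<^sup>+ w. \<integral>\<^sup>+ v. \<integral>\<^sup>+ u. ?f (x(c := w, b := v, a := u)) \<partial>?M a \<partial>?M b \<partial>?M c \<partial>PiM K' ?M)"
    proof (rule nn_integral_cong)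
      fix x assume x: "x \<in> space (PiM K' ?M)"
      let ?g = "\<lambda>u v w. ?f (x(c := w, b := v, a := u))"
      have "burke a b c (x(c := w, b := v, a := u)) = x(c := min u v, b := w + max (v - u) 0, a := w + max (u - v) 0)" for u v w
        using K by (auto simp: burke_def fun_eq_iff)
      moreover have "(\<integral>\<^sup>+ w. \<integral>\<^sup>+ v. \<integral>\<^sup>+ u. ?g (w + max (u - v) 0) (w + max (v - u) 0) (min u v) \<partial>?M a \<partial>?M b \<partial>expm 1)
        = (\<integral>\<^sup>+ w. \<integral>\<^sup>+ v. \<integral>\<^sup>+ u. ?g u v w \<partial>?M a \<partial>?M b \<partial>expm 1)"
      proof (rule nn_integral_burke)
        have "(\<lambda>(u, v, w). x(c := w, b := v, a := u)) \<in> measurable (borel \<Otimes>\<^sub>M borel \<Otimes>\<^sub>M borel) (PiM K ?M)"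
        proof (rule measurable_PiM_single')
          fix k assume "k \<in> K"
          show "(\<lambda>z. (case z of (u, v, w) \<Rightarrow> x(c := w, b := v, a := u)) k) \<in> measurable (borel \<Otimes>\<^sub>M borel \<Otimes>\<^sub>M borel) (?M k)"
            unfolding split_beta fun_upd_apply by measurable
        qed (use x K' in \<open>auto simp: space_PiM PiE_def extensional_def\<close>)
        from measurable_compose[OF this borel_measurable_indicator[OF A, where 'b = ennreal]]
        show "(\<lambda>(u, v, w). ?g u v w) \<in> borel_measurable (borel \<Otimes>\<^sub>M borel \<Otimes>\<^sub>M borel)"
          by (simp add: case_prod_unfold)
      qed (use r in auto)
      ultimately show "(\<integral>\<^sup>+ w. \<integral>\<^sup>+ v. \<integral>\<^sup>+ u. ?f (burke a b c (x(c := w, b := v, a := u))) \<partial>?M a \<partial>?M b \<partial>?M c)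
        = (\<integral>\<^sup>+ w. \<integral>\<^sup>+ v. \<integral>\<^sup>+ u. ?g u v w \<partial>?M a \<partial>?M b \<partial>?M c)"
        using r by simp
    qed
    also have "\<dots> = (\<integral>\<^sup>+ x. ?f x \<partial>PiM K ?M)" by (rule fold[symmetric]) measurable
    also have "\<dots> = emeasure (PiM K ?M) A" by (rule nn_integral_indicator) measurable
    finally show "emeasure (distr (PiM K ?M) (PiM K ?M) (burke a b c)) A = emeasure (PiM K ?M) A" .
  qed simp
qed

section \<open>Sums of exponential variables\<close>

lemma product_prob_space_expm:
  "(\<And>k. r k > 0) \<Longrightarrow> product_prob_space (\<lambda>k. expm (r k))"
  by (intro product_prob_space.intro product_prob_space_axioms.intro product_sigma_finite.intro
      prob_space_imp_sigma_finite prob_space_expm)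

lemma prob_space_PiM_expm:
  "(\<And>k. r k > 0) \<Longrightarrow> prob_space (PiM K (\<lambda>k. expm (r k)))"
  by (intro prob_space_PiM prob_space_expm)

lemma measurable_coord_expm [measurable (raw)]:
  "i \<in> K \<Longrightarrow> (\<lambda>x. x i) \<in> borel_measurable (PiM K (\<lambda>k. expm (r k)))"
  using measurable_component_singleton[of i K "\<lambda>k. expm (r k)"] by simp

lemma nn_integral_expm_mgf:
  assumes "\<theta> < r" "r > 0"
  shows "(\<integral>\<^sup>+ x. ennreal (exp (\<theta> * x)) \<partial>expm r) = ennreal (r / (r - \<theta>))"
proof -
  interpret E: prob_space "expm (r - \<theta>)" using assms by (intro prob_space_expm) auto
  have "(\<integral>\<^sup>+ x. ennreal (exp (\<theta> * x)) \<partial>expm r) = (\<integral>\<^sup>+ x. ennreal (r / (r - \<theta>)) * ennreal (exponential_density (r - \<theta>) x) \<partial>lborel)"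
  proof -
    have "exponential_density r x * exp (\<theta> * x) = r / (r - \<theta>) * exponential_density (r - \<theta>) x" for x
    proof -
      have "exp (- x * r) * exp (\<theta> * x) = exp (- x * (r - \<theta>))"
        by (simp add: exp_add[symmetric] algebra_simps)
      then show ?thesis using assms by (auto simp: exponential_density_def mult.assoc)
    qed
    then show ?thesis
      using assms by (subst nn_integral_density) (auto intro!: nn_integral_cong simp: ennreal_mult[symmetric] exponential_density_nonneg)
  qed
  also have "\<dots> = ennreal (r / (r - \<theta>)) * (\<integral>\<^sup>+ x. ennreal (exponential_density (r - \<theta>) x) \<partial>lborel)"
    by (rule nn_integral_cmult) measurable
  also have "(\<integral>\<^sup>+ x. ennreal (exponential_density (r - \<theta>) x) \<partial>lborel) = 1"
    using E.emeasure_space_1 by (simp add: emeasure_density)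
  finally show ?thesis by simp
qed

text \<open>The moment generating function of a mean 1 exponential variable is
  \<open>1 / (1 - s)\<close>; after centring only the quadratic term remains.\<close>

lemma inverse_one_minus_le_exp:
  fixes s :: real
  assumes "\<bar>s\<bar> \<le> 1 / 2"
  shows "1 / (1 - s) \<le> exp (s + 2 * s\<^sup>2)"
proof -
  have "- s - 2 * s\<^sup>2 \<le> ln (1 - s)"
  proof (cases "s \<ge> 0")
    case True
    then show ?thesis using ln_one_minus_pos_lower_bound[of s] assms by simp
  next
    case False
    then show ?thesis using ln_one_plus_pos_lower_bound[of "-s"] assms by (simp add: abs_if) (smt (verit) zero_le_power2)
  qed
  then have "exp (- s - 2 * s\<^sup>2) \<le> 1 - s" using assms by (metis abs_le_D1 diff_gt_0_iff_gt exp_le_cancel_iff exp_ln le_less_trans half_gt_zero_iff field_sum_of_halves less_add_same_cancel1 zero_less_one half_gt_zero)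
  moreover have "exp (- s - 2 * s\<^sup>2) = 1 / exp (s + 2 * s\<^sup>2)" by (simp add: exp_minus[symmetric] divide_inverse)
  moreover have "1 - s > 0" using assms by auto
  ultimately show ?thesis by (simp add: divide_simps mult.commute)
qed

text \<open>\<open>\<theta>\<close> may have either sign, which covers both tails. Factors outside
  \<open>S\<close> integrate to 1, those inside to \<open>r1 / (r1 - \<theta>)\<close>.\<close>

lemma chernoff_expm:
  assumes K: "finite K" "S \<subseteq> K" and r: "\<And>k. r k > 0" "\<And>k. k \<in> S \<Longrightarrow> r k = r1" "r1 > 0" and th: "\<bar>\<theta>\<bar> \<le> r1 / 2"
  shows "measure (PiM K (\<lambda>k. expm (r k))) {x \<in> space (PiM K (\<lambda>k. expm (r k))). \<tau> \<le> \<theta> * ((\<Sum>k\<in>S. x k) - card S / r1)}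
     \<le> exp (card S * (2 * (\<theta> / r1)\<^sup>2) - \<tau>)"
proof -
  let ?M = "\<lambda>k. expm (r k)" and ?P = "PiM K (\<lambda>k. expm (r k))"
  interpret P: product_prob_space ?M by (rule product_prob_space_expm) (rule r)
  interpret Q: prob_space ?P by (rule prob_space_PiM_expm) (rule r)
  have fS: "finite S" using K finite_subset by blast
  have [measurable]: "(\<lambda>x. \<Sum>k\<in>S. x k) \<in> borel_measurable ?P"
    using K by (intro borel_measurable_sum) (auto intro: measurable_coord_expm)
  let ?A = "{x \<in> space ?P. \<tau> \<le> \<theta> * ((\<Sum>k\<in>S. x k) - card S / r1)}"
  let ?f = "\<lambda>k x. if k \<in> S then ennreal (exp (\<theta> * x)) else 1"
  have "emeasure ?P ?A = (\<integral>\<^sup>+ x. indicator ?A x \<partial>?P)"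
    by (rule nn_integral_indicator[symmetric]) measurable
  also have "\<dots> \<le> (\<integral>\<^sup>+ x. ennreal (exp (- \<tau> - \<theta> * card S / r1)) * (\<Prod>k\<in>K. ?f k (x k)) \<partial>?P)"
  proof (rule nn_integral_mono)
    fix x
    have "(\<Prod>k\<in>K. ?f k (x k)) = (\<Prod>k\<in>S. ennreal (exp (\<theta> * x k)))"
      using K by (simp add: prod.If_cases Int_absorb1)
    also have "\<dots> = ennreal (exp (\<theta> * (\<Sum>k\<in>S. x k)))"
      using fS by (simp add: prod_ennreal exp_sum[symmetric] sum_distrib_left)
    finally have eq: "ennreal (exp (- \<tau> - \<theta> * card S / r1)) * (\<Prod>k\<in>K. ?f k (x k))
      = ennreal (exp (- \<tau> - \<theta> * card S / r1 + \<theta> * (\<Sum>k\<in>S. x k)))"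
      by (simp add: ennreal_mult[symmetric] exp_add)
    show "indicator ?A x \<le> ennreal (exp (- \<tau> - \<theta> * card S / r1)) * (\<Prod>k\<in>K. ?f k (x k))"
      unfolding eq by (auto simp: indicator_def algebra_simps)
  qed
  also have "\<dots> = ennreal (exp (- \<tau> - \<theta> * card S / r1)) * (\<Prod>k\<in>K. \<integral>\<^sup>+ x. ?f k x \<partial>?M k)"
  proof -
    have [measurable]: "(\<lambda>x. \<Prod>k\<in>K. ?f k (x k)) \<in> borel_measurable ?P"
    proof (rule borel_measurable_prod_ennreal)
      fix k assume [simp]: "k \<in> K"
      show "(\<lambda>x. ?f k (x k)) \<in> borel_measurable ?P" by (cases "k \<in> S") auto
    qed
    have "(\<integral>\<^sup>+ x. (\<Prod>k\<in>K. ?f k (x k)) \<partial>?P) = (\<Prod>k\<in>K. \<integral>\<^sup>+ x. ?f k x \<partial>?M k)"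
      using K(1) by (intro P.product_nn_integral_prod) auto
    then show ?thesis by (subst nn_integral_cmult) auto
  qed
  also have "(\<Prod>k\<in>K. \<integral>\<^sup>+ x. ?f k x \<partial>?M k) = (\<Prod>k\<in>S. ennreal (r1 / (r1 - \<theta>)))"
  proof -
    have 1: "(\<integral>\<^sup>+ x. ?f k x \<partial>?M k) = (if k \<in> S then ennreal (r1 / (r1 - \<theta>)) else 1)" for k
      using prob_space.emeasure_space_1[OF prob_space_expm[OF r(1)[of k]]] nn_integral_expm_mgf[of \<theta> r1] th r
      by auto
    show ?thesis unfolding 1 using K by (simp add: prod.If_cases Int_absorb1)
  qed
  also have "\<dots> = ennreal ((r1 / (r1 - \<theta>)) ^ card S)"
    using th r by (subst prod_ennreal) auto
  also have "ennreal (exp (- \<tau> - \<theta> * card S / r1)) * \<dots> \<le> ennreal (exp (card S * (2 * (\<theta> / r1)\<^sup>2) - \<tau>))"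
  proof -
    have "r1 / (r1 - \<theta>) = 1 / (1 - \<theta> / r1)" using r th by (simp add: field_simps)
    also have "\<dots> \<le> exp (\<theta> / r1 + 2 * (\<theta> / r1)\<^sup>2)"
      using r th by (intro inverse_one_minus_le_exp) (auto simp: field_simps)
    finally have "(r1 / (r1 - \<theta>)) ^ card S \<le> exp (\<theta> / r1 + 2 * (\<theta> / r1)\<^sup>2) ^ card S"
      using r th by (intro power_mono) auto
    also have "\<dots> = exp (card S * (\<theta> / r1 + 2 * (\<theta> / r1)\<^sup>2))" by (simp add: exp_of_nat_mult)
    finally have "exp (- \<tau> - \<theta> * card S / r1) * (r1 / (r1 - \<theta>)) ^ card S
       \<le> exp (- \<tau> - \<theta> * card S / r1) * exp (card S * (\<theta> / r1 + 2 * (\<theta> / r1)\<^sup>2))" by (intro mult_left_mono) auto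
    also have "\<dots> = exp (card S * (2 * (\<theta> / r1)\<^sup>2) - \<tau>)" by (simp add: exp_add[symmetric] algebra_simps)
    finally show ?thesis using r th by (auto simp: ennreal_mult[symmetric] intro: ennreal_leI)
  qed
  finally show ?thesis by (simp add: Q.emeasure_eq_measure)
qed

lemma expm_sum_deviation:
  assumes "r0 > 0" "\<epsilon> > 0" "L > 0"
  shows "\<exists>c>0. \<forall>N (K :: 'i set) S r r1. finite K \<longrightarrow> S \<subseteq> K \<longrightarrow> (\<forall>k. r k > 0) \<longrightarrow> (\<forall>k\<in>S. r k = r1) \<longrightarrow> r0 \<le> r1 \<longrightarrow>
     real (card S) \<le> L * real N \<longrightarrow>
     measure (PiM K (\<lambda>k. expm (r k))) {x \<in> space (PiM K (\<lambda>k. expm (r k))). \<epsilon> * real N \<le> \<bar>(\<Sum>k\<in>S. x k) - card S / r1\<bar>}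
       \<le> 2 * exp (- c * real N)"
proof -
  \<comment> \<open>The first entry is the range of \<open>chernoff_expm\<close>; the second makes
    the quadratic term at most half of the gain \<open>\<theta> * \<epsilon> * N\<close>.\<close>
  define \<theta> where "\<theta> = min (r0 / 2) (\<epsilon> * r0\<^sup>2 / (4 * L))"
  have th: "\<theta> > 0" "\<theta> \<le> r0 / 2" "\<theta> * (4 * L) \<le> \<epsilon> * r0\<^sup>2" using assms
    by (auto simp: \<theta>_def min_def field_simps)
  show ?thesis
  proof (intro exI[of _ "\<theta> * \<epsilon> / 2"] conjI allI impI)
    show "\<theta> * \<epsilon> / 2 > 0" using th assms by simp
    fix N and K :: "'i set" and S r r1
    assume a: "finite K" "S \<subseteq> K" "\<forall>k. r k > 0" "\<forall>k\<in>S. r k = r1" "r0 \<le> r1" "real (card S) \<le> L * real N"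
    let ?P = "PiM K (\<lambda>k. expm (r k))"
    let ?D = "\<lambda>x. (\<Sum>k\<in>S. x k) - card S / r1"
    let ?A = "\<lambda>s. {x \<in> space ?P. \<theta> * \<epsilon> * real N \<le> s * ?D x}"
    interpret Q: prob_space ?P by (rule prob_space_PiM_expm) (use a in auto)
    have [measurable]: "(\<lambda>x. \<Sum>k\<in>S. x k) \<in> borel_measurable ?P"
      using a by (intro borel_measurable_sum) (auto intro: measurable_coord_expm)
    have bd: "Q.prob (?A s) \<le> exp (- (\<theta> * \<epsilon> / 2) * real N)" if s: "s = \<theta> \<or> s = - \<theta>" for s
    proof -
      have s2: "\<bar>s\<bar> = \<theta>" "s\<^sup>2 = \<theta>\<^sup>2" using s th by auto
      have "Q.prob (?A s) \<le> exp (card S * (2 * (s / r1)\<^sup>2) - \<theta> * \<epsilon> * real N)"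
        using a s2 th assms by (intro chernoff_expm) auto
      also have "card S * (2 * (s / r1)\<^sup>2) \<le> \<theta> * \<epsilon> / 2 * real N"
      proof -
        have "(s / r1)\<^sup>2 \<le> (\<theta> / r0)\<^sup>2"
          using a assms th s2 by (simp add: power_divide) (intro divide_left_mono power_mono, auto)
        then have "card S * (2 * (s / r1)\<^sup>2) \<le> (L * real N) * (2 * (\<theta> / r0)\<^sup>2)"
          using a assms by (intro mult_mono) auto
        also have "\<dots> = real N * \<theta> * (\<theta> * (4 * L)) / (2 * r0\<^sup>2)" by (simp add: power2_eq_square)
        also have "\<dots> \<le> real N * \<theta> * (\<epsilon> * r0\<^sup>2) / (2 * r0\<^sup>2)"
          using th assms by (intro divide_right_mono mult_left_mono) auto
        also have "\<dots> = \<theta> * \<epsilon> / 2 * real N" using assms by simp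
        finally show ?thesis .
      qed
      finally show ?thesis by (simp add: algebra_simps)
    qed
    have "Q.prob {x \<in> space ?P. \<epsilon> * real N \<le> \<bar>?D x\<bar>} \<le> Q.prob (?A \<theta> \<union> ?A (-\<theta>))"
    proof (rule Q.finite_measure_mono)
      show "{x \<in> space ?P. \<epsilon> * real N \<le> \<bar>?D x\<bar>} \<subseteq> ?A \<theta> \<union> ?A (-\<theta>)"
      proof safe
        fix x assume x: "\<epsilon> * real N \<le> \<bar>?D x\<bar>" "\<not> \<theta> * \<epsilon> * real N \<le> - \<theta> * ?D x"
        then have "\<theta> * (\<epsilon> * real N) \<le> \<theta> * \<bar>?D x\<bar>" using th by (intro mult_left_mono) auto
        then show "\<theta> * \<epsilon> * real N \<le> \<theta> * ?D x" using x(2) by (auto simp: abs_if mult.assoc split: if_splits)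
      qed
    qed measurable
    also have "\<dots> \<le> Q.prob (?A \<theta>) + Q.prob (?A (-\<theta>))" by (rule measure_Un_le) measurable
    also have "\<dots> \<le> 2 * exp (- (\<theta> * \<epsilon> / 2) * real N)" using bd[of \<theta>] bd[of "-\<theta>"] by simp
    finally show "Q.prob {x \<in> space ?P. \<epsilon> * real N \<le> \<bar>?D x\<bar>} \<le> 2 * exp (- (\<theta> * \<epsilon> / 2) * real N)" .
  qed
qed

section \<open>The stationary model\<close>

lemma measurable_lpt:
  assumes "\<And>i j. i < m \<Longrightarrow> j < n \<Longrightarrow> (\<lambda>x. w x (i, j)) \<in> borel_measurable M"
  shows "(\<lambda>x. lpt (w x) m n) \<in> borel_measurable M"
  using assms
proof (induction m arbitrary: n)
  case (Suc m)
  note IHm = Suc.IH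
  show ?case using Suc.prems
  proof (induction n)
    case (Suc n)
    have [measurable]: "(\<lambda>x. lpt (w x) m (Suc n)) \<in> borel_measurable M" "(\<lambda>x. lpt (w x) (Suc m) n) \<in> borel_measurable M"
      "(\<lambda>x. w x (m, n)) \<in> borel_measurable M"
      using Suc IHm by auto
    show ?case by simp
  qed simp
qed simp

abbreviation box_measure :: "nat \<Rightarrow> nat \<Rightarrow> (nat \<times> nat \<Rightarrow> real) measure" where
  "box_measure m n \<equiv> PiM ({..<m} \<times> {..<n}) (\<lambda>_. expm 1)"

lemma measurable_lpt_shiftw:
  assumes "\<And>i j. i < m \<Longrightarrow> j < n \<Longrightarrow> (a + i, b + j) \<in> K"
  shows "(\<lambda>x. lpt (shiftw (a, b) x) m n) \<in> borel_measurable (PiM K (\<lambda>k. expm (r k)))"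
  using assms by (intro measurable_lpt) (auto intro: measurable_coord_expm)

lemma measurable_lpt_box [measurable]: "(\<lambda>x. lpt x m n) \<in> borel_measurable (box_measure m n)"
  using measurable_lpt_shiftw[of m n 0 0 "{..<m} \<times> {..<n}" "\<lambda>_. 1"] by simp

text \<open>Restriction and reindexing preserve product laws, so a sub-box with rate 1 at all sites
  behaves like a homogeneous box. This moves estimates between the bulk of the stationary model and
  \<open>box_measure\<close>.\<close>

lemma measure_lpt_shiftw:
  fixes r :: "nat \<times> nat \<Rightarrow> real"
  assumes K: "\<And>i j. i < m \<Longrightarrow> j < n \<Longrightarrow> (a + i, b + j) \<in> K \<and> r (a + i, b + j) = 1"
    and r: "\<And>k. r k > 0" and Q: "Measurable.pred borel Q"
  shows "measure (PiM K (\<lambda>k. expm (r k))) {x \<in> space (PiM K (\<lambda>k. expm (r k))). Q (lpt (shiftw (a, b) x) m n)}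
    = measure (box_measure m n) {x \<in> space (box_measure m n). Q (lpt x m n)}"
proof -
  let ?I = "{..<m} \<times> {..<n}" and ?f = "\<lambda>p. (a + fst p, b + snd p)" and ?P = "PiM K (\<lambda>k. expm (r k))"
  let ?g = "\<lambda>x. \<lambda>p\<in>?I. x (?f p)"
  note [measurable] = Q
  have eq: "PiM ?I (\<lambda>p. expm (r (?f p))) = box_measure m n"
    using K by (intro PiM_cong) auto
  have "distr ?P (PiM ?I (\<lambda>p. expm (r (?f p)))) ?g = PiM ?I (\<lambda>p. expm (r (?f p)))"
    using K by (intro distr_PiM_reindex prob_space_expm r) (auto simp: inj_on_def)
  then have d: "distr ?P (box_measure m n) ?g = box_measure m n" unfolding eq .
  have g: "?g \<in> measurable ?P (box_measure m n)"
    unfolding eq[symmetric] using K by (intro measurable_restrict) (auto intro!: measurable_component_singleton)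
  have "measure (box_measure m n) {x \<in> space (box_measure m n). Q (lpt x m n)}
    = measure (distr ?P (box_measure m n) ?g) {x \<in> space (box_measure m n). Q (lpt x m n)}" using d by simp
  also have "\<dots> = measure ?P (?g -` {x \<in> space (box_measure m n). Q (lpt x m n)} \<inter> space ?P)"
    by (rule measure_distr[OF g]) measurable
  also have "?g -` {x \<in> space (box_measure m n). Q (lpt x m n)} \<inter> space ?P
    = {x \<in> space ?P. Q (lpt (shiftw (a, b) x) m n)}"
  proof -
    have "lpt (?g x) m n = lpt (shiftw (a, b) x) m n" for x by (rule lpt_cong) auto
    then show ?thesis using measurable_space[OF g] by auto
  qed
  finally show ?thesis by simp
qed

lemma AE_expm_nonneg: "AE x in expm r. x \<ge> 0"
  by (subst AE_density) (auto simp: exponential_density_def)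

lemma AE_PiM_expm_nonneg:
  assumes "countable K" "\<And>k. r k > 0"
  shows "AE x in PiM K (\<lambda>k. expm (r k)). \<forall>k\<in>K. x k \<ge> 0"
  unfolding AE_ball_countable[OF assms(1)]
  by (intro ballI AE_PiM_component[where M = "\<lambda>k. expm (r k)" and P = "\<lambda>x. x \<ge> 0"] prob_space_expm assms AE_expm_nonneg)

text \<open>The two axis rates add up to 1 and the bulk has rate 1, as \<open>distr_burke\<close>
  requires.\<close>

definition stat_rate :: "real \<Rightarrow> nat \<times> nat \<Rightarrow> real" where
  "stat_rate q k = (if snd k = 0 \<and> fst k > 0 then 1 - q else if fst k = 0 \<and> snd k > 0 then q else 1)"

lemma stat_rate_pos: "0 < q \<Longrightarrow> q < 1 \<Longrightarrow> stat_rate q k > 0"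
  by (simp add: stat_rate_def)

primrec burke_col :: "nat \<Rightarrow> nat \<Rightarrow> (nat \<times> nat \<Rightarrow> real) \<Rightarrow> nat \<times> nat \<Rightarrow> real" where
  "burke_col i 0 x = x"
| "burke_col i (Suc j) x = burke (i, 0) (0, Suc j) (i, Suc j) (burke_col i j x)"

primrec burke_cols :: "nat \<Rightarrow> nat \<Rightarrow> (nat \<times> nat \<Rightarrow> real) \<Rightarrow> nat \<times> nat \<Rightarrow> real" where
  "burke_cols n 0 x = x"
| "burke_cols n (Suc i) x = burke_col (Suc i) n (burke_cols n i x)"

abbreviation stat_measure :: "real \<Rightarrow> nat \<Rightarrow> nat \<Rightarrow> (nat \<times> nat \<Rightarrow> real) measure" where
  "stat_measure q m n \<equiv> PiM ({..m} \<times> {..n}) (\<lambda>k. expm (stat_rate q k))"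

lemma distr_burke_col:
  assumes "0 < q" "q < 1" "0 < i" "i \<le> m" "j \<le> n"
  shows "burke_col i j \<in> measurable (stat_measure q m n) (stat_measure q m n) \<and>
    distr (stat_measure q m n) (stat_measure q m n) (burke_col i j) = stat_measure q m n"
  using assms(5)
proof (induction j)
  case 0
  have "burke_col i 0 = (\<lambda>x. x)" by auto
  then show ?case by simp
next
  case (Suc j)
  let ?P = "stat_measure q m n"
  have b: "burke (i, 0) (0, Suc j) (i, Suc j) \<in> measurable ?P ?P"
    "distr ?P ?P (burke (i, 0) (0, Suc j) (i, Suc j)) = ?P"
    by (rule distr_burke; use assms Suc in \<open>auto simp: stat_rate_def\<close>)+
  have eq: "burke_col i (Suc j) = burke (i, 0) (0, Suc j) (i, Suc j) \<circ> burke_col i j" by auto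
  have "distr ?P ?P (burke (i, 0) (0, Suc j) (i, Suc j) \<circ> burke_col i j)
      = distr (distr ?P ?P (burke_col i j)) ?P (burke (i, 0) (0, Suc j) (i, Suc j))"
    using b(1) Suc by (subst distr_distr) auto
  also have "\<dots> = ?P" using Suc b(2) by simp
  finally have "distr ?P ?P (burke (i, 0) (0, Suc j) (i, Suc j) \<circ> burke_col i j) = ?P" .
  moreover have "burke_col i j \<in> measurable ?P ?P" using Suc by simp
  ultimately show ?case unfolding eq using b(1) by (blast intro: measurable_comp)
qed

text \<open>Measure preservation means that after the sweep the slots \<open>(0, j)\<close> with
  \<open>j > 0\<close> are again independent of rate \<open>q\<close>, while they now hold vertical
  increments along column \<open>i\<close>.\<close>

lemma distr_burke_cols:
  assumes "0 < q" "q < 1" "i \<le> m"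
  shows "burke_cols n i \<in> measurable (stat_measure q m n) (stat_measure q m n) \<and>
    distr (stat_measure q m n) (stat_measure q m n) (burke_cols n i) = stat_measure q m n"
  using assms(3)
proof (induction i)
  case 0
  have "burke_cols n 0 = (\<lambda>x. x)" by auto
  then show ?case by simp
next
  case (Suc i)
  let ?P = "stat_measure q m n"
  have b: "burke_col (Suc i) n \<in> measurable ?P ?P" "distr ?P ?P (burke_col (Suc i) n) = ?P"
    using distr_burke_col[of q "Suc i" m n n] assms Suc by auto
  have eq: "burke_cols n (Suc i) = burke_col (Suc i) n \<circ> burke_cols n i" by auto
  have "distr ?P ?P (burke_col (Suc i) n \<circ> burke_cols n i) = distr (distr ?P ?P (burke_cols n i)) ?P (burke_col (Suc i) n)"
    using b(1) Suc by (subst distr_distr) auto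
  also have "\<dots> = ?P" using Suc b(2) by simp
  finally have "distr ?P ?P (burke_col (Suc i) n \<circ> burke_cols n i) = ?P" .
  moreover have "burke_cols n i \<in> measurable ?P ?P" using Suc by simp
  ultimately show ?case unfolding eq using b(1) by (blast intro: measurable_comp)
qed

text \<open>Weight 0 at the origin makes the passage time along either axis the plain sum of the
  axis variables.\<close>

definition stat_lpt :: "(nat \<times> nat \<Rightarrow> real) \<Rightarrow> nat \<Rightarrow> nat \<Rightarrow> real" where
  "stat_lpt x i j = lpt (x((0, 0) := 0)) (Suc i) (Suc j)"

lemma stat_lpt_Suc:
  "stat_lpt x (Suc i) (Suc j) = x (Suc i, Suc j) + max (stat_lpt x i (Suc j)) (stat_lpt x (Suc i) j)"
  by (simp add: stat_lpt_def)

lemma stat_lpt_boundary: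
  assumes "\<And>i j. i \<le> m \<Longrightarrow> j \<le> n \<Longrightarrow> x (i, j) \<ge> 0"
  shows "i < m \<Longrightarrow> stat_lpt x (Suc i) 0 = x (Suc i, 0) + stat_lpt x i 0"
    "j < n \<Longrightarrow> stat_lpt x 0 (Suc j) = x (0, Suc j) + stat_lpt x 0 j"
    "stat_lpt x 0 0 = 0"
proof -
  have "lpt (x((0, 0) := 0)) i' j' \<ge> 0" if "i' \<le> Suc m" "j' \<le> Suc n" for i' j'
    using that assms by (intro lpt_nonneg) auto
  from this[of "Suc i" "Suc 0"] this[of "Suc 0" "Suc j"] show
   "i < m \<Longrightarrow> stat_lpt x (Suc i) 0 = x (Suc i, 0) + stat_lpt x i 0"
    "j < n \<Longrightarrow> stat_lpt x 0 (Suc j) = x (0, Suc j) + stat_lpt x 0 j"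
    by (auto simp: stat_lpt_def)
qed (simp add: stat_lpt_def)

text \<open>
  Sweeping a column keeps the current horizontal increment of the passage time in slot \<open>(i, 0)\<close>
  and replaces the vertical increments of the previous column, stored in the slots \<open>(0, j)\<close>,
  by those of the current one.
\<close>

lemma burke_col_increments:
  fixes x z :: "nat \<times> nat \<Rightarrow> real"
  assumes z: "\<And>j'. 0 < j' \<Longrightarrow> j' \<le> n \<Longrightarrow> z (0, j') = stat_lpt x i j' - stat_lpt x i (j' - 1)"
    and zx: "\<And>i' j'. i < i' \<Longrightarrow> z (i', j') = x (i', j')"
    and bd: "stat_lpt x (Suc i) 0 = x (Suc i, 0) + stat_lpt x i 0"
    and "j \<le> n"
  shows "burke_col (Suc i) j z (Suc i, 0) = stat_lpt x (Suc i) j - stat_lpt x i j \<and>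
    (\<forall>j'. 0 < j' \<longrightarrow> j' \<le> j \<longrightarrow> burke_col (Suc i) j z (0, j') = stat_lpt x (Suc i) j' - stat_lpt x (Suc i) (j' - 1)) \<and>
    (\<forall>j'. j < j' \<longrightarrow> j' \<le> n \<longrightarrow> burke_col (Suc i) j z (0, j') = stat_lpt x i j' - stat_lpt x i (j' - 1)) \<and>
    (\<forall>i' j'. (i' = Suc i \<and> j < j') \<or> Suc i < i' \<longrightarrow> burke_col (Suc i) j z (i', j') = x (i', j'))"
  using assms(4)
proof (induction j)
  case 0
  then show ?case using z zx bd by auto
next
  case (Suc j)
  let ?z = "burke_col (Suc i) j z"
  let ?G = "stat_lpt x"
  have IH: "?z (Suc i, 0) = ?G (Suc i) j - ?G i j" "?z (0, Suc j) = ?G i (Suc j) - ?G i j" "?z (Suc i, Suc j) = x (Suc i, Suc j)"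
    "\<forall>j'. 0 < j' \<longrightarrow> j' \<le> j \<longrightarrow> ?z (0, j') = ?G (Suc i) j' - ?G (Suc i) (j' - 1)"
    "\<forall>j'. j < j' \<longrightarrow> j' \<le> n \<longrightarrow> ?z (0, j') = ?G i j' - ?G i (j' - 1)"
    "\<forall>i' j'. (i' = Suc i \<and> j < j') \<or> Suc i < i' \<longrightarrow> ?z (i', j') = x (i', j')"
    using Suc by auto
  have step: "?G (Suc i) (Suc j) = x (Suc i, Suc j) + max (?G i (Suc j)) (?G (Suc i) j)"
    by (rule stat_lpt_Suc)
  have v: "burke_col (Suc i) (Suc j) z (Suc i, 0) = x (Suc i, Suc j) + max (?G (Suc i) j - ?G i (Suc j)) 0"
    "burke_col (Suc i) (Suc j) z (0, Suc j) = x (Suc i, Suc j) + max (?G i (Suc j) - ?G (Suc i) j) 0"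
    "p \<noteq> (Suc i, 0) \<Longrightarrow> p \<noteq> (0, Suc j) \<Longrightarrow> p \<noteq> (Suc i, Suc j) \<Longrightarrow> burke_col (Suc i) (Suc j) z p = ?z p" for p
    using IH(1-3) by (auto simp: burke_def)
  show ?case
  proof (intro conjI allI impI)
    show "burke_col (Suc i) (Suc j) z (Suc i, 0) = ?G (Suc i) (Suc j) - ?G i (Suc j)"
      unfolding v(1) step by (auto simp: max_def)
    fix j' assume j': "0 < j'" "j' \<le> Suc j"
    show "burke_col (Suc i) (Suc j) z (0, j') = ?G (Suc i) j' - ?G (Suc i) (j' - 1)"
    proof (cases "j' = Suc j")
      case True
      show ?thesis unfolding True v(2) using step by (auto simp: max_def)
    next
      case False
      then show ?thesis using v(3)[of "(0, j')"] IH(4) j' by auto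
    qed
  next
    fix j' assume "Suc j < j'" "j' \<le> n"
    then show "burke_col (Suc i) (Suc j) z (0, j') = ?G i j' - ?G i (j' - 1)"
      using v(3)[of "(0, j')"] IH(5) by auto
  next
    fix i' j' assume "(i' = Suc i \<and> Suc j < j') \<or> Suc i < i'"
    then show "burke_col (Suc i) (Suc j) z (i', j') = x (i', j')"
      using v(3)[of "(i', j')"] IH(6) by auto
  qed
qed

lemma burke_cols_increments:
  assumes x: "\<And>i j. i \<le> m \<Longrightarrow> j \<le> n \<Longrightarrow> x (i, j) \<ge> 0" and "i \<le> m"
  shows "(\<forall>j'. 0 < j' \<longrightarrow> j' \<le> n \<longrightarrow> burke_cols n i x (0, j') = stat_lpt x i j' - stat_lpt x i (j' - 1)) \<and>
    (\<forall>i' j'. i < i' \<longrightarrow> burke_cols n i x (i', j') = x (i', j'))"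
  using assms(2)
proof (induction i)
  case 0
  have "x (0, j') = stat_lpt x 0 j' - stat_lpt x 0 (j' - 1)" if "0 < j'" "j' \<le> n" for j'
    using stat_lpt_boundary(2)[of m n x "j' - 1"] x that by auto
  then show ?case by auto
next
  case (Suc i)
  have "stat_lpt x (Suc i) 0 = x (Suc i, 0) + stat_lpt x i 0"
    using stat_lpt_boundary(1)[of m n x i] x Suc by auto
  from burke_col_increments[of n "burke_cols n i x" x i n, OF _ _ this] Suc show ?case by auto
qed

text \<open>Telescoping along the bottom edge and then up the right edge. The two sums need not be
  independent of each other, but each one alone has independent exponential terms.\<close>

lemma stat_lpt_eq_sums:
  assumes x: "\<And>i j. i \<le> m \<Longrightarrow> j \<le> n \<Longrightarrow> x (i, j) \<ge> 0"
  shows "stat_lpt x m n = (\<Sum>i\<in>{1..m}. x (i, 0)) + (\<Sum>j\<in>{1..n}. burke_cols n m x (0, j))"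
proof -
  have "stat_lpt x i 0 = (\<Sum>i\<in>{1..i}. x (i, 0))" if "i \<le> m" for i
    using that
  proof (induction i)
    case (Suc i)
    then show ?case using stat_lpt_boundary(1)[of m n x i] x by auto
  qed (use stat_lpt_boundary(3)[of m n x] x in auto)
  moreover have "stat_lpt x m j - stat_lpt x m 0 = (\<Sum>j\<in>{1..j}. burke_cols n m x (0, j))" if "j \<le> n" for j
    using that
  proof (induction j)
    case (Suc j)
    then show ?case using burke_cols_increments[of m n x m, OF x] by auto
  qed simp
  from this[of n] calculation[of m] show ?thesis by simp
qed

lemma measurable_stat_lpt:
  "(\<lambda>x. stat_lpt x m n) \<in> borel_measurable (stat_measure q m n)"
  unfolding stat_lpt_def
proof (rule measurable_lpt)
  fix i j assume "i < Suc m" "j < Suc n"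
  then show "(\<lambda>x. (x((0, 0) := 0)) (i, j)) \<in> borel_measurable (stat_measure q m n)"
    by (cases "(i, j) = (0, 0)") (auto intro: measurable_coord_expm)
qed

text \<open>A union bound over the two edges needs only the law of each sum. The right edge has the
  law of the left axis because \<open>burke_cols\<close> preserves the measure.\<close>

lemma stat_lpt_deviation:
  assumes "q0 > 0" "\<epsilon> > 0" "L > 0"
  shows "\<exists>c>0. \<forall>N q m n. q0 \<le> q \<longrightarrow> q \<le> 1 - q0 \<longrightarrow> real m \<le> L * real N \<longrightarrow> real n \<le> L * real N \<longrightarrow>
     measure (stat_measure q m n) {x \<in> space (stat_measure q m n).
        \<epsilon> * real N \<le> \<bar>stat_lpt x m n - (m / (1 - q) + n / q)\<bar>} \<le> 4 * exp (- c * real N)"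
proof -
  obtain c where c: "c > 0" and dev: "\<And>N (K :: (nat \<times> nat) set) S r r1. finite K \<Longrightarrow> S \<subseteq> K \<Longrightarrow> (\<forall>k. r k > 0) \<Longrightarrow> (\<forall>k\<in>S. r k = r1) \<Longrightarrow> q0 \<le> r1 \<Longrightarrow>
     real (card S) \<le> L * real N \<Longrightarrow>
     measure (PiM K (\<lambda>k. expm (r k))) {x \<in> space (PiM K (\<lambda>k. expm (r k))). \<epsilon> / 2 * real N \<le> \<bar>(\<Sum>k\<in>S. x k) - card S / r1\<bar>}
       \<le> 2 * exp (- c * real N)"
    using expm_sum_deviation[of q0 "\<epsilon> / 2" L, where 'i = "nat \<times> nat"] assms by auto
  show ?thesis
  proof (intro exI[of _ c] conjI c allI impI)
    fix N q m n assume a: "q0 \<le> q" "q \<le> 1 - q0" "real m \<le> L * real N" "real n \<le> L * real N"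
    have q: "0 < q" "q < 1" using a assms by auto
    let ?P = "stat_measure q m n"
    interpret P: prob_space ?P by (intro prob_space_PiM_expm stat_rate_pos q)
    let ?S = "{1..m} \<times> {0::nat}" and ?S' = "{0::nat} \<times> {1..n}"
    let ?A = "{x \<in> space ?P. \<epsilon> / 2 * real N \<le> \<bar>(\<Sum>k\<in>?S. x k) - card ?S / (1 - q)\<bar>}"
    let ?B = "{x \<in> space ?P. \<epsilon> / 2 * real N \<le> \<bar>(\<Sum>k\<in>?S'. x k) - card ?S' / q\<bar>}"
    have A: "P.prob ?A \<le> 2 * exp (- c * real N)"
      using a assms q stat_rate_pos[OF q] by (intro dev) (auto simp: stat_rate_def card_cartesian_product)
    have B: "P.prob ?B \<le> 2 * exp (- c * real N)"
      using a assms q stat_rate_pos[OF q] by (intro dev) (auto simp: stat_rate_def card_cartesian_product)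
    have st: "burke_cols n m \<in> measurable ?P ?P" "distr ?P ?P (burke_cols n m) = ?P"
      using distr_burke_cols[OF q, of m m n] by auto
    have [measurable]: "(\<lambda>x. \<Sum>k\<in>?S. x k) \<in> borel_measurable ?P" "(\<lambda>x. \<Sum>k\<in>?S'. x k) \<in> borel_measurable ?P"
      by (intro borel_measurable_sum measurable_coord_expm; auto)+
    note [measurable] = measurable_stat_lpt[of m n q]
    let ?B' = "burke_cols n m -` ?B \<inter> space ?P"
    have B'm: "?B' \<in> sets ?P" by (rule measurable_sets[OF st(1)]) measurable
    have "P.prob ?B' = measure (distr ?P ?P (burke_cols n m)) ?B"
      by (rule measure_distr[OF st(1), symmetric]) measurable
    also have "\<dots> = P.prob ?B" using st(2) by simp
    finally have B': "P.prob ?B' \<le> 2 * exp (- c * real N)" using B by simp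
    have "P.prob {x \<in> space ?P. \<epsilon> * real N \<le> \<bar>stat_lpt x m n - (m / (1 - q) + n / q)\<bar>} \<le> P.prob (?A \<union> ?B')"
    proof (rule P.finite_measure_mono_AE)
      show "AE x in ?P. x \<in> {x \<in> space ?P. \<epsilon> * real N \<le> \<bar>stat_lpt x m n - (m / (1 - q) + n / q)\<bar>} \<longrightarrow> x \<in> ?A \<union> ?B'"
      proof (rule AE_mp[OF AE_PiM_expm_nonneg], goal_cases)
        case 3
        show ?case
        proof (intro AE_I2 impI)
          fix x assume x: "x \<in> space ?P" "\<forall>k\<in>{..m} \<times> {..n}. x k \<ge> 0"
            "x \<in> {x \<in> space ?P. \<epsilon> * real N \<le> \<bar>stat_lpt x m n - (m / (1 - q) + n / q)\<bar>}"
          have s: "(\<Sum>k\<in>?S. x k) = (\<Sum>i\<in>{1..m}. x (i, 0))"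
            "(\<Sum>k\<in>?S'. y k) = (\<Sum>j\<in>{1..n}. y (0, j))" for y :: "nat \<times> nat \<Rightarrow> real"
            using sum.cartesian_product[of "\<lambda>i j. x (i, j)" "{0}" "{1..m}"] sum.cartesian_product[of "\<lambda>i j. y (i, j)" "{1..n}" "{0}"]
            by (simp_all add: case_prod_unfold)
          have "stat_lpt x m n = (\<Sum>k\<in>?S. x k) + (\<Sum>k\<in>?S'. burke_cols n m x k)"
            unfolding s using x(2) by (intro stat_lpt_eq_sums) auto
          moreover have "\<epsilon> / 2 * real N \<le> \<bar>u - m / (1 - q)\<bar> \<or> \<epsilon> / 2 * real N \<le> \<bar>v - n / q\<bar>"
            if "\<epsilon> * real N \<le> \<bar>(u + v) - (m / (1 - q) + n / q)\<bar>" for u v using that by argo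
          ultimately show "x \<in> ?A \<union> ?B'"
            using x(1,3) measurable_space[OF st(1) x(1)] by (auto simp: card_cartesian_product)
        qed
      qed (use stat_rate_pos[OF q] in auto)
      show "?A \<union> ?B' \<in> sets ?P" by (intro sets.Un B'm) measurable
    qed
    also have "\<dots> \<le> P.prob ?A + P.prob ?B'" by (rule measure_Un_le[OF _ B'm]) measurable
    also have "\<dots> \<le> 4 * exp (- c * real N)" using A B' by simp
    finally show "P.prob {x \<in> space ?P. \<epsilon> * real N \<le> \<bar>stat_lpt x m n - (m / (1 - q) + n / q)\<bar>} \<le> 4 * exp (- c * real N)" .
  qed
qed

section \<open>Tails of the homogeneous passage time\<close>

lemma lpt_shiftw_le:
  assumes "\<And>i j. i < a + m \<Longrightarrow> j < b + n \<Longrightarrow> w (i, j) \<ge> 0"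
  shows "lpt (shiftw (a, b) w) m n \<le> lpt w (a + m) (b + n)"
  using assms
proof (induction "shiftw (a, b) w" m n rule: lpt.induct)
  case (3 m n)
  have "lpt (shiftw (a, b) w) m (Suc n) \<le> lpt w (a + m) (b + Suc n)"
    "lpt (shiftw (a, b) w) (Suc m) n \<le> lpt w (a + Suc m) (b + n)"
    using 3 by auto
  then show ?case by (auto simp: max_def)
qed (auto intro!: lpt_nonneg)

text \<open>This absorbs the number of events in a union bound at the price of half the
  rate.\<close>

lemma polynomial_times_exp_le:
  assumes "c > 0"
  shows "\<exists>C>0. \<forall>N::nat. (1 + real N) ^ d * exp (- c * real N) \<le> C * exp (- (c / 2) * real N)"
proof -
  \<comment> \<open>With this \<open>e\<close>, the power \<open>exp (e * N) ^ d\<close> costs at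
    most the rate \<open>c / 2\<close>; the \<open>+ 1\<close> avoids division by 0 for
    \<open>d = 0\<close>.\<close>
  define e where "e = c / (2 * (real d + 1))"
  have e: "e > 0" "real d * e \<le> c / 2" using assms by (auto simp: e_def field_simps)
  have "(1 + real N) ^ d * exp (- c * real N) \<le> (1 + 1 / e) ^ d * exp (- (c / 2) * real N)" for N
  proof -
    have "e * real N \<le> exp (e * real N)" using exp_ge_add_one_self[of "e * real N"] by linarith
    then have "real N \<le> 1 / e * exp (e * real N)" using e by (simp add: field_simps)
    moreover have "1 \<le> exp (e * real N)" using e by simp
    ultimately have "1 + real N \<le> (1 + 1 / e) * exp (e * real N)" unfolding distrib_right by linarith
    then have "(1 + real N) ^ d \<le> ((1 + 1 / e) * exp (e * real N)) ^ d" by (intro power_mono) auto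
    also have "\<dots> = (1 + 1 / e) ^ d * exp (real d * e * real N)"
      by (simp add: power_mult_distrib exp_of_nat_mult mult.assoc)
    also have "\<dots> \<le> (1 + 1 / e) ^ d * exp (c / 2 * real N)"
      using mult_right_mono[OF e(2), of "real N"] e(1) by (intro mult_left_mono) auto
    finally have "(1 + real N) ^ d * exp (- c * real N) \<le> (1 + 1 / e) ^ d * exp (c / 2 * real N) * exp (- c * real N)"
      by (intro mult_right_mono) auto
    also have "\<dots> = (1 + 1 / e) ^ d * exp (- (c / 2) * real N)"
      by (simp add: mult.assoc exp_add[symmetric] algebra_simps)
    finally show ?thesis .
  qed
  moreover have "(1 + 1 / e) ^ d > 0" using e by (intro zero_less_power add_pos_pos) auto
  ultimately show ?thesis by blast
qed

text \<open>Keeps the minimising \<open>q\<close> away from 0 when neither side is short compared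
  with \<open>N\<close>; exchanging \<open>m\<close> and \<open>n\<close> does the same for
  \<open>1 - q\<close>.\<close>

lemma sqrt_ratio_bounds:
  assumes "\<eta> > 0" "N > 0" "\<eta> * N \<le> m" "\<eta> * N \<le> n" "m \<le> L * N" "n \<le> L * N"
  shows "sqrt \<eta> / (2 * sqrt L) \<le> sqrt n / (sqrt m + sqrt n)"
proof -
  have pos: "0 < \<eta> * N" using assms by simp
  then have L: "L > 0" using assms by (smt (verit) zero_less_mult_pos2)
  have le: "sqrt m \<le> sqrt L * sqrt N" "sqrt n \<le> sqrt L * sqrt N" "sqrt \<eta> * sqrt N \<le> sqrt n"
    using assms by (simp_all add: real_sqrt_mult[symmetric])
  have "0 < m" "0 < n" using assms pos by linarith+
  then have pos': "0 < sqrt m" "0 < sqrt n" by simp_all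
  have "sqrt \<eta> / (2 * sqrt L) = (sqrt \<eta> * sqrt N) / (2 * (sqrt L * sqrt N))" using assms by simp
  also have "\<dots> \<le> sqrt n / (sqrt m + sqrt n)"
    using le pos' by (intro frac_le) linarith+
  finally show ?thesis .
qed

text \<open>The minimiser \<open>q\<close> is taken for the sides enlarged by
  \<open>\<eta> * N\<close>, which bounds it away from 0 and 1 even for thin boxes and shifts the
  mean by at most \<open>\<epsilon> / 2 * N\<close>.\<close>

lemma lpt_upper_tail:
  assumes "\<epsilon> > 0" "L > 0"
  shows "\<exists>c>0. \<forall>N m n. N \<ge> 1 \<longrightarrow> real m \<le> L * real N \<longrightarrow> real n \<le> L * real N \<longrightarrow>
     measure (box_measure m n) {x \<in> space (box_measure m n). (sqrt m + sqrt n)\<^sup>2 + \<epsilon> * real N \<le> lpt x m n}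
       \<le> 4 * exp (- c * real N)"
proof -
  \<comment> \<open>Per unit of \<open>N\<close> the enlargement costs
    \<open>8 * sqrt (\<eta> * L) + 4 * \<eta>\<close>, at most
    \<open>12 * sqrt (\<eta> * L)\<close>; the 24 brings this down to
    \<open>\<epsilon> / 2\<close>.\<close>
  define \<eta> where "\<eta> = min L ((\<epsilon> / 24)\<^sup>2 / L)"
  have eta: "\<eta> > 0" "\<eta> \<le> L" "\<eta> * L \<le> (\<epsilon> / 24)\<^sup>2" using assms by (auto simp: \<eta>_def min_def field_simps)
  have s24: "sqrt \<eta> * sqrt L \<le> \<epsilon> / 24"
    using real_sqrt_le_mono[OF eta(3)] assms by (simp add: real_sqrt_mult)
  have e4: "\<eta> \<le> sqrt \<eta> * sqrt L" using eta assms
    by (metis less_eq_real_def mult_left_mono real_sqrt_ge_zero real_sqrt_le_iff real_sqrt_mult_self abs_of_pos)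
  define q0 where "q0 = sqrt \<eta> / (2 * sqrt (L + \<eta>))"
  have q0: "q0 > 0" using eta assms by (simp add: q0_def)
  obtain c where c: "c > 0" and dev: "\<And>N q m n. q0 \<le> q \<Longrightarrow> q \<le> 1 - q0 \<Longrightarrow> real m \<le> L * real N \<Longrightarrow> real n \<le> L * real N \<Longrightarrow>
     measure (stat_measure q m n) {x \<in> space (stat_measure q m n).
        \<epsilon> / 2 * real N \<le> \<bar>stat_lpt x m n - (m / (1 - q) + n / q)\<bar>} \<le> 4 * exp (- c * real N)"
    using stat_lpt_deviation[OF q0, of "\<epsilon> / 2" L] assms by auto
  show ?thesis
  proof (intro exI[of _ c] conjI c allI impI)
    fix N m n assume a: "1 \<le> N" "real m \<le> L * real N" "real n \<le> L * real N"
    have N: "real N > 0" using a by simp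
    define \<mu> \<nu> where "\<mu> = m + \<eta> * real N" and "\<nu> = n + \<eta> * real N"
    have mn: "\<mu> > 0" "\<nu> > 0" "\<eta> * real N \<le> \<mu>" "\<eta> * real N \<le> \<nu>" "\<mu> \<le> (L + \<eta>) * real N" "\<nu> \<le> (L + \<eta>) * real N"
      using a eta N by (auto simp: \<mu>_def \<nu>_def algebra_simps intro!: add_nonneg_pos)
    define q where "q = sqrt \<nu> / (sqrt \<mu> + sqrt \<nu>)"
    have st: "sqrt \<mu> > 0" "sqrt \<nu> > 0" using mn by auto
    have q1: "1 - q = sqrt \<mu> / (sqrt \<mu> + sqrt \<nu>)" using add_pos_pos[OF st] by (simp add: q_def divide_simps)
    have qb: "q0 \<le> q" "q0 \<le> 1 - q"
      using sqrt_ratio_bounds[of \<eta> "real N" \<mu> \<nu> "L + \<eta>"] sqrt_ratio_bounds[of \<eta> "real N" \<nu> \<mu> "L + \<eta>"] eta N mn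
      unfolding q1 by (auto simp: q0_def q_def add.commute)
    have q: "0 < q" "q < 1" using qb q0 by auto
    let ?P = "stat_measure q m n"
    interpret P: prob_space ?P by (intro prob_space_PiM_expm stat_rate_pos q)
    have mean: "m / (1 - q) + n / q \<le> (sqrt m + sqrt n)\<^sup>2 + \<epsilon> / 2 * real N"
    proof -
      have mm: "\<mu> = sqrt \<mu> * sqrt \<mu>" "\<nu> = sqrt \<nu> * sqrt \<nu>" using mn by simp_all
      have "m / (1 - q) + n / q \<le> \<mu> / (1 - q) + \<nu> / q"
        using q eta N by (intro add_mono divide_right_mono) (auto simp: \<mu>_def \<nu>_def)
      also have "\<mu> / (1 - q) = sqrt \<mu> * (sqrt \<mu> + sqrt \<nu>)"
        unfolding q1 using st mm(1) by (metis (no_types, lifting) divide_divide_eq_right less_irrefl nonzero_mult_div_cancel_left mult.assoc)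
      also have "\<nu> / q = sqrt \<nu> * (sqrt \<mu> + sqrt \<nu>)"
        unfolding q_def using st mm(2) by (metis (no_types, lifting) divide_divide_eq_right less_irrefl nonzero_mult_div_cancel_left mult.assoc)
      also have "sqrt \<mu> * (sqrt \<mu> + sqrt \<nu>) + sqrt \<nu> * (sqrt \<mu> + sqrt \<nu>) = (sqrt \<mu> + sqrt \<nu>)\<^sup>2"
        by (simp add: power2_eq_square algebra_simps)
      also have "\<dots> \<le> (sqrt m + sqrt n + 2 * sqrt (\<eta> * N))\<^sup>2"
      proof (rule power_mono)
        have "sqrt \<mu> \<le> sqrt m + sqrt (\<eta> * N)" "sqrt \<nu> \<le> sqrt n + sqrt (\<eta> * N)"
          unfolding \<mu>_def \<nu>_def using eta N by (intro sqrt_add_le_add_sqrt; simp)+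
        then show "sqrt \<mu> + sqrt \<nu> \<le> sqrt m + sqrt n + 2 * sqrt (\<eta> * N)" by simp
      qed (use st in auto)
      also have "\<dots> = (sqrt m + sqrt n)\<^sup>2 + 4 * sqrt (\<eta> * N) * (sqrt m + sqrt n) + 4 * (\<eta> * N)"
      proof -
        have "sqrt (\<eta> * N) * sqrt (\<eta> * N) = \<eta> * N" using eta N by simp
        then show ?thesis by (simp add: power2_eq_square algebra_simps)
      qed
      also have "4 * sqrt (\<eta> * N) * (sqrt m + sqrt n) \<le> 4 * sqrt (\<eta> * N) * (2 * sqrt (L * N))"
        using a eta N by (intro mult_left_mono) (auto intro!: add_mono[of "sqrt m" "sqrt (L * N)" "sqrt n" "sqrt (L * N)", simplified])
      also have "4 * sqrt (\<eta> * N) * (2 * sqrt (L * N)) = 8 * (sqrt \<eta> * sqrt L) * N"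
        using N by (simp add: real_sqrt_mult)
      also have "(sqrt m + sqrt n)\<^sup>2 + 8 * (sqrt \<eta> * sqrt L) * N + 4 * (\<eta> * N) = (sqrt m + sqrt n)\<^sup>2 + (8 * (sqrt \<eta> * sqrt L) + 4 * \<eta>) * N"
        by (simp add: algebra_simps)
      also have "\<dots> \<le> (sqrt m + sqrt n)\<^sup>2 + \<epsilon> / 2 * N"
        using s24 e4 N by (intro add_left_mono mult_right_mono) auto
      finally show ?thesis by simp
    qed
    have "measure (box_measure m n) {x \<in> space (box_measure m n). (sqrt m + sqrt n)\<^sup>2 + \<epsilon> * real N \<le> lpt x m n}
      = P.prob {x \<in> space ?P. (sqrt m + sqrt n)\<^sup>2 + \<epsilon> * real N \<le> lpt (shiftw (1, 1) x) m n}"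
      by (rule measure_lpt_shiftw[symmetric]) (use stat_rate_pos[OF q] in \<open>auto simp: stat_rate_def\<close>)
    also have "\<dots> \<le> P.prob {x \<in> space ?P. \<epsilon> / 2 * real N \<le> \<bar>stat_lpt x m n - (m / (1 - q) + n / q)\<bar>}"
    proof (rule P.finite_measure_mono_AE)
      show "AE x in ?P. x \<in> {x \<in> space ?P. (sqrt m + sqrt n)\<^sup>2 + \<epsilon> * real N \<le> lpt (shiftw (1, 1) x) m n} \<longrightarrow>
        x \<in> {x \<in> space ?P. \<epsilon> / 2 * real N \<le> \<bar>stat_lpt x m n - (m / (1 - q) + n / q)\<bar>}"
      proof (rule AE_mp[OF AE_PiM_expm_nonneg], goal_cases)
        case 3
        show ?case
        proof (intro AE_I2 impI)
          fix x assume x: "x \<in> space ?P" "\<forall>k\<in>{..m} \<times> {..n}. x k \<ge> 0"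
            "x \<in> {x \<in> space ?P. (sqrt m + sqrt n)\<^sup>2 + \<epsilon> * real N \<le> lpt (shiftw (1, 1) x) m n}"
          \<comment> \<open>The bulk starts at \<open>(1, 1)\<close>, so the homogeneous box lies
            inside the stationary one.\<close>
          have "lpt (shiftw (1, 1) x) m n = lpt (shiftw (1, 1) (x((0, 0) := 0))) m n" by (rule lpt_cong) auto
          also have "\<dots> \<le> lpt (x((0, 0) := 0)) (1 + m) (1 + n)" using x(2) by (intro lpt_shiftw_le) auto
          finally have "lpt (shiftw (1, 1) x) m n \<le> stat_lpt x m n" by (simp add: stat_lpt_def)
          then show "x \<in> {x \<in> space ?P. \<epsilon> / 2 * real N \<le> \<bar>stat_lpt x m n - (m / (1 - q) + n / q)\<bar>}"
            using x(1,3) mean by (auto intro!: order_trans[OF _ abs_ge_self]) argo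
        qed
      qed (use stat_rate_pos[OF q] in auto)
      note [measurable] = measurable_stat_lpt[of m n q]
      show "{x \<in> space ?P. \<epsilon> / 2 * real N \<le> \<bar>stat_lpt x m n - (m / (1 - q) + n / q)\<bar>} \<in> sets ?P" by measurable
    qed
    also have "\<dots> \<le> 4 * exp (- c * real N)" using qb a by (intro dev) auto
    finally show "measure (box_measure m n) {x \<in> space (box_measure m n). (sqrt m + sqrt n)\<^sup>2 + \<epsilon> * real N \<le> lpt x m n} \<le> 4 * exp (- c * real N)" .
  qed
qed

text \<open>\<open>k\<close> marks the last site on the axis along an optimal path, which goes on
  from \<open>(k, 1)\<close> or \<open>(1, k)\<close>. The first step decides the axis, hence
  \<open>k >= 1\<close>; positive \<open>m\<close> and \<open>n\<close> force the path to leave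
  it.\<close>

lemma lpt_exit:
  assumes w: "\<And>i j. i \<le> m \<Longrightarrow> j \<le> n \<Longrightarrow> w (i, j) \<ge> 0" and "0 < m" "0 < n"
  shows "(\<exists>k\<in>{1..m}. lpt w (Suc m) (Suc n) \<le> (\<Sum>i\<le>k. w (i, 0)) + lpt (shiftw (k, 1) w) (Suc m - k) n) \<or>
    (\<exists>k\<in>{1..n}. lpt w (Suc m) (Suc n) \<le> (\<Sum>j\<le>k. w (0, j)) + lpt (shiftw (1, k) w) m (Suc n - k))"
  using assms
proof (induction "m + n" arbitrary: m n rule: less_induct)
  case less
  obtain m' n' where mn: "m = Suc m'" "n = Suc n'" using less.prems gr0_implies_Suc by metis
  have grow1: "w (m, n) + lpt (shiftw (a, b) w) m2 (Suc n2) \<le> lpt (shiftw (a, b) w) (Suc m2) (Suc n2)"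
    if "a + m2 = m" "b + n2 = n" for a b m2 n2 using that by auto
  have grow2: "w (m, n) + lpt (shiftw (a, b) w) (Suc m2) n2 \<le> lpt (shiftw (a, b) w) (Suc m2) (Suc n2)"
    if "a + m2 = m" "b + n2 = n" for a b m2 n2 using that by auto
  consider (L) "lpt w (Suc m) (Suc n) = w (m, n) + lpt w m (Suc n)" | (R) "lpt w (Suc m) (Suc n) = w (m, n) + lpt w (Suc m) n"
    by (cases "lpt w m (Suc n) \<ge> lpt w (Suc m) n") auto
  then show ?case
  proof cases
    case L
    show ?thesis
    proof (cases "m' = 0")
      \<comment> \<open>The predecessor box is a single column, so the path follows the axis to its
        top and \<open>k = n\<close>.\<close>
      case True
      then have "lpt w m (Suc n) = (\<Sum>j\<le>n. w (0, j))"
        using lpt_one_col[of "Suc n" w] less.prems mn by (auto simp: lessThan_Suc_atMost simp del: lpt.simps sum.atMost_Suc)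
      moreover have "lpt (shiftw (1, n) w) m (Suc n - n) = w (m, n)" using True mn by simp
      ultimately have "lpt w (Suc m) (Suc n) \<le> (\<Sum>j\<le>n. w (0, j)) + lpt (shiftw (1, n) w) m (Suc n - n)" using L by simp
      then show ?thesis using less.prems by (intro disjI2 bexI[of _ n]) auto
    next
      case False
      from less.hyps[of m' n] less.prems mn False
      have "(\<exists>k\<in>{1..m'}. lpt w m (Suc n) \<le> (\<Sum>i\<le>k. w (i, 0)) + lpt (shiftw (k, 1) w) (m - k) n) \<or>
        (\<exists>k\<in>{1..n}. lpt w m (Suc n) \<le> (\<Sum>j\<le>k. w (0, j)) + lpt (shiftw (1, k) w) m' (Suc n - k))" by auto
      then show ?thesis
      proof (elim disjE bexE)
        fix k assume k: "k \<in> {1..m'}" "lpt w m (Suc n) \<le> (\<Sum>i\<le>k. w (i, 0)) + lpt (shiftw (k, 1) w) (m - k) n"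
        have "w (m, n) + lpt (shiftw (k, 1) w) (m - k) n \<le> lpt (shiftw (k, 1) w) (Suc m - k) n"
          using grow1[of k "m - k" 1 n'] k mn by (simp add: Suc_diff_le del: lpt.simps)
        then show ?thesis using k mn L by (intro disjI1 bexI[of _ k]) auto
      next
        fix k assume k: "k \<in> {1..n}" "lpt w m (Suc n) \<le> (\<Sum>j\<le>k. w (0, j)) + lpt (shiftw (1, k) w) m' (Suc n - k)"
        have "w (m, n) + lpt (shiftw (1, k) w) m' (Suc n - k) \<le> lpt (shiftw (1, k) w) m (Suc n - k)"
          using grow1[of 1 m' k "n - k"] k mn by (simp add: Suc_diff_le del: lpt.simps)
        then show ?thesis using k mn L by (intro disjI2 bexI[of _ k]) auto
      qed
    qed
  next
    case R
    show ?thesis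
    proof (cases "n' = 0")
      case True
      then have "lpt w (Suc m) n = (\<Sum>i\<le>m. w (i, 0))"
        using lpt_one_row[of "Suc m" w] less.prems mn by (auto simp: lessThan_Suc_atMost simp del: lpt.simps sum.atMost_Suc)
      moreover have "lpt (shiftw (m, 1) w) (Suc m - m) n = w (m, n)" using True mn by simp
      ultimately have "lpt w (Suc m) (Suc n) \<le> (\<Sum>i\<le>m. w (i, 0)) + lpt (shiftw (m, 1) w) (Suc m - m) n" using R by simp
      then show ?thesis using less.prems by (intro disjI1 bexI[of _ m]) auto
    next
      case False
      from less.hyps[of m n'] less.prems mn False
      have "(\<exists>k\<in>{1..m}. lpt w (Suc m) n \<le> (\<Sum>i\<le>k. w (i, 0)) + lpt (shiftw (k, 1) w) (Suc m - k) n') \<or>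
        (\<exists>k\<in>{1..n'}. lpt w (Suc m) n \<le> (\<Sum>j\<le>k. w (0, j)) + lpt (shiftw (1, k) w) m (n - k))" by auto
      then show ?thesis
      proof (elim disjE bexE)
        fix k assume k: "k \<in> {1..m}" "lpt w (Suc m) n \<le> (\<Sum>i\<le>k. w (i, 0)) + lpt (shiftw (k, 1) w) (Suc m - k) n'"
        have "w (m, n) + lpt (shiftw (k, 1) w) (Suc m - k) n' \<le> lpt (shiftw (k, 1) w) (Suc m - k) n"
          using grow2[of k "m - k" 1 n'] k mn by (simp add: Suc_diff_le del: lpt.simps)
        then show ?thesis using k mn R by (intro disjI1 bexI[of _ k]) auto
      next
        fix k assume k: "k \<in> {1..n'}" "lpt w (Suc m) n \<le> (\<Sum>j\<le>k. w (0, j)) + lpt (shiftw (1, k) w) m (n - k)"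
        have "w (m, n) + lpt (shiftw (1, k) w) m (n - k) \<le> lpt (shiftw (1, k) w) m (Suc n - k)"
          using grow2[of 1 m' k "n - k"] k mn by (simp add: Suc_diff_le del: lpt.simps)
        then show ?thesis using k mn R by (intro disjI2 bexI[of _ k]) auto
      qed
    qed
  qed
qed

text \<open>
  The left-hand side is the approximate value of the best path of the stationary model that leaves
  the boundary at distance \<open>k\<close>, when \<open>q\<close> minimises the mean.
\<close>

lemma exit_deficit:
  fixes m n k :: real
  assumes "m > 0" "n \<ge> 0" "0 \<le> k" "k \<le> m"
  shows "k * ((sqrt m + sqrt n) / sqrt m) + (sqrt (m - k) + sqrt n)\<^sup>2
    \<le> (sqrt m + sqrt n)\<^sup>2 - sqrt n / sqrt m * (k / (2 * sqrt m))\<^sup>2"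
proof -
  define a c s where "a = sqrt m" and "c = sqrt n" and "s = sqrt (m - k)"
  have p: "a > 0" "c \<ge> 0" "s \<ge> 0" "s \<le> a" and k: "k = a\<^sup>2 - s\<^sup>2"
    using assms by (auto simp: a_def c_def s_def)
  \<comment> \<open>In the square roots the deficit is exactly \<open>c / a * (a - s)^2\<close>;
    passing to \<open>k\<close> uses \<open>a + s <= 2 * a\<close>.\<close>
  have "k * ((a + c) / a) + (s + c)\<^sup>2 = (a + c)\<^sup>2 - c / a * (a - s)\<^sup>2"
    using p unfolding k by (simp add: field_simps power2_eq_square)
  moreover have "c / a * (k / (2 * a))\<^sup>2 \<le> c / a * (a - s)\<^sup>2"
  proof (intro mult_left_mono power_mono)
    have "k = (a - s) * (a + s)" by (simp add: k power2_eq_square algebra_simps)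
    also have "\<dots> \<le> (a - s) * (2 * a)" using p by (intro mult_left_mono) auto
    finally show "k / (2 * a) \<le> a - s" using p by (simp add: field_simps)
  qed (use p assms in auto)
  ultimately show ?thesis unfolding a_def c_def s_def by linarith
qed

text \<open>\<open>S\<close>, \<open>I\<close>, \<open>B\<close> stand for the stationary time, the
  axis part and the bulk part after the exit. A macroscopic \<open>k\<close> contradicts the
  deficit, and a small \<open>k\<close> makes \<open>I\<close> small, so that \<open>B\<close>, and
  with it \<open>T\<close>, is large.\<close>

lemma exit_bound:
  fixes m n k N :: real
  assumes N: "N > 0" and mn: "\<eta> * N \<le> m" "\<eta> * N \<le> n" "m \<le> L * N" "\<eta> > 0" and k: "1 \<le> k" "k \<le> m"
    and eps: "\<epsilon> > 0" "\<epsilon>1 \<le> \<epsilon> / 8" "8 * \<epsilon>1 \<le> sqrt (\<eta> / L) * (\<epsilon> * q0 / 4)\<^sup>2 / (4 * L)" and q0: "q0 > 0" "(sqrt m + sqrt n) / sqrt m \<le> 1 / q0"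
    and Nlarge: "1 / q0 \<le> \<epsilon>1 * N"
    and S: "(sqrt m + sqrt n)\<^sup>2 - \<epsilon>1 * N \<le> S" "S \<le> I + B"
    and I: "I \<le> k * ((sqrt m + sqrt n) / sqrt m) + \<epsilon>1 * N" and B: "B \<le> (sqrt (m + 1 - k) + sqrt n)\<^sup>2 + \<epsilon>1 * N" "B \<le> T"
  shows "(sqrt m + sqrt n)\<^sup>2 - \<epsilon> * N < T"
proof -
  define R where "R = (sqrt m + sqrt n) / sqrt m"
  \<comment> \<open>Threshold for a macroscopic stay: as \<open>R <= 1 / q0\<close>, a stay of
    length \<open>\<kappa> * N\<close> is worth at most \<open>\<epsilon> / 4 * N\<close>.\<close>
  define \<kappa> where "\<kappa> = \<epsilon> * q0 / 4"
  have e1: "\<epsilon>1 > 0" using order_less_le_trans[OF _ Nlarge, of 0] q0 N by (simp add: zero_less_mult_iff)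
  have pos: "0 < \<eta> * N" using N mn by simp
  then have m: "m > 0" "n > 0" and L: "L > 0" using mn N by (linarith, linarith, meson less_le_trans order_trans zero_less_mult_pos2)
  have R: "R \<le> \<epsilon>1 * N" "R > 0" using q0(2) Nlarge m by (auto simp: R_def intro!: divide_pos_pos add_pos_pos)
  have kap: "\<kappa> > 0" using eps q0 by (simp add: \<kappa>_def)
  show ?thesis
  proof (cases "k - 1 \<ge> \<kappa> * N")
    case True
    \<comment> \<open>The remaining box has \<open>m - (k - 1)\<close> columns, so the deficit is
      applied to \<open>k - 1\<close>; the extra axis site costs
      \<open>R <= \<epsilon>1 * N\<close>.\<close>
    have "(k - 1) * R + (sqrt (m + 1 - k) + sqrt n)\<^sup>2 \<le> (sqrt m + sqrt n)\<^sup>2 - sqrt n / sqrt m * ((k - 1) / (2 * sqrt m))\<^sup>2"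
      using exit_deficit[of m n "k - 1"] m k unfolding R_def by (simp add: algebra_simps)
    moreover have "8 * \<epsilon>1 * N \<le> sqrt n / sqrt m * ((k - 1) / (2 * sqrt m))\<^sup>2"
    proof -
      have "8 * \<epsilon>1 * N \<le> sqrt (\<eta> / L) * \<kappa>\<^sup>2 / (4 * L) * N"
        using eps(3) N by (intro mult_right_mono) (auto simp: \<kappa>_def)
      also have "\<dots> = sqrt (\<eta> / L) * ((\<kappa> * N)\<^sup>2 / (4 * (L * N)))" using N by (simp add: power2_eq_square)
      also have "\<dots> \<le> sqrt (n / m) * ((k - 1)\<^sup>2 / (4 * m))"
      proof (intro mult_mono)
        have "\<eta> / L = \<eta> * N / (L * N)" using N by simp
        also have "\<dots> \<le> n / m" using mn N m L by (intro frac_le) auto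
        finally show "sqrt (\<eta> / L) \<le> sqrt (n / m)" by simp
        show "(\<kappa> * N)\<^sup>2 / (4 * (L * N)) \<le> (k - 1)\<^sup>2 / (4 * m)"
          using True mn m kap N by (intro frac_le power_mono) auto
      qed (use L N mn m in auto)
      also have "\<dots> = sqrt n / sqrt m * ((k - 1) / (2 * sqrt m))\<^sup>2"
        using m by (simp add: real_sqrt_divide power_divide power_mult_distrib)
      finally show ?thesis .
    qed
    moreover have "I + B \<le> (k - 1) * R + (sqrt (m + 1 - k) + sqrt n)\<^sup>2 + R + 2 * (\<epsilon>1 * N)"
      using I B unfolding R_def[symmetric] by (simp add: algebra_simps)
    \<comment> \<open>The deficit \<open>8 * \<epsilon>1 * N\<close> beats the errors, one
      \<open>\<epsilon>1 * N\<close> each from \<open>S\<close>, \<open>I\<close>, \<open>B\<close>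
      and \<open>R\<close>.\<close>
    ultimately have "(sqrt m + sqrt n)\<^sup>2 - \<epsilon>1 * N \<le> (sqrt m + sqrt n)\<^sup>2 - 8 * (\<epsilon>1 * N) + R + 2 * (\<epsilon>1 * N)"
      using S by linarith
    moreover have "\<epsilon>1 * N > 0" using e1 N by simp
    ultimately have False using R by linarith
    then show ?thesis ..
  next
    case False
    have "k * R \<le> \<kappa> * N * R + R" using mult_right_mono[of k "\<kappa> * N + 1" R] False R by (simp add: distrib_right)
    also have "\<kappa> * N * R \<le> \<kappa> * N * (1 / q0)" using q0 kap N by (intro mult_left_mono) (auto simp: R_def)
    also have "\<dots> = \<epsilon> / 4 * N" using q0 by (simp add: \<kappa>_def)
    finally have "I \<le> \<epsilon> / 4 * N + 2 * (\<epsilon>1 * N)" using I R unfolding R_def[symmetric] by linarith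
    moreover have "\<epsilon>1 * N \<le> \<epsilon> / 8 * N" using eps N by (intro mult_right_mono) auto
    moreover have "\<epsilon> * N > 0" using eps N by simp
    ultimately show ?thesis using S B by (simp add: field_simps)
  qed
qed

lemma sum_insert_zero: "(\<Sum>i\<le>k. f i) = f 0 + (\<Sum>i\<in>{1..k}. f i)" for f :: "nat \<Rightarrow> real"
  by (simp add: atMost_atLeast0 sum.atLeast_Suc_atMost)

text \<open>With the minimising \<open>q\<close> the stationary time concentrates at
  \<open>(sqrt m + sqrt n)^2\<close>, the target value itself. If it does so while the parts at
  every exit point obey their upper bounds, \<open>exit_bound\<close> makes the bulk box large. The
  union over exit points costs a factor of order \<open>N\<close>.\<close>

lemma lpt_lower_tail_balanced:
  assumes "\<epsilon> > 0" "L > 0" "\<eta> > 0"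
  shows "\<exists>c>0. \<exists>C>0. \<forall>N m n. N \<ge> 1 \<longrightarrow> \<eta> * real N \<le> real m \<longrightarrow> \<eta> * real N \<le> real n \<longrightarrow> real m \<le> L * real N \<longrightarrow> real n \<le> L * real N \<longrightarrow>
     measure (box_measure m n) {x \<in> space (box_measure m n). lpt x m n \<le> (sqrt m + sqrt n)\<^sup>2 - \<epsilon> * real N}
       \<le> C * exp (- c * real N)"
proof -
  define q0 where "q0 = sqrt \<eta> / (2 * sqrt L)"
  have q0: "q0 > 0" using assms by (simp add: q0_def)
  define \<epsilon>1 where "\<epsilon>1 = min (\<epsilon> / 8) (sqrt (\<eta> / L) * (\<epsilon> * q0 / 4)\<^sup>2 / (4 * L) / 8)"
  have e1: "\<epsilon>1 > 0" "\<epsilon>1 \<le> \<epsilon> / 8" "8 * \<epsilon>1 \<le> sqrt (\<eta> / L) * (\<epsilon> * q0 / 4)\<^sup>2 / (4 * L)"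
    using assms q0 by (auto simp: \<epsilon>1_def)
  obtain c0 where c0: "c0 > 0" and dev0: "\<And>N q m n. q0 \<le> q \<Longrightarrow> q \<le> 1 - q0 \<Longrightarrow> real m \<le> L * real N \<Longrightarrow> real n \<le> L * real N \<Longrightarrow>
     measure (stat_measure q m n) {x \<in> space (stat_measure q m n).
        \<epsilon>1 * real N \<le> \<bar>stat_lpt x m n - (m / (1 - q) + n / q)\<bar>} \<le> 4 * exp (- c0 * real N)"
    using stat_lpt_deviation[OF q0 e1(1), of L] assms by auto
  obtain c1 where c1: "c1 > 0" and dev1: "\<And>N (K :: (nat \<times> nat) set) S r r1. finite K \<Longrightarrow> S \<subseteq> K \<Longrightarrow> (\<forall>k. r k > 0) \<Longrightarrow> (\<forall>k\<in>S. r k = r1) \<Longrightarrow> q0 \<le> r1 \<Longrightarrow>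
     real (card S) \<le> L * real N \<Longrightarrow>
     measure (PiM K (\<lambda>k. expm (r k))) {x \<in> space (PiM K (\<lambda>k. expm (r k))). \<epsilon>1 * real N \<le> \<bar>(\<Sum>k\<in>S. x k) - card S / r1\<bar>}
       \<le> 2 * exp (- c1 * real N)"
    using expm_sum_deviation[of q0 \<epsilon>1 L, where 'i = "nat \<times> nat"] assms q0 e1 by auto
  obtain c2 where c2: "c2 > 0" and dev2: "\<And>N m n. N \<ge> 1 \<Longrightarrow> real m \<le> L * real N \<Longrightarrow> real n \<le> L * real N \<Longrightarrow>
     measure (box_measure m n) {x \<in> space (box_measure m n). (sqrt m + sqrt n)\<^sup>2 + \<epsilon>1 * real N \<le> lpt x m n}
       \<le> 4 * exp (- c2 * real N)"
    using lpt_upper_tail[OF e1(1) assms(2)] by auto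
  define c where "c = min c0 (min c1 c2)"
  have c: "c > 0" "c \<le> c0" "c \<le> c1" "c \<le> c2" using c0 c1 c2 by (auto simp: c_def)
  obtain D where D: "D > 0" "\<And>N::nat. (1 + real N) ^ 1 * exp (- c * real N) \<le> D * exp (- (c / 2) * real N)"
    using polynomial_times_exp_le[OF c(1), of 1] by auto
  \<comment> \<open>The second entry makes the bound at least 1 for small \<open>N\<close>, where
    the allowance \<open>1 / q0\<close> for one axis site exceeds
    \<open>\<epsilon>1 * N\<close>.\<close>
  define C where "C = max ((4 + 12 * L) * D) (exp (c / 2 * (1 / (q0 * \<epsilon>1))))"
  show ?thesis
  proof (rule exI[of _ "c / 2"], rule conjI, use c in simp, rule exI[of _ C], intro conjI allI impI)
    show "C > 0" unfolding C_def by (rule less_le_trans[OF exp_gt_zero max.cobounded2])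
    fix N m n assume a: "1 \<le> N" "\<eta> * real N \<le> real m" "\<eta> * real N \<le> real n" "real m \<le> L * real N" "real n \<le> L * real N"
    have N: "real N > 0" using a by simp
    let ?M = "box_measure m n"
    interpret M: prob_space ?M by (intro prob_space_PiM_expm) simp
    show "M.prob {x \<in> space ?M. lpt x m n \<le> (sqrt m + sqrt n)\<^sup>2 - \<epsilon> * real N} \<le> C * exp (- (c / 2) * real N)"
    proof (cases "1 / q0 \<le> \<epsilon>1 * real N")
      case False
      then have "real N \<le> 1 / (q0 * \<epsilon>1)" using q0 e1 by (simp add: field_simps)
      then have "c / 2 * real N \<le> c / 2 * (1 / (q0 * \<epsilon>1))" using c by (intro mult_left_mono) auto
      then have "1 \<le> exp (c / 2 * (1 / (q0 * \<epsilon>1))) * exp (- (c / 2) * real N)"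
        unfolding exp_add[symmetric] by simp
      also have "\<dots> \<le> C * exp (- (c / 2) * real N)" unfolding C_def by (intro mult_right_mono) auto
      finally show ?thesis using M.prob_le_1 order_trans by blast
    next
      case True
      have mp: "0 < m" "0 < n" using a mult_pos_pos[OF assms(3) N] by auto
      define q where "q = sqrt n / (sqrt m + sqrt n)"
      have st: "sqrt m > 0" "sqrt n > 0" using mp by auto
      have q1: "1 - q = sqrt m / (sqrt m + sqrt n)" using add_pos_pos[OF st] by (simp add: q_def divide_simps)
      have qb: "q0 \<le> q" "q0 \<le> 1 - q"
        using sqrt_ratio_bounds[of \<eta> "real N" m n L] sqrt_ratio_bounds[of \<eta> "real N" n m L] assms N a
        unfolding q1 by (auto simp: q0_def q_def add.commute)
      have q: "0 < q" "q < 1" using qb q0 by auto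
      have inv: "1 / (1 - q) = (sqrt m + sqrt n) / sqrt m" "1 / q = (sqrt n + sqrt m) / sqrt n"
        unfolding q1 by (auto simp: q_def add.commute)
      have invb: "(sqrt m + sqrt n) / sqrt m \<le> 1 / q0" "(sqrt n + sqrt m) / sqrt n \<le> 1 / q0"
        unfolding inv[symmetric] using qb q0 by (auto intro!: divide_left_mono)
      have mean: "m / (1 - q) + n / q = (sqrt m + sqrt n)\<^sup>2"
      proof -
        have "real m / (1 - q) = sqrt m * sqrt m * (1 / (1 - q))" by simp
        also have "\<dots> = sqrt m * (sqrt m + sqrt n)" unfolding inv using st by (simp del: real_sqrt_mult_self)
        finally have m: "real m / (1 - q) = sqrt m * (sqrt m + sqrt n)" .
        have "real n / q = sqrt n * sqrt n * (1 / q)" by simp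
        also have "\<dots> = sqrt n * (sqrt n + sqrt m)" unfolding inv using st by (simp del: real_sqrt_mult_self)
        finally show ?thesis unfolding m by (simp add: power2_eq_square algebra_simps)
      qed
      let ?P = "stat_measure q m n"
      interpret P: prob_space ?P by (intro prob_space_PiM_expm stat_rate_pos q)
      \<comment> \<open>The bad events: stationary time off its mean, axis sum up to
        \<open>k\<close> off its mean, box after the exit too large.\<close>
      let ?B0 = "{x \<in> space ?P. \<epsilon>1 * real N \<le> \<bar>stat_lpt x m n - (m / (1 - q) + n / q)\<bar>}"
      let ?BI = "\<lambda>k. {x \<in> space ?P. \<epsilon>1 * real N \<le> \<bar>(\<Sum>i\<in>{1..k} \<times> {0}. x i) - card ({1..k} \<times> {0::nat}) / (1 - q)\<bar>}"
      let ?BJ = "\<lambda>k. {x \<in> space ?P. \<epsilon>1 * real N \<le> \<bar>(\<Sum>i\<in>{0} \<times> {1..k}. x i) - card ({0::nat} \<times> {1..k}) / q\<bar>}"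
      let ?BX = "\<lambda>k. {x \<in> space ?P. (sqrt (Suc m - k) + sqrt n)\<^sup>2 + \<epsilon>1 * real N \<le> lpt (shiftw (k, 1) x) (Suc m - k) n}"
      let ?BY = "\<lambda>k. {x \<in> space ?P. (sqrt m + sqrt (Suc n - k))\<^sup>2 + \<epsilon>1 * real N \<le> lpt (shiftw (1, k) x) m (Suc n - k)}"
      note [measurable] = measurable_stat_lpt[of m n q]
      have mB0: "?B0 \<in> P.events" by measurable
      have mBI: "?BI k \<in> P.events" if "k \<in> {1..m}" for k
      proof -
        have [measurable]: "(\<lambda>x. \<Sum>i\<in>{1..k} \<times> {0}. x i) \<in> borel_measurable ?P"
          using that by (intro borel_measurable_sum measurable_coord_expm) auto
        show ?thesis by measurable
      qed
      have mBJ: "?BJ k \<in> P.events" if "k \<in> {1..n}" for k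
      proof -
        have [measurable]: "(\<lambda>x. \<Sum>i\<in>{0} \<times> {1..k}. x i) \<in> borel_measurable ?P"
          using that by (intro borel_measurable_sum measurable_coord_expm) auto
        show ?thesis by measurable
      qed
      have mBX: "?BX k \<in> P.events" if "k \<in> {1..m}" for k
      proof -
        have [measurable]: "(\<lambda>x. lpt (shiftw (k, 1) x) (Suc m - k) n) \<in> borel_measurable ?P"
          using that by (intro measurable_lpt_shiftw) auto
        show ?thesis by measurable
      qed
      have mBY: "?BY k \<in> P.events" if "k \<in> {1..n}" for k
      proof -
        have [measurable]: "(\<lambda>x. lpt (shiftw (1, k) x) m (Suc n - k)) \<in> borel_measurable ?P"
          using that by (intro measurable_lpt_shiftw) auto
        show ?thesis by measurable
      qed
      have ex: "exp (- c0 * real N) \<le> exp (- c * real N)" "exp (- c1 * real N) \<le> exp (- c * real N)" "exp (- c2 * real N) \<le> exp (- c * real N)"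
        using c by (auto intro!: mult_right_mono)
      have p0: "P.prob ?B0 \<le> 4 * exp (- c * real N)"
      proof -
        have "P.prob ?B0 \<le> 4 * exp (- c0 * real N)" using qb a by (intro dev0) auto
        then show ?thesis using ex(1) by linarith
      qed
      have pI: "P.prob (?BI k) \<le> 2 * exp (- c * real N)" if "k \<in> {1..m}" for k
      proof -
        have "P.prob (?BI k) \<le> 2 * exp (- c1 * real N)"
          using that a qb stat_rate_pos[OF q] by (intro dev1) (auto simp: stat_rate_def card_cartesian_product)
        then show ?thesis using ex(2) by linarith
      qed
      have pJ: "P.prob (?BJ k) \<le> 2 * exp (- c * real N)" if "k \<in> {1..n}" for k
      proof -
        have "P.prob (?BJ k) \<le> 2 * exp (- c1 * real N)"
          using that a qb stat_rate_pos[OF q] by (intro dev1) (auto simp: stat_rate_def card_cartesian_product)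
        then show ?thesis using ex(2) by linarith
      qed
      have pX: "P.prob (?BX k) \<le> 4 * exp (- c * real N)" if "k \<in> {1..m}" for k
      proof -
        have "P.prob (?BX k) = measure (box_measure (Suc m - k) n) {x \<in> space (box_measure (Suc m - k) n). (sqrt (Suc m - k) + sqrt n)\<^sup>2 + \<epsilon>1 * real N \<le> lpt x (Suc m - k) n}"
          using that stat_rate_pos[OF q] by (intro measure_lpt_shiftw) (auto simp: stat_rate_def)
        also have "\<dots> \<le> 4 * exp (- c2 * real N)"
          using that a by (intro dev2) auto
        finally show ?thesis using ex(3) by linarith
      qed
      have pY: "P.prob (?BY k) \<le> 4 * exp (- c * real N)" if "k \<in> {1..n}" for k
      proof -
        have "P.prob (?BY k) = measure (box_measure m (Suc n - k)) {x \<in> space (box_measure m (Suc n - k)). (sqrt m + sqrt (Suc n - k))\<^sup>2 + \<epsilon>1 * real N \<le> lpt x m (Suc n - k)}"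
          using that stat_rate_pos[OF q] by (intro measure_lpt_shiftw) (auto simp: stat_rate_def)
        also have "\<dots> \<le> 4 * exp (- c2 * real N)"
          using that a by (intro dev2) auto
        finally show ?thesis using ex(3) by linarith
      qed
      let ?H = "\<Union>k\<in>{1..m}. ?BI k \<union> ?BX k" and ?V = "\<Union>k\<in>{1..n}. ?BJ k \<union> ?BY k"
      have mH: "?H \<in> P.events" "?V \<in> P.events"
        by (intro sets.finite_UN sets.Un mBI mBX mBJ mBY finite_atLeastAtMost; assumption)+
      have pH: "P.prob ?H \<le> (\<Sum>k\<in>{1..m}. 6 * exp (- c * real N))"
      proof -
        have "P.prob ?H \<le> (\<Sum>k\<in>{1..m}. P.prob (?BI k \<union> ?BX k))"
          by (intro measure_UNION_le sets.Un mBI mBX finite_atLeastAtMost; assumption)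
        also have "\<dots> \<le> (\<Sum>k\<in>{1..m}. 6 * exp (- c * real N))"
        proof (rule sum_mono)
          fix k assume k: "k \<in> {1..m}"
          show "P.prob (?BI k \<union> ?BX k) \<le> 6 * exp (- c * real N)"
            using measure_Un_le[OF mBI[OF k] mBX[OF k]] pI[OF k] pX[OF k] by linarith
        qed
        finally show ?thesis .
      qed
      have pV: "P.prob ?V \<le> (\<Sum>k\<in>{1..n}. 6 * exp (- c * real N))"
      proof -
        have "P.prob ?V \<le> (\<Sum>k\<in>{1..n}. P.prob (?BJ k \<union> ?BY k))"
          by (intro measure_UNION_le sets.Un mBJ mBY finite_atLeastAtMost; assumption)
        also have "\<dots> \<le> (\<Sum>k\<in>{1..n}. 6 * exp (- c * real N))"
        proof (rule sum_mono)
          fix k assume k: "k \<in> {1..n}"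
          show "P.prob (?BJ k \<union> ?BY k) \<le> 6 * exp (- c * real N)"
            using measure_Un_le[OF mBJ[OF k] mBY[OF k]] pJ[OF k] pY[OF k] by linarith
        qed
        finally show ?thesis .
      qed
      have "M.prob {x \<in> space ?M. lpt x m n \<le> (sqrt m + sqrt n)\<^sup>2 - \<epsilon> * real N}
        = P.prob {x \<in> space ?P. lpt (shiftw (1, 1) x) m n \<le> (sqrt m + sqrt n)\<^sup>2 - \<epsilon> * real N}"
        by (rule measure_lpt_shiftw[symmetric]) (use stat_rate_pos[OF q] in \<open>auto simp: stat_rate_def\<close>)
      also have "\<dots> \<le> P.prob (?B0 \<union> (?H \<union> ?V))"
      proof (rule P.finite_measure_mono_AE)
        show "AE x in ?P. x \<in> {x \<in> space ?P. lpt (shiftw (1, 1) x) m n \<le> (sqrt m + sqrt n)\<^sup>2 - \<epsilon> * real N} \<longrightarrow> x \<in> ?B0 \<union> (?H \<union> ?V)"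
        proof (rule AE_mp[OF AE_PiM_expm_nonneg], goal_cases)
          case 3
          show ?case
          proof (intro AE_I2 impI, rule ccontr)
            fix x assume x: "x \<in> space ?P" "\<forall>k\<in>{..m} \<times> {..n}. x k \<ge> 0"
              "x \<in> {x \<in> space ?P. lpt (shiftw (1, 1) x) m n \<le> (sqrt m + sqrt n)\<^sup>2 - \<epsilon> * real N}" "x \<notin> ?B0 \<union> (?H \<union> ?V)"
            let ?w = "x((0, 0) := 0)" and ?T = "lpt (shiftw (1, 1) x) m n"
            have S: "(sqrt m + sqrt n)\<^sup>2 - \<epsilon>1 * real N \<le> stat_lpt x m n"
            proof -
              have "x \<notin> ?B0" using x(4) by (meson UnI1)
              then show ?thesis using x(1) unfolding mean by auto
            qed
            have nH: "x \<notin> ?H" and nV: "x \<notin> ?V" using x(4) by (meson UnI1 UnI2)+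
            have w0: "\<And>i j. i \<le> m \<Longrightarrow> j \<le> n \<Longrightarrow> ?w (i, j) \<ge> 0" using x(2) by auto
            have "(\<exists>k\<in>{1..m}. lpt ?w (Suc m) (Suc n) \<le> (\<Sum>i\<le>k. ?w (i, 0)) + lpt (shiftw (k, 1) ?w) (Suc m - k) n) \<or>
              (\<exists>k\<in>{1..n}. lpt ?w (Suc m) (Suc n) \<le> (\<Sum>j\<le>k. ?w (0, j)) + lpt (shiftw (1, k) ?w) m (Suc n - k))"
              by (rule lpt_exit) (use w0 mp in auto)
            then have "(sqrt m + sqrt n)\<^sup>2 - \<epsilon> * real N < ?T"
            proof (elim disjE bexE)
              fix k assume k: "k \<in> {1..m}" and le: "lpt ?w (Suc m) (Suc n) \<le> (\<Sum>i\<le>k. ?w (i, 0)) + lpt (shiftw (k, 1) ?w) (Suc m - k) n"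
              have 1: "lpt (shiftw (k, 1) ?w) (Suc m - k) n = lpt (shiftw (k, 1) x) (Suc m - k) n" by (rule lpt_cong) auto
              have 2: "(\<Sum>i\<le>k. ?w (i, 0)) = (\<Sum>i\<in>{1..k} \<times> {0}. x i)"
                using sum.cartesian_product[of "\<lambda>i j. x (i, j)" "{0}" "{1..k}"]
                unfolding sum_insert_zero by (simp add: case_prod_unfold)
              note le' = le[unfolded 1 2, folded stat_lpt_def]
              have nb: "x \<notin> ?BI k" "x \<notin> ?BX k" using nH k by (meson UN_I UnI1 UnI2)+
              have 3: "lpt (shiftw (k, 1) x) (Suc m - k) n \<le> ?T"
              proof -
                \<comment> \<open>The box after the exit lies inside the box that starts at
                  \<open>(1, 1)\<close>.\<close>
                have "shiftw (k, 1) x = shiftw (k - 1, 0) (shiftw (1, 1) x)" using k by (simp add: shiftw_shiftw)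
                moreover have "lpt (shiftw (k - 1, 0) (shiftw (1, 1) x)) (Suc m - k) n \<le> lpt (shiftw (1, 1) x) ((k - 1) + (Suc m - k)) (0 + n)"
                  using x(2) k by (intro lpt_shiftw_le) auto
                ultimately show ?thesis using k by simp
              qed
              have "real (card ({1..k} \<times> {0::nat})) / (1 - q) = real k * ((sqrt m + sqrt n) / sqrt m)"
                unfolding inv(1)[symmetric] by (simp add: card_cartesian_product)
              then have I: "(\<Sum>i\<in>{1..k} \<times> {0}. x i) \<le> real k * ((sqrt m + sqrt n) / sqrt m) + \<epsilon>1 * real N"
                using nb(1) x(1) by simp
              have sm: "real (Suc m - k) = real m + 1 - real k" using k by auto
              have B: "lpt (shiftw (k, 1) x) (Suc m - k) n \<le> (sqrt (real m + 1 - real k) + sqrt n)\<^sup>2 + \<epsilon>1 * real N"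
                using nb(2) x(1) unfolding sm by simp
              show ?thesis
                using exit_bound[OF N a(2,3,4) assms(3) _ _ assms(1) e1(2,3) q0 invb(1) True S le' I B 3] k by simp
            next
              fix k assume k: "k \<in> {1..n}" and le: "lpt ?w (Suc m) (Suc n) \<le> (\<Sum>j\<le>k. ?w (0, j)) + lpt (shiftw (1, k) ?w) m (Suc n - k)"
              have 1: "lpt (shiftw (1, k) ?w) m (Suc n - k) = lpt (shiftw (1, k) x) m (Suc n - k)" by (rule lpt_cong) auto
              have 2: "(\<Sum>j\<le>k. ?w (0, j)) = (\<Sum>i\<in>{0} \<times> {1..k}. x i)"
                using sum.cartesian_product[of "\<lambda>i j. x (i, j)" "{1..k}" "{0}"]
                unfolding sum_insert_zero by (simp add: case_prod_unfold)
              note le' = le[unfolded 1 2, folded stat_lpt_def]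
              have nb: "x \<notin> ?BJ k" "x \<notin> ?BY k" using nV k by (meson UN_I UnI1 UnI2)+
              have 3: "lpt (shiftw (1, k) x) m (Suc n - k) \<le> ?T"
              proof -
                have "shiftw (1, k) x = shiftw (0, k - 1) (shiftw (1, 1) x)" using k by (simp add: shiftw_shiftw)
                moreover have "lpt (shiftw (0, k - 1) (shiftw (1, 1) x)) m (Suc n - k) \<le> lpt (shiftw (1, 1) x) (0 + m) ((k - 1) + (Suc n - k))"
                  using x(2) k by (intro lpt_shiftw_le) auto
                ultimately show ?thesis using k by simp
              qed
              have "real (card ({0::nat} \<times> {1..k})) / q = real k * ((sqrt n + sqrt m) / sqrt n)"
                unfolding inv(2)[symmetric] by (simp add: card_cartesian_product)
              then have I: "(\<Sum>i\<in>{0} \<times> {1..k}. x i) \<le> real k * ((sqrt n + sqrt m) / sqrt n) + \<epsilon>1 * real N"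
                using nb(1) x(1) by simp
              have sm: "real (Suc n - k) = real n + 1 - real k" using k by auto
              have B: "lpt (shiftw (1, k) x) m (Suc n - k) \<le> (sqrt (real n + 1 - real k) + sqrt m)\<^sup>2 + \<epsilon>1 * real N"
                using nb(2) x(1) unfolding sm by (simp add: add.commute)
              \<comment> \<open>Exit from the left axis is the previous case with \<open>m\<close>
                and \<open>n\<close> exchanged.\<close>
              have S': "(sqrt n + sqrt m)\<^sup>2 - \<epsilon>1 * real N \<le> stat_lpt x m n" using S by (simp add: add.commute)
              have "(sqrt n + sqrt m)\<^sup>2 - \<epsilon> * real N < ?T"
                using exit_bound[OF N a(3,2,5) assms(3) _ _ assms(1) e1(2,3) q0 invb(2) True S' le' I B 3] k by simp
              then show ?thesis by (simp add: add.commute)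
            qed
            then show False using x(3) by simp
          qed
        qed (use stat_rate_pos[OF q] in auto)
        show "?B0 \<union> (?H \<union> ?V) \<in> P.events" by (intro sets.Un mB0 mH)
      qed
      also have "\<dots> \<le> P.prob ?B0 + P.prob (?H \<union> ?V)" by (intro measure_Un_le sets.Un mB0 mH)
      also have "\<dots> \<le> P.prob ?B0 + (P.prob ?H + P.prob ?V)" by (intro add_left_mono measure_Un_le mH)
      also have "\<dots> \<le> 4 * exp (- c * real N) + ((\<Sum>k\<in>{1..m}. 6 * exp (- c * real N)) + (\<Sum>k\<in>{1..n}. 6 * exp (- c * real N)))"
        by (intro add_mono p0 pH pV)
      also have "\<dots> = (4 + 6 * real m + 6 * real n) * exp (- c * real N)" by (simp add: algebra_simps)
      also have "\<dots> \<le> ((4 + 12 * L) * (1 + real N) ^ 1) * exp (- c * real N)"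
        using a assms by (intro mult_right_mono) (auto simp: algebra_simps)
      also have "\<dots> \<le> (4 + 12 * L) * (D * exp (- (c / 2) * real N))"
        unfolding mult.assoc using D(2)[of N] assms by (intro mult_left_mono) auto
      also have "\<dots> \<le> C * exp (- (c / 2) * real N)"
        unfolding C_def mult.assoc[symmetric] by (intro mult_right_mono) auto
      finally show ?thesis .
    qed
  qed
qed

text \<open>In a thin box a single row or column, a sum of independent exponentials, already has
  mean \<open>(sqrt m + sqrt n)^2\<close> up to \<open>\<epsilon> / 2 * N\<close>; other boxes are
  balanced.\<close>

lemma lpt_lower_tail:
  assumes "\<epsilon> > 0" "L > 0"
  shows "\<exists>c>0. \<exists>C>0. \<forall>N m n. N \<ge> 1 \<longrightarrow> 1 \<le> m \<longrightarrow> 1 \<le> n \<longrightarrow> real m \<le> L * real N \<longrightarrow> real n \<le> L * real N \<longrightarrow>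
     measure (box_measure m n) {x \<in> space (box_measure m n). lpt x m n \<le> (sqrt m + sqrt n)\<^sup>2 - \<epsilon> * real N}
       \<le> C * exp (- c * real N)"
proof -
  \<comment> \<open>The error \<open>\<eta> + 2 * sqrt (\<eta> * L)\<close> is at most
    \<open>3 * sqrt (\<eta> * L)\<close> and has to stay below \<open>\<epsilon> / 2\<close>; hence
    the 6.\<close>
  define \<eta> where "\<eta> = min L ((\<epsilon> / 6)\<^sup>2 / L)"
  have eta: "\<eta> > 0" "\<eta> \<le> L" "\<eta> * L \<le> (\<epsilon> / 6)\<^sup>2" using assms by (auto simp: \<eta>_def min_def field_simps)
  have s6: "sqrt \<eta> * sqrt L \<le> \<epsilon> / 6"
    using real_sqrt_le_mono[OF eta(3)] assms by (simp add: real_sqrt_mult)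
  have e6: "\<eta> \<le> sqrt \<eta> * sqrt L" using eta assms
    by (metis less_eq_real_def mult_left_mono real_sqrt_ge_zero real_sqrt_le_iff real_sqrt_mult_self abs_of_pos)
  obtain c1 C1 where c1: "c1 > 0" "C1 > 0" and bal: "\<And>N m n. N \<ge> 1 \<Longrightarrow> \<eta> * real N \<le> real m \<Longrightarrow> \<eta> * real N \<le> real n \<Longrightarrow> real m \<le> L * real N \<Longrightarrow> real n \<le> L * real N \<Longrightarrow>
     measure (box_measure m n) {x \<in> space (box_measure m n). lpt x m n \<le> (sqrt m + sqrt n)\<^sup>2 - \<epsilon> * real N}
       \<le> C1 * exp (- c1 * real N)"
    using lpt_lower_tail_balanced[OF assms eta(1)] by auto
  obtain c2 where c2: "c2 > 0" and dev: "\<And>N (K :: (nat \<times> nat) set) S r r1. finite K \<Longrightarrow> S \<subseteq> K \<Longrightarrow> (\<forall>k. r k > 0) \<Longrightarrow> (\<forall>k\<in>S. r k = r1) \<Longrightarrow> 1 \<le> r1 \<Longrightarrow>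
     real (card S) \<le> L * real N \<Longrightarrow>
     measure (PiM K (\<lambda>k. expm (r k))) {x \<in> space (PiM K (\<lambda>k. expm (r k))). \<epsilon> / 2 * real N \<le> \<bar>(\<Sum>k\<in>S. x k) - card S / r1\<bar>}
       \<le> 2 * exp (- c2 * real N)"
    using expm_sum_deviation[of 1 "\<epsilon> / 2" L, where 'i = "nat \<times> nat"] assms by auto
  define c C where "c = min c1 c2" and "C = max C1 2"
  have c: "c > 0" "c \<le> c1" "c \<le> c2" "C \<ge> C1" "C \<ge> 2" using c1 c2 by (auto simp: c_def C_def)
  show ?thesis
  proof (rule exI[of _ c], rule conjI, use c in simp, rule exI[of _ C], intro conjI allI impI)
    show "C > 0" using c by simp
    fix N m n :: nat assume a: "1 \<le> N" "1 \<le> m" "1 \<le> n" "real m \<le> L * real N" "real n \<le> L * real N"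
    let ?M = "box_measure m n" and ?A = "{x \<in> space (box_measure m n). lpt x m n \<le> (sqrt m + sqrt n)\<^sup>2 - \<epsilon> * real N}"
    interpret M: prob_space ?M by (intro prob_space_PiM_expm) simp
    have N: "real N > 0" using a by simp
    have ex: "C1 * exp (- c1 * real N) \<le> C * exp (- c * real N)" "2 * exp (- c2 * real N) \<le> C * exp (- c * real N)"
      using c c1 by (auto intro!: mult_mono)
    have small: "(sqrt m + sqrt n)\<^sup>2 \<le> real k + \<epsilon> / 2 * real N" if "(real m < \<eta> * N \<and> k = n) \<or> (real n < \<eta> * N \<and> k = m)" for k
    proof -
      have *: "(sqrt u + sqrt v)\<^sup>2 \<le> v + \<epsilon> / 2 * real N" if "0 \<le> u" "u \<le> \<eta> * N" "0 \<le> v" "v \<le> L * N" for u v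
      proof -
        have "(sqrt u + sqrt v)\<^sup>2 = v + u + 2 * (sqrt u * sqrt v)" using that by (simp add: power2_sum)
        also have "\<dots> \<le> v + \<eta> * N + 2 * (sqrt (\<eta> * N) * sqrt (L * N))"
          using that by (intro add_mono mult_left_mono mult_mono) auto
        also have "sqrt (\<eta> * N) * sqrt (L * N) = (sqrt \<eta> * sqrt L) * N" using N by (simp add: real_sqrt_mult)
        also have "v + \<eta> * N + 2 * ((sqrt \<eta> * sqrt L) * N) = v + (\<eta> + 2 * (sqrt \<eta> * sqrt L)) * N" by (simp add: algebra_simps)
        also have "\<dots> \<le> v + \<epsilon> / 2 * N" using s6 e6 N by (intro add_left_mono mult_right_mono) auto
        finally show ?thesis .
      qed
      show ?thesis using that *[of m n] *[of n m] a by (auto simp: add.commute)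
    qed
    have line: "M.prob ?A \<le> C * exp (- c * real N)"
      if S: "S \<subseteq> {..<m} \<times> {..<n}" "real (card S) \<le> L * real N" "(sqrt m + sqrt n)\<^sup>2 \<le> card S + \<epsilon> / 2 * real N"
        "\<And>x. (\<forall>k\<in>{..<m} \<times> {..<n}. x k \<ge> 0) \<Longrightarrow> (\<Sum>k\<in>S. x k) \<le> lpt x m n" for S
    proof -
      let ?B = "{x \<in> space ?M. \<epsilon> / 2 * real N \<le> \<bar>(\<Sum>k\<in>S. x k) - card S / 1\<bar>}"
      have [measurable]: "(\<lambda>x. \<Sum>k\<in>S. x k) \<in> borel_measurable ?M"
        using S(1) by (intro borel_measurable_sum measurable_coord_expm[where r = "\<lambda>_. 1"]) auto
      have "M.prob ?A \<le> M.prob ?B"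
      proof (rule M.finite_measure_mono_AE)
        show "AE x in ?M. x \<in> ?A \<longrightarrow> x \<in> ?B"
        proof (rule AE_mp[OF AE_PiM_expm_nonneg], goal_cases)
          case 3
          show ?case
          proof (intro AE_I2 impI)
            fix x assume x: "x \<in> space ?M" "\<forall>k\<in>{..<m} \<times> {..<n}. x k \<ge> 0" "x \<in> ?A"
            have "\<epsilon> * real N = \<epsilon> / 2 * real N + \<epsilon> / 2 * real N" by simp
            then have "\<epsilon> / 2 * real N \<le> - ((\<Sum>k\<in>S. x k) - card S / 1)"
              using S(3) S(4)[OF x(2)] x(3) by simp
            then show "x \<in> ?B" using x(1) abs_ge_minus_self order_trans by blast
          qed
        qed auto
        show "?B \<in> M.events" by measurable
      qed
      also have "\<dots> \<le> 2 * exp (- c2 * real N)" using S by (intro dev[where r = "\<lambda>_. 1"]) auto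
      finally show ?thesis using ex(2) by linarith
    qed
    show "M.prob ?A \<le> C * exp (- c * real N)"
    proof (cases "real m < \<eta> * N \<or> real n < \<eta> * N")
      case False
      then have "M.prob ?A \<le> C1 * exp (- c1 * real N)" using a by (intro bal) auto
      then show ?thesis using ex(1) by linarith
    next
      case True
      then show ?thesis
      proof
        assume m: "real m < \<eta> * N"
        show ?thesis
        proof (rule line[of "{0} \<times> {..<n}"])
          show "(\<Sum>k\<in>{0} \<times> {..<n}. x k) \<le> lpt x m n" if "\<forall>k\<in>{..<m} \<times> {..<n}. x k \<ge> 0" for x :: "nat \<times> nat \<Rightarrow> real"
          proof -
            have "(\<Sum>k\<in>{0} \<times> {..<n}. x k) = (\<Sum>j<n. x (0, j))"
              using sum.cartesian_product[of "\<lambda>i j. x (i, j)" "{..<n}" "{0}"] by (simp add: case_prod_unfold)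
            also have "\<dots> = lpt x (Suc 0) n" using that a by (intro lpt_one_col[symmetric]) auto
            also have "\<dots> \<le> lpt x m n" using that a by (intro lpt_size_mono) auto
            finally show ?thesis .
          qed
        qed (use a m small[of n] in \<open>auto simp: card_cartesian_product\<close>)
      next
        assume n: "real n < \<eta> * N"
        show ?thesis
        proof (rule line[of "{..<m} \<times> {0}"])
          show "(\<Sum>k\<in>{..<m} \<times> {0}. x k) \<le> lpt x m n" if "\<forall>k\<in>{..<m} \<times> {..<n}. x k \<ge> 0" for x :: "nat \<times> nat \<Rightarrow> real"
          proof -
            have "(\<Sum>k\<in>{..<m} \<times> {0}. x k) = (\<Sum>j<m. x (j, 0))"
              using sum.cartesian_product[of "\<lambda>i j. x (i, j)" "{0}" "{..<m}"] by (simp add: case_prod_unfold)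
            also have "\<dots> = lpt x m (Suc 0)" using that a by (intro lpt_one_row[symmetric]) auto
            also have "\<dots> \<le> lpt x m n" using that a by (intro lpt_size_mono) auto
            finally show ?thesis .
          qed
        qed (use a n small[of m] in \<open>auto simp: card_cartesian_product\<close>)
      qed
    qed
  qed
qed

section \<open>The limit shape and two-sided deviations\<close>

definition hshape :: "real \<Rightarrow> real \<Rightarrow> real" where
  "hshape m n = (sqrt m + sqrt n)\<^sup>2"

text \<open>A box with \<open>m + 1\<close> by \<open>n + 1\<close> sites has corner increments
  \<open>m\<close> and \<open>n\<close>; for sides of order \<open>N\<close> the discrepancy is of
  order \<open>sqrt N\<close> and disappears in \<open>\<epsilon> * N\<close>.\<close>

lemma hshape_Suc_le:
  assumes "0 \<le> m" "0 \<le> n"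
  shows "hshape m n \<le> hshape (m + 1) (n + 1)" "hshape (m + 1) (n + 1) \<le> hshape m n + 4 * (sqrt m + sqrt n) + 4"
proof -
  show "hshape m n \<le> hshape (m + 1) (n + 1)" unfolding hshape_def using assms by (intro power_mono add_mono) auto
  have "sqrt (m + 1) \<le> sqrt m + 1" "sqrt (n + 1) \<le> sqrt n + 1"
    using sqrt_add_le_add_sqrt[of m 1] sqrt_add_le_add_sqrt[of n 1] assms by auto
  then have "hshape (m + 1) (n + 1) \<le> (sqrt m + sqrt n + 2)\<^sup>2" unfolding hshape_def using assms by (intro power_mono) auto
  then show "hshape (m + 1) (n + 1) \<le> hshape m n + 4 * (sqrt m + sqrt n) + 4"
    unfolding hshape_def by (simp add: power2_eq_square algebra_simps)
qed

lemma sqrt_le_linear: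
  assumes "\<epsilon> > 0" "L > 0"
  shows "\<exists>N0. \<forall>N\<ge>N0. 8 * sqrt (L * real N) + 4 \<le> \<epsilon> * real N"
proof -
  \<comment> \<open>The first entry gives \<open>4 <= \<epsilon> / 2 * N\<close>, the second
    \<open>8 * sqrt (L * N) <= \<epsilon> / 2 * N\<close>.\<close>
  define N0 where "N0 = nat \<lceil>max (8 / \<epsilon>) ((16 / \<epsilon>)\<^sup>2 * L)\<rceil>"
  have "8 * sqrt (L * real N) + 4 \<le> \<epsilon> * real N" if "N \<ge> N0" for N
  proof -
    have le: "8 / \<epsilon> \<le> real N" "(16 / \<epsilon>)\<^sup>2 * L \<le> real N"
      using that unfolding N0_def by (auto simp: nat_le_iff ceiling_le_iff)
    have "(16 / \<epsilon>)\<^sup>2 * L * real N \<le> real N * real N" using le by (intro mult_right_mono) auto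
    then have "sqrt ((16 / \<epsilon>)\<^sup>2 * (L * real N)) \<le> sqrt (real N * real N)" by (intro real_sqrt_le_mono) (simp add: mult.assoc)
    then have "16 / \<epsilon> * sqrt (L * real N) \<le> real N" using assms by (simp add: real_sqrt_mult)
    then show ?thesis using le assms by (simp add: field_simps)
  qed
  then show ?thesis by blast
qed

text \<open>Stated by increments between corner sites, so that single rows, columns and sites are
  included and boxes can be chained at common corners.\<close>

lemma lpt_deviation:
  assumes "\<epsilon> > 0" "L > 0"
  shows "\<exists>c>0. \<exists>C>0. \<forall>N m n. N \<ge> 1 \<longrightarrow> real m \<le> L * real N \<longrightarrow> real n \<le> L * real N \<longrightarrow>
     measure (box_measure (Suc m) (Suc n)) {x \<in> space (box_measure (Suc m) (Suc n)). \<epsilon> * real N \<le> \<bar>lpt x (Suc m) (Suc n) - hshape m n\<bar>}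
       \<le> C * exp (- c * real N)"
proof -
  have e2: "\<epsilon> / 2 > 0" "L + 1 > 0" using assms by auto
  obtain c1 where c1: "c1 > 0" and up: "\<And>N m n. N \<ge> 1 \<Longrightarrow> real m \<le> (L + 1) * real N \<Longrightarrow> real n \<le> (L + 1) * real N \<Longrightarrow>
     measure (box_measure m n) {x \<in> space (box_measure m n). (sqrt m + sqrt n)\<^sup>2 + \<epsilon> / 2 * real N \<le> lpt x m n}
       \<le> 4 * exp (- c1 * real N)"
    using lpt_upper_tail[OF e2] by auto
  obtain c2 C2 where c2: "c2 > 0" "C2 > 0" and lo: "\<And>N m n. N \<ge> 1 \<Longrightarrow> 1 \<le> m \<Longrightarrow> 1 \<le> n \<Longrightarrow> real m \<le> (L + 1) * real N \<Longrightarrow> real n \<le> (L + 1) * real N \<Longrightarrow>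
     measure (box_measure m n) {x \<in> space (box_measure m n). lpt x m n \<le> (sqrt m + sqrt n)\<^sup>2 - \<epsilon> / 2 * real N}
       \<le> C2 * exp (- c2 * real N)"
    using lpt_lower_tail[OF e2] by auto
  obtain N0 where N0: "\<And>N. N \<ge> N0 \<Longrightarrow> 8 * sqrt (L * real N) + 4 \<le> \<epsilon> / 2 * real N"
    using sqrt_le_linear[OF e2(1) assms(2)] by auto
  define c C where "c = min c1 c2" and "C = max (4 + C2) (exp (c * real N0))"
  have c: "c > 0" "c \<le> c1" "c \<le> c2" using c1 c2 by (auto simp: c_def)
  show ?thesis
  proof (rule exI[of _ c], rule conjI, use c in simp, rule exI[of _ C], intro conjI allI impI)
    show "C > 0" using c2 by (simp add: C_def)
    fix N m n :: nat assume a: "1 \<le> N" "real m \<le> L * real N" "real n \<le> L * real N"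
    let ?M = "box_measure (Suc m) (Suc n)"
    let ?A = "{x \<in> space ?M. \<epsilon> * real N \<le> \<bar>lpt x (Suc m) (Suc n) - hshape m n\<bar>}"
    interpret M: prob_space ?M by (intro prob_space_PiM_expm) simp
    show "M.prob ?A \<le> C * exp (- c * real N)"
    proof (cases "N0 \<le> N")
      case False
      then have "1 \<le> exp (c * real N0) * exp (- c * real N)" using c unfolding exp_add[symmetric] by simp
      also have "\<dots> \<le> C * exp (- c * real N)" unfolding C_def by (intro mult_right_mono) auto
      finally show ?thesis using M.prob_le_1 order_trans by blast
    next
      case True
      let ?h = "(sqrt (Suc m) + sqrt (Suc n))\<^sup>2"
      let ?U = "{x \<in> space ?M. ?h + \<epsilon> / 2 * real N \<le> lpt x (Suc m) (Suc n)}"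
      let ?V = "{x \<in> space ?M. lpt x (Suc m) (Suc n) \<le> ?h - \<epsilon> / 2 * real N}"
      have h: "hshape m n \<le> ?h" "?h \<le> hshape m n + \<epsilon> / 2 * real N"
      proof -
        have eq: "?h = hshape (real m + 1) (real n + 1)" by (simp add: hshape_def add.commute)
        have le: "sqrt m \<le> sqrt (L * N)" "sqrt n \<le> sqrt (L * N)" using a by auto
        show "hshape m n \<le> ?h" unfolding eq by (rule hshape_Suc_le) auto
        have "hshape (real m + 1) (real n + 1) \<le> hshape m n + 4 * (sqrt m + sqrt n) + 4"
          by (rule hshape_Suc_le) auto
        also have "\<dots> \<le> hshape m n + 4 * (sqrt (L * N) + sqrt (L * N)) + 4"
          by (intro add_mono mult_left_mono le order_refl) simp
        also have "\<dots> = hshape m n + (8 * sqrt (L * N) + 4)" by (simp add: algebra_simps)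
        also have "\<dots> \<le> hshape m n + \<epsilon> / 2 * real N" using N0[OF True] by (rule add_left_mono)
        finally show "?h \<le> hshape m n + \<epsilon> / 2 * real N" unfolding eq .
      qed
      have sub: "?A \<subseteq> ?U \<union> ?V"
      proof
        fix x assume x: "x \<in> ?A"
        have "\<epsilon> * real N = \<epsilon> / 2 * real N + \<epsilon> / 2 * real N" by simp
        then have "?h + \<epsilon> / 2 * real N \<le> lpt x (Suc m) (Suc n) \<or> lpt x (Suc m) (Suc n) \<le> ?h - \<epsilon> / 2 * real N"
          using x h unfolding mem_Collect_eq by linarith
        then show "x \<in> ?U \<union> ?V" using x by blast
      qed
      have "M.prob ?A \<le> M.prob (?U \<union> ?V)" using sub by (rule M.finite_measure_mono) measurable
      also have "\<dots> \<le> M.prob ?U + M.prob ?V" by (rule measure_Un_le) measurable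
      also have "\<dots> \<le> 4 * exp (- c1 * real N) + C2 * exp (- c2 * real N)"
        using a assms by (intro add_mono up lo) (auto simp: algebra_simps)
      also have "\<dots> \<le> 4 * exp (- c * real N) + C2 * exp (- c * real N)"
        using c c2 by (intro add_mono mult_left_mono) (auto intro: mult_right_mono)
      also have "\<dots> = (4 + C2) * exp (- c * real N)" by (simp add: algebra_simps)
      also have "\<dots> \<le> C * exp (- c * real N)" unfolding C_def by (intro mult_right_mono) auto
      finally show ?thesis .
    qed
  qed
qed

section \<open>Piecewise linear functions and bounds on the functional\<close>

lemma compact_rectQ: "compact (rectQ l b)"
proof -
  have eq: "rectQ l b = ({0..l} \<times> {-l..l}) \<inter> {p. \<bar>snd p\<bar> \<le> fst p} \<inter> {p. \<bar>b - snd p\<bar> \<le> l - fst p}"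
    by (auto simp: rectQ_def)
  have "closed {p :: real \<times> real. \<bar>snd p\<bar> \<le> fst p}" "closed {p :: real \<times> real. \<bar>b - snd p\<bar> \<le> l - fst p}"
    by (intro closed_Collect_le continuous_intros)+
  moreover have "compact ({0..l} \<times> {-l..l})" by (intro compact_Times compact_Icc)
  ultimately show ?thesis unfolding eq by (intro compact_Int_closed)
qed

lemma admissible_in_rectQ:
  assumes "y \<in> admissible l b" "0 \<le> x" "x \<le> l"
  shows "(x, y x) \<in> rectQ l b"
proof -
  have lip: "1-lipschitz_on {0..l} y" using assms by (simp add: admissible_def)
  have "dist (y x) (y 0) \<le> 1 * dist x 0" "dist (y l) (y x) \<le> 1 * dist l x"
    by (rule lipschitz_onD[OF lip]; use assms in simp)+
  then show ?thesis using assms by (auto simp: admissible_def rectQ_def dist_real_def)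
qed

text \<open>This turns the homogeneous limit shape into the integrand of \<open>functional\<close>.
  The identity behind it is \<open>(m + n)^2 - (m - n)^2 = 4 * m * n\<close>.\<close>

lemma hshape_gamma:
  assumes "0 \<le> m" "0 \<le> n"
  shows "hshape m n = (m + n) * gamma_fn ((m - n) / (m + n))"
proof (cases "m + n = 0")
  case True
  then have "m = 0" "n = 0" using assms by auto
  then show ?thesis by (simp add: hshape_def)
next
  case False
  then have pos: "m + n > 0" using assms by simp
  have "1 - ((m - n) / (m + n))\<^sup>2 = (2 * (sqrt m * sqrt n) / (m + n))\<^sup>2"
    using assms pos by (simp add: power_divide power_mult_distrib divide_simps) (simp add: power2_eq_square algebra_simps)
  then have "sqrt (1 - ((m - n) / (m + n))\<^sup>2) = 2 * (sqrt m * sqrt n) / (m + n)"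
    using assms pos by simp
  then show ?thesis using pos assms by (simp add: gamma_fn_def hshape_def power2_sum distrib_left[of "m + n"])
qed

lemma hshape_scale: "c \<ge> 0 \<Longrightarrow> hshape (c * m) (c * n) = c * hshape m n"
  unfolding hshape_def real_sqrt_mult by (simp add: power_mult_distrib flip: distrib_left)

lemma hshape_mono: "0 \<le> m \<Longrightarrow> 0 \<le> n \<Longrightarrow> m \<le> m' \<Longrightarrow> n \<le> n' \<Longrightarrow> hshape m n \<le> hshape m' n'"
  unfolding hshape_def by (intro power_mono add_mono) auto

text \<open>A sum of clamped ramps, one per piece. It is defined on the whole line, and a piece with
  \<open>X i = X (Suc i)\<close> contributes 0, so repeated nodes are harmless.\<close>

definition plin :: "(nat \<Rightarrow> real) \<Rightarrow> (nat \<Rightarrow> real) \<Rightarrow> nat \<Rightarrow> real \<Rightarrow> real" where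
  "plin X Y k x = (\<Sum>i<k. (Y (Suc i) - Y i) / (X (Suc i) - X i) * (max (X i) (min x (X (Suc i))) - X i))"

lemma mono_partition:
  fixes X :: "nat \<Rightarrow> real"
  assumes "\<forall>i<k. X i \<le> X (Suc i)" "i \<le> j" "j \<le> k"
  shows "X i \<le> X j"
proof -
  have "X i \<le> X (i + n)" if "i + n \<le> k" for n
    using that
  proof (induction n)
    case (Suc n)
    then have "X (i + n) \<le> X (Suc (i + n))" using assms(1) by simp
    then show ?case using Suc by simp
  qed simp
  from this[of "j - i"] show ?thesis using assms by simp
qed

context
  fixes X Y :: "nat \<Rightarrow> real" and k :: nat
  assumes X: "\<And>i. i < k \<Longrightarrow> X i \<le> X (Suc i)" and XY: "\<And>i. i < k \<Longrightarrow> \<bar>Y (Suc i) - Y i\<bar> \<le> X (Suc i) - X i"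
    and Y0: "Y 0 = 0"
begin

lemma plin_nodes_mono: "i \<le> j \<Longrightarrow> j \<le> k \<Longrightarrow> X i \<le> X j"
  using mono_partition[of k X i j] X by blast

lemma plin_slope_le: "i < k \<Longrightarrow> \<bar>(Y (Suc i) - Y i) / (X (Suc i) - X i)\<bar> \<le> 1"
  using X[of i] XY[of i] by (cases "X (Suc i) = X i") (auto simp: abs_le_iff divide_le_eq le_divide_eq)

lemma plin_slope_mult: "i < k \<Longrightarrow> (Y (Suc i) - Y i) / (X (Suc i) - X i) * (X (Suc i) - X i) = Y (Suc i) - Y i"
  using XY[of i] by (cases "X (Suc i) = X i") auto

lemma plin_clamp_sum:
  assumes "n \<le> k"
  shows "(\<Sum>i<n. max (X i) (min x (X (Suc i))) - X i) = max (X 0) (min x (X n)) - X 0"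
  using assms
proof (induction n)
  case (Suc n)
  have "X 0 \<le> X n" "X n \<le> X (Suc n)" using plin_nodes_mono[of 0 n] X[of n] Suc.prems by auto
  then show ?case using Suc by (auto simp: max_def min_def)
qed simp

text \<open>The clamped increments of all pieces have the same sign and telescope to the increment
  of a single clamp, so slopes of modulus at most 1 suffice.\<close>

lemma plin_lipschitz: "1-lipschitz_on A (plin X Y k)"
proof (rule lipschitz_onI)
  have le: "\<bar>plin X Y k x - plin X Y k z\<bar> \<le> x - z" if "z \<le> x" for x z
  proof -
    have "\<bar>plin X Y k x - plin X Y k z\<bar>
      \<le> (\<Sum>i<k. \<bar>(Y (Suc i) - Y i) / (X (Suc i) - X i)\<bar> * \<bar>max (X i) (min x (X (Suc i))) - max (X i) (min z (X (Suc i)))\<bar>)"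
      unfolding plin_def sum_subtractf[symmetric] right_diff_distrib[symmetric]
      by (rule order_trans[OF sum_abs]) (simp add: abs_mult)
    also have "\<dots> \<le> (\<Sum>i<k. (max (X i) (min x (X (Suc i))) - X i) - (max (X i) (min z (X (Suc i))) - X i))"
    proof (rule sum_mono)
      fix i assume "i \<in> {..<k}"
      then have "\<bar>(Y (Suc i) - Y i) / (X (Suc i) - X i)\<bar> \<le> 1" using plin_slope_le by simp
      then have "\<bar>(Y (Suc i) - Y i) / (X (Suc i) - X i)\<bar> * \<bar>max (X i) (min x (X (Suc i))) - max (X i) (min z (X (Suc i)))\<bar>
        \<le> 1 * \<bar>max (X i) (min x (X (Suc i))) - max (X i) (min z (X (Suc i)))\<bar>" by (intro mult_right_mono) auto
      also have "\<dots> = (max (X i) (min x (X (Suc i))) - X i) - (max (X i) (min z (X (Suc i))) - X i)"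
        using that by (auto simp: max_def min_def)
      finally show "\<bar>(Y (Suc i) - Y i) / (X (Suc i) - X i)\<bar> * \<bar>max (X i) (min x (X (Suc i))) - max (X i) (min z (X (Suc i)))\<bar>
        \<le> (max (X i) (min x (X (Suc i))) - X i) - (max (X i) (min z (X (Suc i))) - X i)" .
    qed
    also have "\<dots> = max (X 0) (min x (X k)) - max (X 0) (min z (X k))"
      by (subst sum_subtractf) (use plin_clamp_sum[of k x] plin_clamp_sum[of k z] in linarith)
    also have "\<dots> \<le> x - z" using that by (auto simp: max_def min_def)
    finally show ?thesis .
  qed
  show "dist (plin X Y k x) (plin X Y k z) \<le> 1 * dist x z" for x z
    using le[of x z] le[of z x] by (cases "z \<le> x") (auto simp: dist_real_def abs_minus_commute)
qed simp

text \<open>On piece \<open>j\<close> the earlier ramps are complete and telescope to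
  \<open>Y j\<close>, while the later ones have not started.\<close>

lemma plin_affine:
  assumes j: "j < k" and x: "X j \<le> x" "x \<le> X (Suc j)"
  shows "plin X Y k x = Y j + (Y (Suc j) - Y j) / (X (Suc j) - X j) * (x - X j)"
proof -
  let ?t = "\<lambda>i. (Y (Suc i) - Y i) / (X (Suc i) - X i) * (max (X i) (min x (X (Suc i))) - X i)"
  have "plin X Y k x = sum ?t ({..<j} \<union> {j} \<union> {j<..<k})"
    unfolding plin_def using j by (intro sum.cong) auto
  also have "\<dots> = sum ?t {..<j} + ?t j + sum ?t {j<..<k}"
    by (subst sum.union_disjoint; auto)+
  also have "sum ?t {j<..<k} = 0"
  proof (rule sum.neutral, safe)
    fix i assume "i \<in> {j<..<k}"
    then have "X (Suc j) \<le> X i" "X i \<le> X (Suc i)" using plin_nodes_mono[of "Suc j" i] X[of i] by auto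
    then have "max (X i) (min x (X (Suc i))) = X i" using x by auto
    then show "?t i = 0" by simp
  qed
  also have "sum ?t {..<j} = (\<Sum>i<j. Y (Suc i) - Y i)"
  proof (rule sum.cong)
    fix i assume i: "i \<in> {..<j}"
    then have "X (Suc i) \<le> X j" "X i \<le> X (Suc i)" using plin_nodes_mono[of "Suc i" j] X[of i] j by auto
    then have "max (X i) (min x (X (Suc i))) = X (Suc i)" using x by auto
    then show "?t i = Y (Suc i) - Y i" using plin_slope_mult[of i] i j by simp
  qed simp
  also have "\<dots> = Y j" using sum_lessThan_telescope[of Y j] Y0 by simp
  also have "?t j = (Y (Suc j) - Y j) / (X (Suc j) - X j) * (x - X j)" using x by auto
  finally show ?thesis by simp
qed

lemma plin_deriv:
  assumes "j < k" and x: "x \<in> {X j<..<X (Suc j)}"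
  shows "deriv (plin X Y k) x = (Y (Suc j) - Y j) / (X (Suc j) - X j)"
proof -
  let ?s = "(Y (Suc j) - Y j) / (X (Suc j) - X j)"
  have "((\<lambda>x. c + s * (x - a)) has_real_derivative s) (at x)" for c s a by (auto intro!: derivative_eq_intros)
  then have "(plin X Y k has_real_derivative ?s) (at x)"
    by (rule has_field_derivative_transform_within_open[where S = "{X j<..<X (Suc j)}" and f = "\<lambda>x. Y j + ?s * (x - X j)"])
      (use x plin_affine[OF assms(1)] in auto)
  then show ?thesis by (rule DERIV_imp_deriv)
qed

lemma plin_node: "j \<le> k \<Longrightarrow> plin X Y k (X j) = Y j"
proof (cases "j < k")
  case True
  then show ?thesis using plin_affine[OF True, of "X j"] X by simp
next
  case False
  assume "j \<le> k"
  then have "j = k" using False by simp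
  show ?thesis
  proof (cases k)
    case 0
    then show ?thesis using \<open>j = k\<close> Y0 by (simp add: plin_def)
  next
    case (Suc k')
    then show ?thesis using \<open>j = k\<close> plin_affine[of k' "X k"] X[of k'] plin_slope_mult[of k'] by simp
  qed
qed

lemma plin_admissible: "X 0 = 0 \<Longrightarrow> X k = l \<Longrightarrow> Y k = b \<Longrightarrow> plin X Y k \<in> admissible l b"
  using plin_lipschitz plin_node[of 0] plin_node[of k] Y0 by (auto simp: admissible_def)

end

lemma partition_cover:
  fixes X :: "nat \<Rightarrow> real"
  assumes "X 0 \<le> x" "x \<le> X k" "0 < k"
  shows "\<exists>i<k. X i \<le> x \<and> x \<le> X (Suc i)"
  using assms
proof (induction k)
  case (Suc k)
  show ?case
  proof (cases "x \<le> X k \<and> 0 < k")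
    case True
    then show ?thesis using Suc less_SucI by blast
  next
    case False
    then have "X k \<le> x" using Suc.prems by (cases "k = 0") auto
    then show ?thesis using Suc.prems by blast
  qed
qed simp

lemma partition_indicator_sum:
  fixes X :: "nat \<Rightarrow> real"
  assumes "\<forall>i<k. X i \<le> X (Suc i)" "j < k" "x \<in> {X j<..<X (Suc j)}"
  shows "(\<Sum>i<k. indicator {X i<..<X (Suc i)} x * c i) = (c j :: real)"
proof -
  have "indicator {X i<..<X (Suc i)} x * c i = (if i = j then c j else 0)" if i: "i < k" for i
  proof (cases "i = j")
    case False
    have "\<not> (X i < x \<and> x < X (Suc i))"
    proof (cases "i < j")
      case True
      then have "X (Suc i) \<le> X j" using assms(2) by (intro mono_partition[OF assms(1)]) auto
      then show ?thesis using assms(3) by auto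
    next
      case F: False
      then have "X (Suc j) \<le> X i" using False i by (intro mono_partition[OF assms(1)]) auto
      then show ?thesis using assms(3) by auto
    qed
    then show ?thesis using False by (auto simp: indicator_def)
  qed (use assms in auto)
  then have "(\<Sum>i<k. indicator {X i<..<X (Suc i)} x * c i) = (\<Sum>i<k. if i = j then c j else 0)"
    by (intro sum.cong) auto
  then show ?thesis using assms(2) by simp
qed

lemma functional_eq: "functional \<alpha> l y = (\<integral>x. indicator {0..l} x * (\<alpha> (x, y x) * gamma_fn (deriv y x)) \<partial>lebesgue)"
  by (simp add: functional_def set_lebesgue_integral_def)

lemma compact_bounded_above:
  fixes \<alpha> :: "real \<times> real \<Rightarrow> real"
  assumes "continuous_on (rectQ l b) \<alpha>"
  obtains B where "B > 0" "\<And>p. p \<in> rectQ l b \<Longrightarrow> \<alpha> p \<le> B"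
proof -
  have "bounded (\<alpha> ` rectQ l b)" using compact_continuous_image[OF assms compact_rectQ] compact_imp_bounded by blast
  then obtain B where "\<forall>v\<in>\<alpha> ` rectQ l b. \<bar>v\<bar> \<le> B" by (auto simp: bounded_iff)
  then have "\<alpha> p \<le> max B 1" if "p \<in> rectQ l b" for p using that by fastforce
  then show thesis by (intro that[of "max B 1"]) auto
qed

text \<open>Off the nodes the integrand is \<alpha> times a constant on each piece, so a lower bound
  \<open>c i\<close> for \<alpha> can be integrated exactly.\<close>

lemma functional_plin_ge:
  fixes X Y :: "nat \<Rightarrow> real"
  assumes cont: "continuous_on (rectQ l b) \<alpha>" and nn: "\<forall>p\<in>rectQ l b. \<alpha> p \<ge> 0"
    and X: "\<And>i. i < k \<Longrightarrow> X i \<le> X (Suc i)" and XY: "\<And>i. i < k \<Longrightarrow> \<bar>Y (Suc i) - Y i\<bar> \<le> X (Suc i) - X i"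
    and ends: "Y 0 = 0" "X 0 = 0" "X k = l" "Y k = b" and k: "0 < k"
    and c: "\<And>i. i < k \<Longrightarrow> 0 \<le> c i" "\<And>i x. i < k \<Longrightarrow> x \<in> {X i<..<X (Suc i)} \<Longrightarrow> c i \<le> \<alpha> (x, plin X Y k x)"
  shows "(\<Sum>i<k. c i * ((X (Suc i) - X i) * gamma_fn ((Y (Suc i) - Y i) / (X (Suc i) - X i)))) \<le> functional \<alpha> l (plin X Y k)"
proof -
  let ?y = "plin X Y k"
  let ?\<gamma> = "\<lambda>i. gamma_fn ((Y (Suc i) - Y i) / (X (Suc i) - X i))"
  have adm: "?y \<in> admissible l b" by (rule plin_admissible) (use X XY ends in auto)
  note inQ = admissible_in_rectQ[OF adm]
  have Xle: "X i \<le> X j" if "i \<le> j" "j \<le> k" for i j using X that by (intro mono_partition) auto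
  have gam: "0 \<le> ?\<gamma> i" "?\<gamma> i \<le> 2" if "i < k" for i
    using gamma_fn_bounds plin_slope_le[of k X Y i] X XY that ends by auto
  obtain B where B: "B > 0" "\<And>p. p \<in> rectQ l b \<Longrightarrow> \<alpha> p \<le> B" using compact_bounded_above[OF cont] by blast
  define a where "a x = indicator {0..l} x * \<alpha> (x, ?y x)" for x
  have contA: "continuous_on {0..l} (\<lambda>x. \<alpha> (x, ?y x))"
  proof (rule continuous_on_compose2[OF cont])
    have "1-lipschitz_on {0..l} ?y" using adm by (simp add: admissible_def)
    then have "continuous_on {0..l} ?y" by (rule lipschitz_on_continuous_on)
    then show "continuous_on {0..l} (\<lambda>x. (x, ?y x))" by (intro continuous_intros)
    show "(\<lambda>x. (x, ?y x)) ` {0..l} \<subseteq> rectQ l b" using inQ by auto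
  qed
  have am [measurable]: "a \<in> borel_measurable borel"
    using borel_measurable_continuous_on_indicator[OF _ contA] unfolding a_def by simp
  have ab: "0 \<le> a x" "a x \<le> B" for x using inQ[of x] nn B by (auto simp: a_def indicator_def)
  \<comment> \<open>A Borel function that avoids \<open>deriv\<close>, whose value at a node is not
    controlled.\<close>
  define G where "G x = a x * (\<Sum>i<k. indicator {X i<..<X (Suc i)} x * ?\<gamma> i)" for x
  have Gm [measurable]: "G \<in> borel_measurable borel" unfolding G_def by measurable
  have G_in: "G x = \<alpha> (x, ?y x) * ?\<gamma> j" if "j < k" "x \<in> {X j<..<X (Suc j)}" for j x
  proof -
    have "X 0 \<le> X j" "X (Suc j) \<le> X k" using Xle that by auto
    then have "x \<in> {0..l}" using that ends by auto
    then show ?thesis unfolding G_def a_def using partition_indicator_sum[of k X j x ?\<gamma>] X that by simp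
  qed
  have G_out: "G x = 0" if "\<And>j. j < k \<Longrightarrow> x \<notin> {X j<..<X (Suc j)}" for x
  proof -
    have "(\<Sum>i<k. indicator {X i<..<X (Suc i)} x * ?\<gamma> i) = 0"
      using that by (intro sum.neutral) (auto simp: indicator_def)
    then show ?thesis by (simp add: G_def)
  qed
  have Gb: "0 \<le> G x \<and> G x \<le> B * 2" for x
  proof (cases "\<exists>j<k. x \<in> {X j<..<X (Suc j)}")
    case True
    then obtain j where j: "j < k" "x \<in> {X j<..<X (Suc j)}" by blast
    have "X 0 \<le> X j" "X (Suc j) \<le> X k" using Xle j by auto
    then have "(x, ?y x) \<in> rectQ l b" using j ends by (intro inQ) auto
    then show ?thesis unfolding G_in[OF j] using gam[OF j(1)] nn B by (auto intro!: mult_mono)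
  next
    case False
    then show ?thesis using G_out[of x] B by auto
  qed
  define f where "f x = indicator {0..l} x * (\<alpha> (x, ?y x) * gamma_fn (deriv ?y x))" for x
  let ?F = "X ` {..k}"
  have fG: "f x = G x" if "x \<notin> ?F" for x
  proof (cases "x \<in> {0..l}")
    case True
    then obtain i where i: "i < k" "X i \<le> x" "x \<le> X (Suc i)" using partition_cover[of X x k] ends k by auto
    moreover have "x \<noteq> X i" "x \<noteq> X (Suc i)" using that i by auto
    ultimately have x: "x \<in> {X i<..<X (Suc i)}" by auto
    have "deriv ?y x = (Y (Suc i) - Y i) / (X (Suc i) - X i)" by (rule plin_deriv) (use X XY ends i x in auto)
    then show ?thesis unfolding f_def G_in[OF i(1) x] using True by simp
  next
    case False
    then show ?thesis by (simp add: f_def G_def a_def)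
  qed
  \<comment> \<open>A finite correction at the nodes transfers measurability from \<open>G\<close>
    to the actual integrand.\<close>
  have feq: "f = (\<lambda>x. G x + (\<Sum>p\<in>?F. (f p - G p) * indicator {p} x))"
  proof
    fix x
    show "f x = G x + (\<Sum>p\<in>?F. (f p - G p) * indicator {p} x)"
    proof (cases "x \<in> ?F")
      case True
      have "(\<Sum>p\<in>?F. (f p - G p) * indicator {p} x) = (\<Sum>p\<in>?F. if p = x then f x - G x else 0)"
        by (intro sum.cong) (auto simp: indicator_def)
      then show ?thesis using True by simp
    next
      case False
      then have "(\<Sum>p\<in>?F. (f p - G p) * indicator {p} x) = 0" by (intro sum.neutral) (auto simp: indicator_def)
      then show ?thesis using fG[OF False] by simp
    qed
  qed
  have fm: "f \<in> borel_measurable lebesgue" by (subst feq) (rule measurable_completion, measurable)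
  have Gml: "G \<in> borel_measurable lebesgue" by (rule measurable_completion) measurable
  have "AE x in lebesgue. f x = G x"
    by (rule AE_I'[of ?F]) (use fG in \<open>auto intro!: null_sets_completionI countable_imp_null_set_lborel\<close>)
  then have fint: "(\<integral>x. f x \<partial>lebesgue) = (\<integral>x. G x \<partial>lebesgue)" by (rule integral_cong_AE[OF fm Gml])
  let ?h = "\<lambda>x. \<Sum>i<k. (c i * ?\<gamma> i) * indicator {X i<..<X (Suc i)} x"
  have indint: "integrable lebesgue (indicat_real {u<..<v})" for u v :: real
    by (cases "u \<le> v") (auto intro!: integrable_real_indicator)
  have "(\<integral>x. ?h x \<partial>lebesgue) \<le> (\<integral>x. G x \<partial>lebesgue)"
  proof (rule integral_mono)
    show "integrable lebesgue ?h" by (intro Bochner_Integration.integrable_sum integrable_mult_right indint)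
    have "integrable lebesgue (\<lambda>x. indicator {0..l} x * G x)"
      using Gb by (intro integrable_indicator_bounded[OF Gml, of "B * 2"]) (auto simp: abs_le_iff intro: order_trans)
    moreover have "(\<lambda>x. indicator {0..l} x * G x) = G" by (auto simp: G_def a_def indicator_def)
    ultimately show "integrable lebesgue G" by simp
    fix x
    show "?h x \<le> G x"
    proof (cases "\<exists>j<k. x \<in> {X j<..<X (Suc j)}")
      case True
      then obtain j where j: "j < k" "x \<in> {X j<..<X (Suc j)}" by blast
      have "?h x = c j * ?\<gamma> j"
        using partition_indicator_sum[of k X j x "\<lambda>i. c i * ?\<gamma> i"] X j by (simp add: mult.commute)
      also have "\<dots> \<le> \<alpha> (x, ?y x) * ?\<gamma> j" using c(2)[OF j] gam[OF j(1)] by (intro mult_right_mono) auto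
      finally show ?thesis unfolding G_in[OF j] .
    next
      case False
      then have "?h x = 0" by (intro sum.neutral) (auto simp: indicator_def)
      then show ?thesis using Gb[of x] by simp
    qed
  qed
  also have "(\<integral>x. ?h x \<partial>lebesgue) = (\<Sum>i<k. (c i * ?\<gamma> i) * (X (Suc i) - X i))"
    using X by (subst Bochner_Integration.integral_sum) (auto intro!: sum.cong integrable_mult_right indint simp: indint)
  finally show ?thesis
    unfolding functional_eq f_def[symmetric] fint by (simp add: mult_ac)
qed

text \<open>On each piece \<alpha> is bounded by a constant, and by \<open>jensen_gamma\<close>
  replacing \<open>y\<close> by its chord does not lower the integral of
  \<open>gamma_fn\<close>.\<close>

lemma functional_le:
  fixes X :: "nat \<Rightarrow> real"
  assumes l: "l > 0" and nn: "\<forall>p\<in>rectQ l b. \<alpha> p \<ge> 0" and y: "y \<in> admissible l b"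
    and X: "\<And>i. i < k \<Longrightarrow> X i \<le> X (Suc i)" and ends: "X 0 = 0" "X k = l" and k: "0 < k"
    and c: "\<And>i x. i < k \<Longrightarrow> x \<in> {X i..X (Suc i)} \<Longrightarrow> \<alpha> (x, y x) \<le> c i"
  shows "functional \<alpha> l y \<le> (\<Sum>i<k. c i * ((X (Suc i) - X i) * gamma_fn ((y (X (Suc i)) - y (X i)) / (X (Suc i) - X i))))"
proof -
  let ?\<gamma> = "\<lambda>i. gamma_fn ((y (X (Suc i)) - y (X i)) / (X (Suc i) - X i))"
  have lip: "1-lipschitz_on {0..l} y" using y by (simp add: admissible_def)
  note inQ = admissible_in_rectQ[OF y]
  have Xle: "X i \<le> X j" if "i \<le> j" "j \<le> k" for i j using X that by (intro mono_partition) auto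
  have X0l: "0 \<le> X i" "X i \<le> l" if "i \<le> k" for i using Xle[of 0 i] Xle[of i k] that ends by auto
  have c0: "0 \<le> c i" if "i < k" for i
    using c[OF that, of "X i"] X[OF that] inQ[of "X i"] nn X0l[of i] that by force
  have dy: "\<bar>y (X (Suc i)) - y (X i)\<bar> \<le> X (Suc i) - X i" if "i < k" for i
    using lipschitz_onD[OF lip, of "X (Suc i)" "X i"] X0l[of i] X0l[of "Suc i"] X[OF that] that by (auto simp: dist_real_def)
  have gam: "0 \<le> ?\<gamma> i" if "i < k" for i
  proof (rule gamma_fn_bounds)
    show "\<bar>(y (X (Suc i)) - y (X i)) / (X (Suc i) - X i)\<bar> \<le> 1"
      using dy[OF that] by (cases "X (Suc i) = X i") (auto simp: abs_le_iff divide_le_eq le_divide_eq)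
  qed
  obtain d where d: "d \<in> borel_measurable lebesgue" "\<And>x. \<bar>d x\<bar> \<le> 1"
    "AE x in lebesgue. x \<in> {0..l} \<longrightarrow> deriv y x = d x"
    "\<And>a c. 0 \<le> a \<Longrightarrow> a \<le> c \<Longrightarrow> c \<le> l \<Longrightarrow> (\<integral>x. indicator {a..c} x * d x \<partial>lebesgue) = y c - y a"
    using lipschitz_derivative[OF lip l] by blast
  note [measurable] = d(1)
  have gm: "(\<lambda>x. gamma_fn (d x)) \<in> borel_measurable lebesgue" unfolding gamma_fn_def by measurable
  have gb: "\<bar>gamma_fn (d x)\<bar> \<le> 2" "0 \<le> gamma_fn (d x)" for x using gamma_fn_bounds[of "d x"] d(2)[of x] by auto
  let ?f = "\<lambda>x. indicator {0..l} x * (\<alpha> (x, y x) * gamma_fn (deriv y x))"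
  let ?h = "\<lambda>x. \<Sum>i<k. c i * (indicator {X i..X (Suc i)} x * gamma_fn (d x))"
  show ?thesis
  proof (cases "integrable lebesgue ?f")
    \<comment> \<open>A non-integrable function has integral 0 by convention, and the right-hand
      side is nonnegative.\<close>
    case False
    then have "functional \<alpha> l y = 0" unfolding functional_eq by (rule not_integrable_integral_eq)
    then show ?thesis using c0 gam X by (auto intro!: sum_nonneg mult_nonneg_nonneg)
  next
    case True
    have hint: "integrable lebesgue ?h"
      by (intro Bochner_Integration.integrable_sum integrable_mult_right integrable_indicator_bounded[OF gm gb(1)])
    have "functional \<alpha> l y \<le> (\<integral>x. ?h x \<partial>lebesgue)"
      unfolding functional_eq
    proof (rule integral_mono_AE[OF True hint])
      show "AE x in lebesgue. ?f x \<le> ?h x"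
        using d(3)
      proof eventually_elim
        case (elim x)
        have nnh: "0 \<le> c i * (indicator {X i..X (Suc i)} x * gamma_fn (d x))" if "i < k" for i
          using c0[OF that] gb(2)[of x] by auto
        show ?case
        proof (cases "x \<in> {0..l}")
          case True
          then obtain i where i: "i < k" "X i \<le> x" "x \<le> X (Suc i)" using partition_cover[of X x k] ends k by auto
          have "?f x \<le> c i * (indicator {X i..X (Suc i)} x * gamma_fn (d x))"
            using True i elim c[of i x] gb(2)[of x] by (auto intro!: mult_right_mono)
          \<comment> \<open>Closed pieces overlap at the nodes, which can only increase
            \<open>?h\<close> since its terms are nonnegative.\<close>
          also have "\<dots> \<le> ?h x" using i(1) nnh by (intro member_le_sum) auto
          finally show ?thesis .
        next
          case False
          then have "?f x = 0" by simp
          also have "0 \<le> ?h x" using nnh by (intro sum_nonneg) auto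
          finally show ?thesis .
        qed
      qed
    qed
    also have "(\<integral>x. ?h x \<partial>lebesgue) = (\<Sum>i<k. c i * (\<integral>x. indicator {X i..X (Suc i)} x * gamma_fn (d x) \<partial>lebesgue))"
      by (subst Bochner_Integration.integral_sum)
        (auto intro!: sum.cong integrable_mult_right integrable_indicator_bounded[OF gm gb(1)])
    also have "\<dots> \<le> (\<Sum>i<k. c i * ((X (Suc i) - X i) * ?\<gamma> i))"
    proof (intro sum_mono mult_left_mono)
      fix i assume i: "i \<in> {..<k}"
      show "(\<integral>x. indicator {X i..X (Suc i)} x * gamma_fn (d x) \<partial>lebesgue) \<le> (X (Suc i) - X i) * ?\<gamma> i"
        using i X[of i] dy[of i] X0l[of i] X0l[of "Suc i"] by (intro jensen_gamma[OF d(1,2)] d(4)) auto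
    qed (use c0 in auto)
    finally show ?thesis .
  qed
qed

section \<open>The variational argument\<close>

text \<open>Extension by 0 outside \<open>rectQ\<close>, where the sign of \<alpha> is unknown,
  gives nonnegative weights on the whole grid.\<close>

definition envw :: "(real \<times> real \<Rightarrow> real) \<Rightarrow> real \<Rightarrow> real \<Rightarrow> nat \<Rightarrow> (nat \<times> nat \<Rightarrow> real) \<Rightarrow> nat \<times> nat \<Rightarrow> real" where
  "envw \<alpha> l b N x p = (if emb N p \<in> rectQ l b then \<alpha> (emb N p) / real N * x p else 0)"

text \<open>All sub-boxes are included because the boxes along an optimal path depend on the
  weights.\<close>

definition typical :: "real \<Rightarrow> real \<Rightarrow> real \<Rightarrow> nat \<Rightarrow> (nat \<times> nat \<Rightarrow> real) \<Rightarrow> bool" where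
  "typical \<epsilon> l b N x \<longleftrightarrow> (\<forall>p. x p \<ge> 0) \<and>
    (\<forall>i i' j j'. i \<le> i' \<longrightarrow> i' \<le> gwidth l b N \<longrightarrow> j \<le> j' \<longrightarrow> j' \<le> gwidth l (-b) N \<longrightarrow>
      \<bar>lpt (shiftw (i, j) x) (Suc (i' - i)) (Suc (j' - j)) - hshape (real (i' - i)) (real (j' - j))\<bar> \<le> \<epsilon> * real N)"

abbreviation box_lpt :: "(nat \<times> nat \<Rightarrow> real) \<Rightarrow> nat \<times> nat \<Rightarrow> nat \<times> nat \<Rightarrow> real" where
  "box_lpt w p q \<equiv> lpt (shiftw p w) (Suc (fst q - fst p)) (Suc (snd q - snd p))"

text \<open>Repeated use of \<open>lpt_cut\<close> at the prescribed antidiagonal levels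
  \<open>t i\<close>; the cut points \<open>P i\<close> depend on the weights.\<close>

lemma lpt_chain_upper:
  assumes w: "\<And>p. w p \<ge> 0"
  shows "(\<forall>i<Suc k. t i \<le> t (Suc i)) \<Longrightarrow> t 0 = 0 \<Longrightarrow> t (Suc k) = m + n \<Longrightarrow>
    \<exists>P. P 0 = (0, 0) \<and> P (Suc k) = (m, n) \<and> (\<forall>i\<le>Suc k. fst (P i) + snd (P i) = t i) \<and>
      (\<forall>i<Suc k. fst (P i) \<le> fst (P (Suc i)) \<and> snd (P i) \<le> snd (P (Suc i))) \<and>
      lpt w (Suc m) (Suc n) \<le> (\<Sum>i<Suc k. box_lpt w (P i) (P (Suc i)))"
proof (induction k arbitrary: m n)
  case 0
  show ?case
    using 0 by (intro exI[of _ "\<lambda>i. if i = 0 then (0, 0) else (m, n)"]) (auto simp: le_Suc_eq simp del: lpt.simps)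
next
  case (Suc k)
  have "t (Suc k) \<le> t (Suc (Suc k))" using Suc.prems(1) by simp
  then have "t (Suc k) \<le> m + n" using Suc.prems(3) by simp
  then obtain i j where ij: "i \<le> m" "j \<le> n" "i + j = t (Suc k)"
    "lpt w (Suc m) (Suc n) \<le> lpt w (Suc i) (Suc j) + lpt (shiftw (i, j) w) (Suc (m - i)) (Suc (n - j))"
    using lpt_cut[of w "t (Suc k)" m n] w by blast
  obtain P where P: "P 0 = (0, 0)" "P (Suc k) = (i, j)" "\<forall>i\<le>Suc k. fst (P i) + snd (P i) = t i"
      "\<forall>i<Suc k. fst (P i) \<le> fst (P (Suc i)) \<and> snd (P i) \<le> snd (P (Suc i))"
      "lpt w (Suc i) (Suc j) \<le> (\<Sum>i<Suc k. box_lpt w (P i) (P (Suc i)))"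
  proof -
    have "\<forall>i<Suc k. t i \<le> t (Suc i)" using Suc.prems(1) by simp
    from Suc.IH[OF this Suc.prems(2) ij(3)[symmetric]] that show thesis by blast
  qed
  define P' where "P' = P(Suc (Suc k) := (m, n))"
  have eq: "P' i = P i" if "i \<le> Suc k" for i using that by (auto simp: P'_def)
  have top: "P' (Suc (Suc k)) = (m, n)" by (simp add: P'_def)
  have s: "(\<Sum>i<Suc k. box_lpt w (P' i) (P' (Suc i)))
    = (\<Sum>i<Suc k. box_lpt w (P i) (P (Suc i)))"
    by (intro sum.cong) (auto simp: eq simp del: lpt.simps)
  show ?case
  proof (intro exI[of _ P'] conjI allI impI)
    show "lpt w (Suc m) (Suc n) \<le> (\<Sum>i<Suc (Suc k). box_lpt w (P' i) (P' (Suc i)))"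
      unfolding sum.lessThan_Suc[of _ "Suc k"] s using P(2,5) ij(4) eq[of "Suc k"] top by (simp del: lpt.simps sum.lessThan_Suc)
    show "fst (P' i') + snd (P' i') = t i'" if "i' \<le> Suc (Suc k)" for i'
      using that P(3) eq top Suc.prems(3) by (auto simp: le_Suc_eq)
    show "fst (P' i') \<le> fst (P' (Suc i'))" "snd (P' i') \<le> snd (P' (Suc i'))" if "i' < Suc (Suc k)" for i'
      using that P(2,4) eq top ij by (auto simp: less_Suc_eq)
  qed (use P eq top in auto)
qed

text \<open>Joining optimal paths of consecutive boxes counts common corners twice; the sum of
  \<open>w (P i)\<close> pays for that.\<close>

lemma lpt_chain_lower:
  assumes w: "\<And>p. w p \<ge> 0" and P0: "P 0 = (0, 0)"
  shows "\<forall>i<k. fst (P i) \<le> fst (P (Suc i)) \<and> snd (P i) \<le> snd (P (Suc i)) \<Longrightarrow>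
    (\<Sum>i<k. box_lpt w (P i) (P (Suc i)))
      \<le> lpt w (Suc (fst (P k))) (Suc (snd (P k))) + (\<Sum>i<k. w (P i))"
proof (induction k)
  case 0
  have "0 \<le> lpt w (Suc (fst (P 0))) (Suc (snd (P 0)))" using w by (intro lpt_nonneg)
  then show ?case by simp
next
  case (Suc k)
  have le: "fst (P k) \<le> fst (P (Suc k))" "snd (P k) \<le> snd (P (Suc k))" using Suc.prems by auto
  have "lpt w (Suc (fst (P k))) (Suc (snd (P k))) + lpt (shiftw (P k) w) (Suc (fst (P (Suc k)) - fst (P k))) (Suc (snd (P (Suc k)) - snd (P k)))
    \<le> lpt w (Suc (fst (P (Suc k)))) (Suc (snd (P (Suc k)))) + w (P k)"
    using lpt_superadditive[of w "Suc (fst (P (Suc k)) - fst (P k))" "Suc (snd (P (Suc k)) - snd (P k))" "fst (P k)" "snd (P k)", OF w] le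
    by (simp del: lpt.simps)
  then show ?case using Suc by (simp del: lpt.simps)
qed

section \<open>Deterministic comparison with the variational problem\<close>

locale lpp_env =
  fixes l b :: real and \<alpha> :: "real \<times> real \<Rightarrow> real"
  assumes b: "\<bar>b\<bar> < l" and cont: "continuous_on (rectQ l b) \<alpha>" and nn: "\<forall>p\<in>rectQ l b. \<alpha> p \<ge> 0"
begin

lemma l_pos: "l > 0" using b by linarith

lemma envw_nonneg: "(\<And>p. x p \<ge> 0) \<Longrightarrow> envw \<alpha> l b N x p \<ge> 0"
  using nn by (auto simp: envw_def)

text \<open>Bounding \<alpha> by a constant on the box reduces, by monotonicity and scaling of
  \<open>lpt\<close>, to the homogeneous box controlled by \<open>typical\<close>.\<close>

lemma box_upper:
  assumes N: "N \<ge> 1" and g: "typical \<epsilon> l b N x" and le: "i \<le> i'" "i' \<le> gwidth l b N" "j \<le> j'" "j' \<le> gwidth l (-b) N"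
    and c: "\<And>u v. i \<le> u \<Longrightarrow> u \<le> i' \<Longrightarrow> j \<le> v \<Longrightarrow> v \<le> j' \<Longrightarrow> \<alpha> (emb N (u, v)) \<le> c" and c0: "c \<ge> 0"
  shows "lpt (shiftw (i, j) (envw \<alpha> l b N x)) (Suc (i' - i)) (Suc (j' - j)) \<le> c * (hshape (real (i' - i)) (real (j' - j)) / real N + \<epsilon>)"
proof -
  have x: "x p \<ge> 0" for p using g unfolding typical_def by blast
  have "lpt (shiftw (i, j) (envw \<alpha> l b N x)) (Suc (i' - i)) (Suc (j' - j)) \<le> lpt (\<lambda>q. c / real N * shiftw (i, j) x q) (Suc (i' - i)) (Suc (j' - j))"
  proof (rule lpt_mono)
    fix u v assume "u < Suc (i' - i)" "v < Suc (j' - j)"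
    then have "\<alpha> (emb N (i + u, j + v)) \<le> c" using le by (intro c) auto
    then show "shiftw (i, j) (envw \<alpha> l b N x) (u, v) \<le> c / real N * shiftw (i, j) x (u, v)"
      using x c0 by (auto simp: envw_def intro!: mult_right_mono divide_right_mono)
  qed
  also have "\<dots> = c / real N * lpt (shiftw (i, j) x) (Suc (i' - i)) (Suc (j' - j))" using c0 by (intro lpt_scale) simp
  also have "\<dots> \<le> c / real N * (hshape (real (i' - i)) (real (j' - j)) + \<epsilon> * real N)"
  proof (rule mult_left_mono)
    have "\<bar>lpt (shiftw (i, j) x) (Suc (i' - i)) (Suc (j' - j)) - hshape (real (i' - i)) (real (j' - j))\<bar> \<le> \<epsilon> * real N"
      using g le unfolding typical_def by blast
    then show "lpt (shiftw (i, j) x) (Suc (i' - i)) (Suc (j' - j)) \<le> hshape (real (i' - i)) (real (j' - j)) + \<epsilon> * real N" by linarith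
  qed (use c0 in simp)
  also have "\<dots> = c * (hshape (real (i' - i)) (real (j' - j)) / real N + \<epsilon>)" using N by (simp add: field_simps)
  finally show ?thesis .
qed

lemma box_lower:
  assumes N: "N \<ge> 1" and g: "typical \<epsilon> l b N x" and le: "i \<le> i'" "i' \<le> gwidth l b N" "j \<le> j'" "j' \<le> gwidth l (-b) N"
    and c: "\<And>u v. i \<le> u \<Longrightarrow> u \<le> i' \<Longrightarrow> j \<le> v \<Longrightarrow> v \<le> j' \<Longrightarrow> c \<le> \<alpha> (emb N (u, v))" and c0: "c \<ge> 0"
  shows "c * (hshape (real (i' - i)) (real (j' - j)) / real N - \<epsilon>) \<le> lpt (shiftw (i, j) (envw \<alpha> l b N x)) (Suc (i' - i)) (Suc (j' - j))"
proof -
  have x: "x p \<ge> 0" for p using g unfolding typical_def by blast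
  have "c * (hshape (real (i' - i)) (real (j' - j)) / real N - \<epsilon>) = c / real N * (hshape (real (i' - i)) (real (j' - j)) - \<epsilon> * real N)"
    using N by (simp add: field_simps)
  also have "\<dots> \<le> c / real N * lpt (shiftw (i, j) x) (Suc (i' - i)) (Suc (j' - j))"
  proof (rule mult_left_mono)
    have "\<bar>lpt (shiftw (i, j) x) (Suc (i' - i)) (Suc (j' - j)) - hshape (real (i' - i)) (real (j' - j))\<bar> \<le> \<epsilon> * real N"
      using g le unfolding typical_def by blast
    then show "hshape (real (i' - i)) (real (j' - j)) - \<epsilon> * real N \<le> lpt (shiftw (i, j) x) (Suc (i' - i)) (Suc (j' - j))" by linarith
  qed (use c0 in simp)
  also have "\<dots> = lpt (\<lambda>q. c / real N * shiftw (i, j) x q) (Suc (i' - i)) (Suc (j' - j))"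
    using c0 by (intro lpt_scale[symmetric]) simp
  also have "\<dots> \<le> lpt (shiftw (i, j) (envw \<alpha> l b N x)) (Suc (i' - i)) (Suc (j' - j))"
  proof (rule lpt_mono)
    fix u v assume uv: "u < Suc (i' - i)" "v < Suc (j' - j)"
    then have "c \<le> \<alpha> (emb N (i + u, j + v))" using le by (intro c) auto
    moreover have "emb N (i + u, j + v) \<in> rectQ l b" unfolding emb_in_rectQ_iff[OF N b] using uv le by linarith
    ultimately show "c / real N * shiftw (i, j) x (u, v) \<le> shiftw (i, j) (envw \<alpha> l b N x) (u, v)"
      using x by (auto simp: envw_def intro!: mult_right_mono divide_right_mono)
  qed
  finally show ?thesis .
qed

lemma gwidth_sum_le: "real (gwidth l b N + gwidth l (-b) N) \<le> real N * l" "real (gwidth l b N) \<le> l * real N" "real (gwidth l (-b) N) \<le> l * real N"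
proof -
  have 1: "2 * real (gwidth l b N) \<le> real N * (l + b)" "2 * real (gwidth l (-b) N) \<le> real N * (l + (-b))"
    using le_gwidth_iff[of b l "gwidth l b N" N] le_gwidth_iff[of "-b" l "gwidth l (-b) N" N] b by auto
  then show s: "real (gwidth l b N + gwidth l (-b) N) \<le> real N * l" by (simp add: algebra_simps)
  show "real (gwidth l b N) \<le> l * real N" "real (gwidth l (-b) N) \<le> l * real N"
    using s by (auto simp: mult.commute)
qed

lemma uniform_modulus:
  assumes "\<eta> > 0"
  obtains d where "d > 0" "\<And>p q. p \<in> rectQ l b \<Longrightarrow> q \<in> rectQ l b \<Longrightarrow> \<bar>fst p - fst q\<bar> + \<bar>snd p - snd q\<bar> < d \<Longrightarrow> \<bar>\<alpha> p - \<alpha> q\<bar> < \<eta>"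
proof -
  have "uniformly_continuous_on (rectQ l b) \<alpha>" using compact_uniformly_continuous[OF cont compact_rectQ] .
  then obtain d where d: "d > 0" "\<forall>p\<in>rectQ l b. \<forall>q\<in>rectQ l b. dist q p < d \<longrightarrow> dist (\<alpha> q) (\<alpha> p) < \<eta>"
    using assms unfolding uniformly_continuous_on_def by meson
  have "dist p q \<le> \<bar>fst p - fst q\<bar> + \<bar>snd p - snd q\<bar>" for p q :: "real \<times> real"
    unfolding dist_prod_def dist_real_def by (rule order_trans[OF sqrt_sum_squares_le_sum_abs]) simp
  then have "\<bar>\<alpha> p - \<alpha> q\<bar> < \<eta>" if "p \<in> rectQ l b" "q \<in> rectQ l b" "\<bar>fst p - fst q\<bar> + \<bar>snd p - snd q\<bar> < d" for p q
    using d(2) that by (metis dist_real_def le_less_trans)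
  then show thesis using that d(1) by blast
qed

lemma functional_bdd_above: "bdd_above (functional \<alpha> l ` admissible l b)"
proof -
  obtain B where B: "B > 0" "\<And>p. p \<in> rectQ l b \<Longrightarrow> \<alpha> p \<le> B" using compact_bounded_above[OF cont] by blast
  have "functional \<alpha> l y \<le> B * (l * 2)" if y: "y \<in> admissible l b" for y
  proof -
    let ?X = "\<lambda>i::nat. if i = 0 then 0 else l"
    have "functional \<alpha> l y \<le> (\<Sum>i<1. B * ((?X (Suc i) - ?X i) * gamma_fn ((y (?X (Suc i)) - y (?X i)) / (?X (Suc i) - ?X i))))"
      using l_pos nn y B(2) admissible_in_rectQ[OF y] by (intro functional_le[where b = b]) auto
    also have "\<dots> = B * (l * gamma_fn ((y l - y 0) / l))" by simp
    also have "\<dots> \<le> B * (l * 2)" using B l_pos gamma_fn_bounds(2) by (intro mult_left_mono) auto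
    finally show ?thesis .
  qed
  then show ?thesis by (auto intro!: bdd_aboveI)
qed

lemma functional_le_Gstar: "y \<in> admissible l b \<Longrightarrow> functional \<alpha> l y \<le> Gstar \<alpha> l b"
  unfolding Gstar_def by (intro cSUP_upper functional_bdd_above)

text \<open>The points where an optimal path crosses equally spaced antidiagonals become the nodes
  of a piecewise linear competitor in the supremum.\<close>

lemma upper_deterministic:
  assumes "\<delta> > 0"
  shows "\<exists>\<epsilon>>0. \<exists>N0\<ge>1. \<forall>N\<ge>N0. \<forall>x. typical \<epsilon> l b N x \<longrightarrow>
    lpt (envw \<alpha> l b N x) (Suc (gwidth l b N)) (Suc (gwidth l (-b) N)) \<le> Gstar \<alpha> l b + \<delta>"
proof -
  note l = l_pos
  obtain B where B: "B > 0" "\<And>p. p \<in> rectQ l b \<Longrightarrow> \<alpha> p \<le> B" using compact_bounded_above[OF cont] by blast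
  \<comment> \<open>Passing from the upper to the lower bound of \<alpha> costs
    \<open>2 * \<eta>\<close> times \<open>gamma_fn <= 2\<close> over length \<open>l\<close>, that
    is \<open>4 * \<eta> * l = \<delta> / 2\<close>.\<close>
  define \<eta> where "\<eta> = \<delta> / (8 * l)"
  have eta: "\<eta> > 0" using assms l by (simp add: \<eta>_def)
  obtain d where d: "d > 0" "\<And>p q. p \<in> rectQ l b \<Longrightarrow> q \<in> rectQ l b \<Longrightarrow> \<bar>fst p - fst q\<bar> + \<bar>snd p - snd q\<bar> < d \<Longrightarrow> \<bar>\<alpha> p - \<alpha> q\<bar> < \<eta>"
    using uniform_modulus[OF eta] by blast
  obtain k0 where k0: "4 * l / d < real k0" using reals_Archimedean2 by blast
  define k where "k = Suc k0"
  have k: "l / real k < d / 4" "0 < k" using k0 l d by (auto simp: k_def field_simps)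
  \<comment> \<open>Each of the \<open>k\<close> boxes contributes at most
    \<open>\<epsilon> * (B + \<eta>)\<close>, in total \<open>\<delta> / 2\<close>.\<close>
  define \<epsilon> where "\<epsilon> = \<delta> / (2 * real k * (B + \<eta>))"
  have eps: "\<epsilon> > 0" "real k * (\<epsilon> * (B + \<eta>)) = \<delta> / 2" using assms k B eta by (auto simp: \<epsilon>_def)
  define N0 where "N0 = nat \<lceil>4 / d\<rceil> + 1"
  show ?thesis
  proof (rule exI[of _ \<epsilon>], rule conjI[OF eps(1)], rule exI[of _ N0], intro conjI allI impI)
    show "1 \<le> N0" by (simp add: N0_def)
    fix N x assume NN: "N0 \<le> N" and g: "typical \<epsilon> l b N x"
    have N: "N \<ge> 1" using NN by (simp add: N0_def)
    have "4 / d \<le> real N" using NN unfolding N0_def by linarith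
    then have N4: "1 / real N \<le> d / 4" using N d by (simp add: field_simps)
    let ?A = "gwidth l b N" and ?B = "gwidth l (-b) N" and ?w = "envw \<alpha> l b N x"
    have x: "x p \<ge> 0" for p using g unfolding typical_def by blast
    define t where "t i = (i * (?A + ?B)) div k" for i
    have t: "\<forall>i<Suc k0. t i \<le> t (Suc i)" "t 0 = 0" "t (Suc k0) = ?A + ?B"
    proof -
      show "\<forall>i<Suc k0. t i \<le> t (Suc i)" unfolding t_def by (intro allI impI div_le_mono mult_le_mono1) simp
      show "t 0 = 0" by (simp add: t_def)
      show "t (Suc k0) = ?A + ?B" unfolding t_def k_def by (rule nonzero_mult_div_cancel_left) simp
    qed
    obtain P where P: "P 0 = (0, 0)" "P k = (?A, ?B)" "\<forall>i\<le>k. fst (P i) + snd (P i) = t i"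
      "\<forall>i<k. fst (P i) \<le> fst (P (Suc i)) \<and> snd (P i) \<le> snd (P (Suc i))"
      "lpt ?w (Suc ?A) (Suc ?B) \<le> (\<Sum>i<k. box_lpt ?w (P i) (P (Suc i)))"
    proof -
      have w0: "\<And>p. ?w p \<ge> 0" by (rule envw_nonneg) (rule x)
      show thesis using lpt_chain_upper[of ?w, OF w0 t] that unfolding k_def[symmetric] by blast
    qed
    \<comment> \<open>A box is less than \<open>l / k + 1 / N\<close>-close to its first corner in
      each coordinate, up to equality, and this is below \<open>d / 2\<close>; the
      \<open>1 / N\<close> comes from the rounding in \<open>t\<close>, the factor 2 from adding
      both coordinates.\<close>
    have tstep: "2 * ((real (t (Suc i)) - real (t i)) / real N) < d" if "i < k" for i
    proof -
      have "real (t (Suc i)) \<le> real (Suc i * (?A + ?B)) / real k" unfolding t_def by (rule of_nat_div_le_of_nat)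
      moreover have "real (i * (?A + ?B)) / real k - 1 \<le> real (t i)" 
      proof -
        have "real (i * (?A + ?B)) \<le> real k * real (t i) + real k"
          unfolding t_def of_nat_mult[symmetric] of_nat_add[symmetric] of_nat_le_iff
          using k(2) by (metis add_le_cancel_left less_imp_le mod_less_divisor mult_div_mod_eq)
        then show ?thesis using k(2) by (simp add: field_simps)
      qed
      ultimately have "real (t (Suc i)) - real (t i) \<le> real (Suc i * (?A + ?B)) / real k - (real (i * (?A + ?B)) / real k - 1)" by linarith
      also have "\<dots> = real (?A + ?B) / real k + 1"
      proof -
        have "real (Suc i * (?A + ?B)) = real (i * (?A + ?B)) + real (?A + ?B)" by simp
        then show ?thesis by (simp add: add_divide_distrib)
      qed
      also have "\<dots> \<le> real N * l / real k + 1" using gwidth_sum_le(1)[of N] by (intro add_right_mono divide_right_mono) auto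
      finally have "(real (t (Suc i)) - real (t i)) / real N \<le> (real N * l / real k + 1) / real N" by (rule divide_right_mono) simp
      also have "\<dots> = l / real k + 1 / real N" using N by (simp add: field_simps)
      finally show ?thesis using k(1) N4 by linarith
    qed
    have Pmono: "fst (P i) \<le> fst (P j) \<and> snd (P i) \<le> snd (P j)" if "i \<le> j" "j \<le> k" for i j
      using mono_partition[of k "\<lambda>i. real (fst (P i))" i j] mono_partition[of k "\<lambda>i. real (snd (P i))" i j] P(4) that by auto
    have PA: "fst (P i) \<le> ?A" "snd (P i) \<le> ?B" if "i \<le> k" for i using Pmono[of i k] that P(2) by auto
    have PQ: "emb N (u, v) \<in> rectQ l b" if "u \<le> ?A" "v \<le> ?B" for u v using that by (simp add: emb_in_rectQ_iff[OF N b])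
    \<comment> \<open>Node \<open>k + 1\<close> is \<open>(l, b)\<close>, since the last lattice
      point may lie to the left of it; this extra piece has no box.\<close>
    define X where "X i = (if i \<le> k then real (t i) / real N else l)" for i
    define Y where "Y i = (if i \<le> k then (real (fst (P i)) - real (snd (P i))) / real N else b)" for i
    have embP: "emb N (P i) = (X i, Y i)" if "i \<le> k" for i
      using that P(3) by (auto simp: emb_def X_def Y_def simp flip: of_nat_add)
    have PiQ: "(X i, Y i) \<in> rectQ l b" if "i \<le> k" for i
      using PQ[OF PA(1)[OF that] PA(2)[OF that]] embP[OF that] by simp
    define D1 D2 where "D1 i = real (fst (P (Suc i)) - fst (P i))" and "D2 i = real (snd (P (Suc i)) - snd (P i))" for i
    have D: "X (Suc i) - X i = (D1 i + D2 i) / real N" "Y (Suc i) - Y i = (D1 i - D2 i) / real N" "0 \<le> D1 i" "0 \<le> D2 i"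
      "D1 i + D2 i = real (t (Suc i)) - real (t i)" if "i < k" for i
    proof -
      have e: "D1 i = real (fst (P (Suc i))) - real (fst (P i))" "D2 i = real (snd (P (Suc i))) - real (snd (P i))"
        using P(4) that by (auto simp: D1_def D2_def of_nat_diff)
      have "fst (P i) + snd (P i) = t i" "fst (P (Suc i)) + snd (P (Suc i)) = t (Suc i)" using P(3) that by auto
      then show tt: "D1 i + D2 i = real (t (Suc i)) - real (t i)" unfolding e by linarith
      show "X (Suc i) - X i = (D1 i + D2 i) / real N" unfolding tt using that by (simp add: X_def diff_divide_distrib)
      show "Y (Suc i) - Y i = (D1 i - D2 i) / real N" unfolding e using that by (simp add: Y_def diff_divide_distrib)
      show "0 \<le> D1 i" "0 \<le> D2 i" by (auto simp: D1_def D2_def)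
    qed
    have X_step: "X i \<le> X (Suc i)" and XY_step: "\<bar>Y (Suc i) - Y i\<bar> \<le> X (Suc i) - X i" if "i < Suc k" for i
    proof -
      have "\<bar>Y (Suc i) - Y i\<bar> \<le> X (Suc i) - X i"
      proof (cases "i < k")
        case True
        have "\<bar>D1 i - D2 i\<bar> \<le> D1 i + D2 i" using D(3,4)[OF True] by linarith
        then show ?thesis unfolding D(1,2)[OF True] using N by (simp add: divide_right_mono)
      next
        case False
        then have "i = k" using that by simp
        then show ?thesis using PiQ[of k] by (simp add: rectQ_def X_def Y_def)
      qed
      then show "\<bar>Y (Suc i) - Y i\<bar> \<le> X (Suc i) - X i" "X i \<le> X (Suc i)" by linarith+
    qed
    define y where "y = plin X Y (Suc k)"
    define \<gamma> where "\<gamma> i = gamma_fn ((Y (Suc i) - Y i) / (X (Suc i) - X i))" for i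
    have ends: "Y 0 = 0" "X 0 = 0" "X (Suc k) = l" "Y (Suc k) = b" using P(1) t(2) by (auto simp: X_def Y_def)
    have hs: "hshape (D1 i) (D2 i) / real N = (X (Suc i) - X i) * \<gamma> i" if "i < k" for i
      unfolding \<gamma>_def D(1,2)[OF that] hshape_gamma[OF D(3,4)[OF that]] using N by simp
    have adm: "y \<in> admissible l b" unfolding y_def by (rule plin_admissible) (use X_step XY_step ends in auto)
    define a where "a i = \<alpha> (X i, Y i)" for i
    have a: "0 \<le> a i" "a i \<le> B" if "i \<le> k" for i using PiQ[OF that] nn B by (auto simp: a_def)
    \<comment> \<open>Truncation at 0 keeps the lower bounds nonnegative where \<alpha> is small; on
      the extra last piece 0 suffices.\<close>
    define c where "c i = (if i < k then max 0 (a i - \<eta>) else 0)" for i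
    have low: "(\<Sum>i<Suc k. c i * ((X (Suc i) - X i) * \<gamma> i)) \<le> functional \<alpha> l y"
      unfolding y_def \<gamma>_def
    proof (rule functional_plin_ge[OF cont nn X_step XY_step ends])
      show "0 \<le> c i" for i by (simp add: c_def)
      fix i z assume i: "i < Suc k" and z: "z \<in> {X i<..<X (Suc i)}"
      have X0: "X 0 \<le> X i" "X (Suc i) \<le> X (Suc k)" 
        using mono_partition[of "Suc k" X 0 i] mono_partition[of "Suc k" X "Suc i" "Suc k"] i X_step by auto
      have zQ: "(z, y z) \<in> rectQ l b" using z X0 ends by (intro admissible_in_rectQ[OF adm]) auto
      show "c i \<le> \<alpha> (z, plin X Y (Suc k) z)"
      proof (cases "i < k")
        case True
        have yi: "y (X i) = Y i" unfolding y_def by (rule plin_node) (use X_step XY_step ends True in auto)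
        have "1-lipschitz_on UNIV y" unfolding y_def by (rule plin_lipschitz) (use X_step XY_step ends in auto)
        from lipschitz_onD[OF this, of z "X i"] have "\<bar>y z - Y i\<bar> \<le> \<bar>z - X i\<bar>" unfolding yi[symmetric] by (simp add: dist_real_def)
        moreover have "\<bar>z - X i\<bar> \<le> X (Suc i) - X i" using z by auto
        moreover have "2 * (X (Suc i) - X i) < d" using tstep[OF True] unfolding D(1)[OF True] D(5)[OF True] .
        ultimately have "\<bar>fst (z, y z) - fst (X i, Y i)\<bar> + \<bar>snd (z, y z) - snd (X i, Y i)\<bar> < d" by simp
        then have "\<bar>\<alpha> (z, y z) - a i\<bar> < \<eta>" unfolding a_def using zQ PiQ[of i] True by (intro d(2)) auto
        moreover have "0 \<le> \<alpha> (z, y z)" using zQ nn by blast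
        ultimately show ?thesis unfolding y_def[symmetric] c_def using True by auto
      next
        case False
        then show ?thesis using zQ nn by (auto simp: c_def y_def)
      qed
    qed simp_all
    have up: "box_lpt ?w (P i) (P (Suc i))
      \<le> (a i + \<eta>) * ((X (Suc i) - X i) * \<gamma> i + \<epsilon>)" if i: "i < k" for i
    proof -
      have "lpt (shiftw (fst (P i), snd (P i)) ?w) (Suc (fst (P (Suc i)) - fst (P i))) (Suc (snd (P (Suc i)) - snd (P i)))
        \<le> (a i + \<eta>) * (hshape (real (fst (P (Suc i)) - fst (P i))) (real (snd (P (Suc i)) - snd (P i))) / real N + \<epsilon>)"
      proof (rule box_upper[OF N g])
        show "fst (P i) \<le> fst (P (Suc i))" "snd (P i) \<le> snd (P (Suc i))" using P(4) i by auto
        show "fst (P (Suc i)) \<le> ?A" "snd (P (Suc i)) \<le> ?B" using PA[of "Suc i"] i by auto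
        show "0 \<le> a i + \<eta>" using a[of i] i eta by simp
        fix u v assume uv: "fst (P i) \<le> u" "u \<le> fst (P (Suc i))" "snd (P i) \<le> v" "v \<le> snd (P (Suc i))"
        have e: "D1 i = real (fst (P (Suc i))) - real (fst (P i))" "D2 i = real (snd (P (Suc i))) - real (snd (P i))"
          using P(4) i by (auto simp: D1_def D2_def of_nat_diff)
        have "\<bar>fst (emb N (u, v)) - fst (emb N (P i))\<bar> = \<bar>(real u - real (fst (P i))) + (real v - real (snd (P i)))\<bar> / real N"
          "\<bar>snd (emb N (u, v)) - snd (emb N (P i))\<bar> = \<bar>(real u - real (fst (P i))) - (real v - real (snd (P i)))\<bar> / real N"
          using N by (simp_all add: emb_def algebra_simps flip: diff_divide_distrib)
        moreover have "\<bar>(real u - real (fst (P i))) + (real v - real (snd (P i)))\<bar> \<le> D1 i + D2 i"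
          "\<bar>(real u - real (fst (P i))) - (real v - real (snd (P i)))\<bar> \<le> D1 i + D2 i"
          unfolding e using uv by auto
        ultimately have "\<bar>fst (emb N (u, v)) - fst (emb N (P i))\<bar> \<le> (D1 i + D2 i) / real N"
          "\<bar>snd (emb N (u, v)) - snd (emb N (P i))\<bar> \<le> (D1 i + D2 i) / real N" using N by (auto intro: divide_right_mono)
        then have "\<bar>fst (emb N (u, v)) - fst (emb N (P i))\<bar> + \<bar>snd (emb N (u, v)) - snd (emb N (P i))\<bar> < d"
          using tstep[OF i] unfolding D(5)[OF i] by linarith
        moreover have "emb N (u, v) \<in> rectQ l b" using PA[of "Suc i"] uv i by (intro PQ) auto
        ultimately have "\<bar>\<alpha> (emb N (u, v)) - \<alpha> (emb N (P i))\<bar> < \<eta>" using PiQ[of i] embP[of i] i by (intro d(2)) auto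
        then show "\<alpha> (emb N (u, v)) \<le> a i + \<eta>" using embP[of i] i by (simp add: a_def)
      qed
      then show ?thesis unfolding D1_def[symmetric] D2_def[symmetric] hs[OF i] by (simp del: lpt.simps)
    qed
    have G0: "0 \<le> (X (Suc i) - X i) * \<gamma> i" "(X (Suc i) - X i) * \<gamma> i \<le> 2 * (X (Suc i) - X i)" if "i < k" for i
    proof -
      have "\<bar>(Y (Suc i) - Y i) / (X (Suc i) - X i)\<bar> \<le> 1" by (rule plin_slope_le[of "Suc k"]) (use X_step XY_step ends that in auto)
      then have "0 \<le> \<gamma> i" "\<gamma> i \<le> 2" "0 \<le> X (Suc i) - X i"
        using gamma_fn_bounds X_step[of i] that by (auto simp: \<gamma>_def)
      then show "0 \<le> (X (Suc i) - X i) * \<gamma> i" "(X (Suc i) - X i) * \<gamma> i \<le> 2 * (X (Suc i) - X i)"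
        using mult_left_mono[of "\<gamma> i" 2 "X (Suc i) - X i"] by (auto simp: mult.commute)
    qed
    have "lpt ?w (Suc ?A) (Suc ?B) \<le> (\<Sum>i<k. (a i + \<eta>) * ((X (Suc i) - X i) * \<gamma> i + \<epsilon>))"
      using P(5) by (rule order_trans) (intro sum_mono up, simp)
    also have "\<dots> \<le> (\<Sum>i<k. c i * ((X (Suc i) - X i) * \<gamma> i) + 4 * \<eta> * (X (Suc i) - X i) + \<epsilon> * (B + \<eta>))"
    proof (rule sum_mono)
      fix i assume i: "i \<in> {..<k}"
      have "a i + \<eta> \<le> c i + 2 * \<eta>" using i by (auto simp: c_def)
      then have "(a i + \<eta>) * ((X (Suc i) - X i) * \<gamma> i) \<le> (c i + 2 * \<eta>) * ((X (Suc i) - X i) * \<gamma> i)"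
        using G0[of i] i by (intro mult_right_mono) auto
      moreover have "2 * \<eta> * ((X (Suc i) - X i) * \<gamma> i) \<le> 2 * \<eta> * (2 * (X (Suc i) - X i))"
        using G0[of i] i eta by (intro mult_left_mono) auto
      moreover have "(a i + \<eta>) * \<epsilon> \<le> (B + \<eta>) * \<epsilon>" using a[of i] i eps by (intro mult_right_mono) auto
      ultimately show "(a i + \<eta>) * ((X (Suc i) - X i) * \<gamma> i + \<epsilon>) \<le> c i * ((X (Suc i) - X i) * \<gamma> i) + 4 * \<eta> * (X (Suc i) - X i) + \<epsilon> * (B + \<eta>)"
        by (simp add: algebra_simps)
    qed
    also have "\<dots> = (\<Sum>i<k. c i * ((X (Suc i) - X i) * \<gamma> i)) + 4 * \<eta> * (\<Sum>i<k. X (Suc i) - X i) + real k * (\<epsilon> * (B + \<eta>))"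
      by (simp add: sum.distrib sum_distrib_left)
    also have "(\<Sum>i<k. X (Suc i) - X i) \<le> l"
      using sum_lessThan_telescope[of X k] ends PiQ[of k] by (auto simp: rectQ_def)
    also have "(\<Sum>i<k. c i * ((X (Suc i) - X i) * \<gamma> i)) = (\<Sum>i<Suc k. c i * ((X (Suc i) - X i) * \<gamma> i))" by (simp add: c_def)
    finally have "lpt ?w (Suc ?A) (Suc ?B) \<le> (\<Sum>i<Suc k. c i * ((X (Suc i) - X i) * \<gamma> i)) + 4 * \<eta> * l + \<delta> / 2"
      unfolding eps(2) using eta by simp
    also have "4 * \<eta> * l = \<delta> / 2" using l by (simp add: \<eta>_def)
    finally show "lpt ?w (Suc ?A) (Suc ?B) \<le> Gstar \<alpha> l b + \<delta>"
      using low functional_le_Gstar[OF adm] by linarith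
  qed
qed

lemma admissible_nonempty: "admissible l b \<noteq> {}"
proof -
  have bl: "\<bar>b / l\<bar> \<le> 1" using b l_pos by (simp add: abs_divide divide_le_eq)
  have "1-lipschitz_on {0..l} (\<lambda>x. b / l * x)"
  proof (rule lipschitz_onI)
    fix x z :: real
    have "dist (b / l * x) (b / l * z) = \<bar>b / l\<bar> * dist x z" 
      unfolding dist_real_def abs_mult[symmetric] right_diff_distrib ..
    also have "\<dots> \<le> 1 * dist x z" using bl by (intro mult_right_mono) auto
    finally show "dist (b / l * x) (b / l * z) \<le> 1 * dist x z" .
  qed simp
  then have "(\<lambda>x. b / l * x) \<in> admissible l b" using l_pos by (simp add: admissible_def)
  then show ?thesis by blast
qed

text \<open>A nearly optimal \<open>y\<close> is sampled at equally spaced abscissae and rounded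
  down to grid points. By \<open>functional_le\<close> its chords lose nothing but the variation of
  \<alpha> on a piece.\<close>

lemma lower_deterministic:
  assumes "\<delta> > 0"
  shows "\<exists>\<epsilon>>0. \<exists>N0\<ge>1. \<forall>N\<ge>N0. \<forall>x. typical \<epsilon> l b N x \<longrightarrow>
    Gstar \<alpha> l b - \<delta> \<le> lpt (envw \<alpha> l b N x) (Suc (gwidth l b N)) (Suc (gwidth l (-b) N))"
proof -
  note l = l_pos
  obtain B where B: "B > 0" "\<And>p. p \<in> rectQ l b \<Longrightarrow> \<alpha> p \<le> B" using compact_bounded_above[OF cont] by blast
  have "Gstar \<alpha> l b - \<delta> / 2 < Gstar \<alpha> l b" using assms by simp
  then obtain y where y: "y \<in> admissible l b" "Gstar \<alpha> l b - \<delta> / 2 < functional \<alpha> l y"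
    unfolding Gstar_def using less_cSUP_iff[OF admissible_nonempty functional_bdd_above] by blast
  have lip: "1-lipschitz_on {0..l} y" and yends: "y 0 = 0" "y l = b" using y by (auto simp: admissible_def)
  have ylip: "\<bar>y s - y r\<bar> \<le> \<bar>s - r\<bar>" if "0 \<le> s" "s \<le> l" "0 \<le> r" "r \<le> l" for s r
    using lipschitz_onD[OF lip, of s r] that by (simp add: dist_real_def)
  \<comment> \<open>The loss \<delta> is split into \<delta> / 2 for the choice of \<open>y\<close>,
    \<open>4 * \<eta> * l = \<delta> / 4\<close> for the variation of \<alpha>, and \<delta> / 4 for
    the boxes.\<close>
  define \<eta> where "\<eta> = \<delta> / (16 * l)"
  have eta: "\<eta> > 0" using assms l by (simp add: \<eta>_def)
  obtain d where d: "d > 0" "\<And>p q. p \<in> rectQ l b \<Longrightarrow> q \<in> rectQ l b \<Longrightarrow> \<bar>fst p - fst q\<bar> + \<bar>snd p - snd q\<bar> < d \<Longrightarrow> \<bar>\<alpha> p - \<alpha> q\<bar> < \<eta>"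
    using uniform_modulus[OF eta] by blast
  obtain k0 where k0: "4 * l / d < real k0" using reals_Archimedean2 by blast
  define k where "k = Suc k0"
  have k: "l / real k < d / 4" "0 < k" using k0 l d by (auto simp: k_def field_simps)
  \<comment> \<open>Each piece loses at most \<open>3 * \<epsilon> * B\<close>: rounding, deviation
    of the box, and a corner counted twice. Over \<open>k\<close> pieces this is \<delta> /
    4.\<close>
  define \<epsilon> where "\<epsilon> = \<delta> / (12 * real k * B)"
  have eps: "\<epsilon> > 0" "real k * (\<epsilon> * B) = \<delta> / 12" using assms k B by (auto simp: \<epsilon>_def)
  obtain N1 where N1: "\<And>N. N \<ge> N1 \<Longrightarrow> 8 * sqrt (l * real N) + 4 \<le> \<epsilon> * real N"
    using sqrt_le_linear[OF eps(1) l] by blast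
  define N0 where "N0 = nat \<lceil>8 / d\<rceil> + 1 + N1"
  show ?thesis
  proof (rule exI[of _ \<epsilon>], rule conjI[OF eps(1)], rule exI[of _ N0], intro conjI allI impI)
    show "1 \<le> N0" by (simp add: N0_def)
    fix N x assume NN: "N0 \<le> N" and g: "typical \<epsilon> l b N x"
    have N: "N \<ge> 1" "N \<ge> N1" using NN by (auto simp: N0_def)
    have "8 / d \<le> real N" using NN unfolding N0_def by linarith
    then have N4: "2 / real N \<le> d / 4" using N d by (simp add: field_simps)
    let ?A = "gwidth l b N" and ?B = "gwidth l (-b) N" and ?w = "envw \<alpha> l b N x"
    have x: "x p \<ge> 0" for p using g unfolding typical_def by blast
    define X where "X i = real i * (l / real k)" for i
    have X: "X 0 = 0" "X k = l" "X (Suc i) - X i = l / real k" for i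
      using k by (auto simp: X_def algebra_simps add_divide_distrib)
    have Xm: "X i \<le> X j" if "i \<le> j" for i j unfolding X_def using that l by (intro mult_right_mono) auto
    have X0l: "0 \<le> X i" "X i \<le> l" if "i \<le> k" for i using Xm[of 0 i] Xm[of i k] that X by auto
    \<comment> \<open>The grid coordinates of the curve divided by \<open>N\<close>; the Lipschitz
      bound amounts to their monotonicity.\<close>
    define u v where "u i = (X i + y (X i)) / 2" and "v i = (X i - y (X i)) / 2" for i
    have uv0: "u 0 = 0" "v 0 = 0" using X yends by (auto simp: u_def v_def)
    have ystep: "\<bar>y (X (Suc i)) - y (X i)\<bar> \<le> X (Suc i) - X i" if "i < k" for i
      using ylip[of "X (Suc i)" "X i"] X0l[of i] X0l[of "Suc i"] that Xm[of i "Suc i"] by simp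
    have uvm: "u i \<le> u (Suc i)" "v i \<le> v (Suc i)" if "i < k" for i
      using ystep[OF that] by (auto simp: u_def v_def)
    have uvn: "0 \<le> u i" "0 \<le> v i" if "i \<le> k" for i
      using mono_partition[of k u 0 i] mono_partition[of k v 0 i] uvm uv0 that by auto
    define P where "P i = (nat \<lfloor>real N * u i\<rfloor>, nat \<lfloor>real N * v i\<rfloor>)" for i
    have P0: "P 0 = (0, 0)" by (simp add: P_def uv0)
    \<comment> \<open>The same floor as in \<open>gwidth\<close>, so the chain ends exactly at the
      corner of the grid.\<close>
    have Pk: "P k = (?A, ?B)" by (simp add: P_def u_def v_def gwidth_def X yends)
    have fl: "real (fst (P i)) \<le> real N * u i" "real N * u i - 1 < real (fst (P i))"
      "real (snd (P i)) \<le> real N * v i" "real N * v i - 1 < real (snd (P i))" if "i \<le> k" for i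
      using uvn[OF that] by (auto simp: P_def)
    have Pm: "fst (P i) \<le> fst (P (Suc i)) \<and> snd (P i) \<le> snd (P (Suc i))" if "i < k" for i
      using uvm[OF that] by (auto simp: P_def intro!: nat_mono floor_mono mult_left_mono)
    have Pmono: "fst (P i) \<le> fst (P j) \<and> snd (P i) \<le> snd (P j)" if "i \<le> j" "j \<le> k" for i j
      using mono_partition[of k "\<lambda>i. real (fst (P i))" i j] mono_partition[of k "\<lambda>i. real (snd (P i))" i j] Pm that by auto
    have PA: "fst (P i) \<le> ?A" "snd (P i) \<le> ?B" if "i \<le> k" for i using Pmono[of i k] that Pk by auto
    have PQ: "emb N (p, q) \<in> rectQ l b" if "p \<le> ?A" "q \<le> ?B" for p q using that by (simp add: emb_in_rectQ_iff[OF N(1) b])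
    note inQ = admissible_in_rectQ[OF y(1)]
    define a where "a i = \<alpha> (X i, y (X i))" for i
    have a: "0 \<le> a i" "a i \<le> B" if "i \<le> k" for i using inQ[of "X i"] X0l[OF that] nn B by (auto simp: a_def)
    define c where "c i = max 0 (a i - \<eta>)" for i
    have c: "0 \<le> c i" "c i \<le> B" "a i + \<eta> \<le> c i + 2 * \<eta>" if "i \<le> k" for i using a[OF that] eta B by (auto simp: c_def)
    define G where "G i = (X (Suc i) - X i) * gamma_fn ((y (X (Suc i)) - y (X i)) / (X (Suc i) - X i))" for i
    have up: "functional \<alpha> l y \<le> (\<Sum>i<k. (a i + \<eta>) * G i)"
      unfolding G_def
    proof (rule functional_le[OF l nn y(1) _ X(1,2) k(2)])
      show "X i \<le> X (Suc i)" for i by (rule Xm) simp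
      fix i z assume i: "i < k" and z: "z \<in> {X i..X (Suc i)}"
      have z0: "0 \<le> z" "z \<le> l" using z X0l[of i] X0l[of "Suc i"] i by auto
      have "\<bar>y z - y (X i)\<bar> \<le> \<bar>z - X i\<bar>" using z0 X0l[of i] i by (intro ylip) auto
      moreover have "\<bar>z - X i\<bar> \<le> l / real k" using z X(3)[of i] by auto
      ultimately have "\<bar>fst (z, y z) - fst (X i, y (X i))\<bar> + \<bar>snd (z, y z) - snd (X i, y (X i))\<bar> < d"
        unfolding fst_conv snd_conv using k(1) d(1) by linarith
      then have "\<bar>\<alpha> (z, y z) - \<alpha> (X i, y (X i))\<bar> < \<eta>" using inQ z0 X0l[of i] i by (intro d(2)) auto
      then show "\<alpha> (z, y z) \<le> a i + \<eta>" by (simp add: a_def)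
    qed
    have G0: "0 \<le> G i" "G i \<le> 2 * (l / real k)" if "i < k" for i
    proof -
      have "\<bar>(y (X (Suc i)) - y (X i)) / (X (Suc i) - X i)\<bar> \<le> 1"
        using ystep[OF that] by (cases "X (Suc i) = X i") (auto simp: abs_le_iff divide_le_eq le_divide_eq)
      then have "0 \<le> gamma_fn ((y (X (Suc i)) - y (X i)) / (X (Suc i) - X i))"
        "gamma_fn ((y (X (Suc i)) - y (X i)) / (X (Suc i) - X i)) \<le> 2"
        using gamma_fn_bounds by auto
      then show "0 \<le> G i" "G i \<le> 2 * (l / real k)"
        using mult_left_mono[of "gamma_fn ((y (X (Suc i)) - y (X i)) / (X (Suc i) - X i))" 2 "l / real k"] l
        unfolding G_def X(3) by (auto simp: mult.commute)
    qed
    \<comment> \<open>Rounding shortens an increment by less than 1, and for large \<open>N\<close>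
      the effect on \<open>hshape\<close> is at most \<open>\<epsilon> * N\<close>.\<close>
    have hG: "real N * G i \<le> hshape (real (fst (P (Suc i)) - fst (P i))) (real (snd (P (Suc i)) - snd (P i))) + \<epsilon> * real N" if i: "i < k" for i
    proof -
      let ?D1 = "real (fst (P (Suc i)) - fst (P i))" and ?D2 = "real (snd (P (Suc i)) - snd (P i))"
      let ?du = "u (Suc i) - u i" and ?dv = "v (Suc i) - v i"
      have duv: "?du + ?dv = X (Suc i) - X i" "?du - ?dv = y (X (Suc i)) - y (X i)" by (auto simp: u_def v_def field_simps)
      have "real N * G i = hshape (real N * ?du) (real N * ?dv)"
        using uvm[OF i] hshape_gamma[of ?du ?dv] unfolding duv by (simp add: hshape_scale G_def)
      also have "\<dots> \<le> hshape (?D1 + 1) (?D2 + 1)"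
      proof (rule hshape_mono)
        have e: "?D1 = real (fst (P (Suc i))) - real (fst (P i))" "?D2 = real (snd (P (Suc i))) - real (snd (P i))"
          using Pm[OF i] by (auto simp: of_nat_diff)
        show "real N * ?du \<le> ?D1 + 1" "real N * ?dv \<le> ?D2 + 1"
          unfolding e right_diff_distrib using fl[of i] fl[of "Suc i"] i by auto
      qed (use uvm[OF i] in auto)
      also have "\<dots> \<le> hshape ?D1 ?D2 + 4 * (sqrt ?D1 + sqrt ?D2) + 4" by (rule hshape_Suc_le) auto
      also have "\<dots> \<le> hshape ?D1 ?D2 + 4 * (sqrt (l * real N) + sqrt (l * real N)) + 4"
      proof (intro add_mono mult_left_mono order_refl real_sqrt_le_mono)
        have "?D1 \<le> real ?A" "?D2 \<le> real ?B" using PA[of "Suc i"] i by auto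
        then show "?D1 \<le> l * real N" "?D2 \<le> l * real N" using gwidth_sum_le(2,3)[of N] by linarith+
      qed simp
      also have "\<dots> = hshape ?D1 ?D2 + (8 * sqrt (l * real N) + 4)" by (simp add: algebra_simps)
      also have "\<dots> \<le> hshape ?D1 ?D2 + \<epsilon> * real N" using N1[OF N(2)] by (rule add_left_mono)
      finally show ?thesis .
    qed
    have box: "c i * (G i - 2 * \<epsilon>) \<le> box_lpt ?w (P i) (P (Suc i))"
      if i: "i < k" for i
    proof -
      have "G i - 2 * \<epsilon> \<le> hshape (real (fst (P (Suc i)) - fst (P i))) (real (snd (P (Suc i)) - snd (P i))) / real N - \<epsilon>"
        using hG[OF i] N(1) by (simp add: field_simps)
      then have "c i * (G i - 2 * \<epsilon>) \<le> c i * (hshape (real (fst (P (Suc i)) - fst (P i))) (real (snd (P (Suc i)) - snd (P i))) / real N - \<epsilon>)"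
        using c(1)[of i] i by (intro mult_left_mono) auto
      also have "\<dots> \<le> lpt (shiftw (fst (P i), snd (P i)) ?w) (Suc (fst (P (Suc i)) - fst (P i))) (Suc (snd (P (Suc i)) - snd (P i)))"
      proof (rule box_lower[OF N(1) g])
        show "fst (P i) \<le> fst (P (Suc i))" "snd (P i) \<le> snd (P (Suc i))" using Pm[OF i] by auto
        show "fst (P (Suc i)) \<le> ?A" "snd (P (Suc i)) \<le> ?B" using PA[of "Suc i"] i by auto
        show "0 \<le> c i" using c(1)[of i] i by simp
        fix p q assume pq: "fst (P i) \<le> p" "p \<le> fst (P (Suc i))" "snd (P i) \<le> q" "q \<le> snd (P (Suc i))"
        have "real (fst (P i)) \<le> real p" "real p \<le> real (fst (P (Suc i)))" "real (snd (P i)) \<le> real q" "real q \<le> real (snd (P (Suc i)))"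
          using pq by auto
        then have r: "real N * u i - 1 \<le> real p" "real p \<le> real N * u (Suc i)" "real N * v i - 1 \<le> real q" "real q \<le> real N * v (Suc i)"
          using fl[of i] fl[of "Suc i"] i by linarith+
        have du: "\<bar>real p / real N - u i\<bar> \<le> u (Suc i) - u i + 1 / real N"
        proof -
          have "u i - 1 / real N \<le> real p / real N" "real p / real N \<le> u (Suc i)"
            using divide_right_mono[OF r(1), of "real N"] divide_right_mono[OF r(2), of "real N"] N(1)
            by (simp_all add: diff_divide_distrib)
          moreover have "0 \<le> 1 / real N" by simp
          ultimately show ?thesis using uvm[OF i] by linarith
        qed
        have dv: "\<bar>real q / real N - v i\<bar> \<le> v (Suc i) - v i + 1 / real N"
        proof -
          have "v i - 1 / real N \<le> real q / real N" "real q / real N \<le> v (Suc i)"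
            using divide_right_mono[OF r(3), of "real N"] divide_right_mono[OF r(4), of "real N"] N(1)
            by (simp_all add: diff_divide_distrib)
          moreover have "0 \<le> 1 / real N" by simp
          ultimately show ?thesis using uvm[OF i] by linarith
        qed
        have e: "fst (emb N (p, q)) - X i = (real p / real N - u i) + (real q / real N - v i)"
          "snd (emb N (p, q)) - y (X i) = (real p / real N - u i) - (real q / real N - v i)"
          by (simp_all add: emb_def u_def v_def add_divide_distrib diff_divide_distrib)
        have "u (Suc i) - u i + (v (Suc i) - v i) = l / real k" using X(3)[of i] by (simp add: u_def v_def field_simps)
        then have "\<bar>fst (emb N (p, q)) - fst (X i, y (X i))\<bar> + \<bar>snd (emb N (p, q)) - snd (X i, y (X i))\<bar> \<le> 2 * (l / real k + 2 / real N)"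
          unfolding fst_conv snd_conv e using du dv by (auto simp: abs_le_iff)
        also have "\<dots> < 2 * (d / 4 + d / 4)" by (intro mult_strict_left_mono add_less_le_mono k(1) N4) simp
        also have "\<dots> = d" by simp
        finally have "\<bar>\<alpha> (emb N (p, q)) - \<alpha> (X i, y (X i))\<bar> < \<eta>"
          using inQ[of "X i"] X0l[of i] i PQ[of p q] PA[of "Suc i"] pq by (intro d(2)) auto
        moreover have "0 \<le> \<alpha> (emb N (p, q))" using PQ[of p q] PA[of "Suc i"] pq i nn by auto
        ultimately show "c i \<le> \<alpha> (emb N (p, q))" by (auto simp: c_def a_def)
      qed
      finally show ?thesis by (simp del: lpt.simps)
    qed
    \<comment> \<open>A single site is a box with increments 0 and \<open>hshape 0 0 = 0\<close>, so
      \<open>typical\<close> also bounds individual weights.\<close>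
    have wP: "?w (P i) \<le> \<epsilon> * B" if i: "i < k" for i
    proof -
      have "\<bar>lpt (shiftw (fst (P i), snd (P i)) x) (Suc (fst (P i) - fst (P i))) (Suc (snd (P i) - snd (P i)))
        - hshape (real (fst (P i) - fst (P i))) (real (snd (P i) - snd (P i)))\<bar> \<le> \<epsilon> * real N"
        using g PA[of i] i unfolding typical_def by (metis order_refl less_imp_le)
      then have xP: "x (P i) \<le> \<epsilon> * real N" by (simp add: hshape_def)
      have eQ: "emb N (P i) \<in> rectQ l b" using PQ[of "fst (P i)" "snd (P i)"] PA[of i] i by simp
      then have "?w (P i) = \<alpha> (emb N (P i)) / real N * x (P i)" by (simp add: envw_def)
      also have "\<dots> \<le> B / real N * (\<epsilon> * real N)"
        using B eQ nn x xP by (intro mult_mono divide_right_mono) auto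
      also have "\<dots> = \<epsilon> * B" using N by simp
      finally show ?thesis .
    qed
    have "(\<Sum>i<k. c i * G i - 2 * (\<epsilon> * B)) \<le> (\<Sum>i<k. c i * (G i - 2 * \<epsilon>))"
    proof (rule sum_mono)
      fix i assume "i \<in> {..<k}"
      then have "c i * (2 * \<epsilon>) \<le> B * (2 * \<epsilon>)" using c[of i] eps by (intro mult_right_mono) auto
      then show "c i * G i - 2 * (\<epsilon> * B) \<le> c i * (G i - 2 * \<epsilon>)" by (simp add: algebra_simps)
    qed
    also have "\<dots> \<le> (\<Sum>i<k. box_lpt ?w (P i) (P (Suc i)))"
      by (intro sum_mono box) simp
    also have "\<dots> \<le> lpt ?w (Suc (fst (P k))) (Suc (snd (P k))) + (\<Sum>i<k. ?w (P i))"
    proof (rule lpt_chain_lower[where P = P and w = ?w, OF _ P0])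
      show "?w p \<ge> 0" for p by (rule envw_nonneg) (rule x)
      show "\<forall>i<k. fst (P i) \<le> fst (P (Suc i)) \<and> snd (P i) \<le> snd (P (Suc i))" using Pm by blast
    qed
    also have "(\<Sum>i<k. ?w (P i)) \<le> (\<Sum>i<k. \<epsilon> * B)" by (intro sum_mono wP) simp
    finally have lo: "(\<Sum>i<k. c i * G i) - 3 * (real k * (\<epsilon> * B)) \<le> lpt ?w (Suc ?A) (Suc ?B)"
      by (simp add: Pk sum_subtractf mult_ac del: lpt.simps)
    have "(\<Sum>i<k. (a i + \<eta>) * G i) \<le> (\<Sum>i<k. c i * G i + 2 * \<eta> * (2 * (l / real k)))"
    proof (rule sum_mono)
      fix i assume i: "i \<in> {..<k}"
      have "(a i + \<eta>) * G i \<le> (c i + 2 * \<eta>) * G i" using c(3)[of i] G0[of i] i by (intro mult_right_mono) auto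
      moreover have "2 * \<eta> * G i \<le> 2 * \<eta> * (2 * (l / real k))" using G0[of i] i eta by (intro mult_left_mono) auto
      ultimately show "(a i + \<eta>) * G i \<le> c i * G i + 2 * \<eta> * (2 * (l / real k))" by (simp add: algebra_simps)
    qed
    also have "\<dots> = (\<Sum>i<k. c i * G i) + 4 * \<eta> * l" using k(2) by (simp add: sum.distrib)
    also have "4 * \<eta> * l = \<delta> / 4" using l by (simp add: \<eta>_def)
    finally have "functional \<alpha> l y \<le> (\<Sum>i<k. c i * G i) + \<delta> / 4" using up by linarith
    then show "Gstar \<alpha> l b - \<delta> \<le> lpt ?w (Suc ?A) (Suc ?B)"
      using lo y(2) assms unfolding eps(2) by linarith
  qed
qed

end

section \<open>Transfer to the given variables\<close>

lemma lpp_cong: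
  assumes "\<And>p. p \<in> latS l b N \<Longrightarrow> w p = v p"
  shows "lpp l b N w = lpp l b N v"
proof -
  have "(\<Sum>p\<leftarrow>\<pi>. w p) = (\<Sum>p\<leftarrow>\<pi>. v p)" if "\<pi> \<in> paths l b N" for \<pi>
  proof -
    have "set \<pi> \<subseteq> latS l b N" using that by (simp add: paths_def)
    then have "map w \<pi> = map v \<pi>" using assms by (auto intro!: map_cong)
    then show ?thesis by (rule arg_cong[where f = sum_list])
  qed
  then show ?thesis unfolding lpp_def by (metis (mono_tags, lifting) image_cong)
qed

lemma measurable_lpp:
  assumes N: "N \<ge> 1" and b: "\<bar>b\<bar> < l"
  shows "lpp l b N \<in> borel_measurable (PiM (latS l b N) (\<lambda>_. borel))"
  unfolding lpp_def
proof (rule borel_measurable_Max[OF finite_paths[OF N b]])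
  fix \<pi> assume "\<pi> \<in> paths l b N"
  then have "set \<pi> \<subseteq> latS l b N" by (simp add: paths_def)
  then show "(\<lambda>w. \<Sum>p\<leftarrow>\<pi>. w p) \<in> borel_measurable (PiM (latS l b N) (\<lambda>_. borel :: real measure))"
  proof (induction \<pi>)
    case (Cons p \<pi>)
    then have p: "(\<lambda>w. w p) \<in> borel_measurable (PiM (latS l b N) (\<lambda>_. borel :: real measure))"
      using measurable_component_singleton[of p "latS l b N" "\<lambda>_. borel"] by simp
    have "(\<lambda>w. \<Sum>p\<leftarrow>\<pi>. w p) \<in> borel_measurable (PiM (latS l b N) (\<lambda>_. borel :: real measure))" using Cons by simp
    from borel_measurable_add[OF p this] show ?case by simp
  qed simp
qed

text \<open>One field of mean 1 exponentials on the whole quadrant serves every \<open>N\<close>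
  after scaling.\<close>

abbreviation exp_field :: "(nat \<times> nat \<Rightarrow> real) measure" where
  "exp_field \<equiv> PiM UNIV (\<lambda>_. expm 1)"

interpretation exp_field: prob_space exp_field
  by (intro prob_space_PiM prob_space_expm) simp

text \<open>Reindexing by the inverse of \<open>emb\<close> keeps independence, and scaling acts
  coordinatewise. Marginals are written as images under \<open>a p * x\<close>, which includes a
  point mass when \<open>a p = 0\<close>.\<close>

lemma scaled_field_law:
  fixes a :: "real \<times> real \<Rightarrow> real"
  assumes N: "N \<ge> 1" and S: "S \<subseteq> range (emb N)" "S \<noteq> {}"
  shows "distr exp_field (PiM S (\<lambda>_. borel)) (\<lambda>x. \<lambda>p\<in>S. a p * x (the_inv (emb N) p))
    = PiM S (\<lambda>p. distr (expm 1) borel (\<lambda>x. a p * x))"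
proof -
  let ?e = "the_inv (emb N)"
  have inj: "inj (emb N)" using emb_inj[OF N] by (auto simp: inj_def)
  have ee: "emb N (?e p) = p" if "p \<in> S" for p using that S(1) f_the_inv_into_f[OF inj] by blast
  have inje: "inj_on ?e S" using ee by (metis inj_onI)
  have comp: "distr exp_field (expm 1) (\<lambda>x. x k) = expm 1" for k
    by (rule distr_PiM_component) (auto intro: prob_space_expm)
  have rv: "(\<lambda>x. x k) \<in> measurable exp_field (expm 1)" for k
    by (rule measurable_component_singleton) simp
  have "distr exp_field (PiM S (\<lambda>_. expm 1)) (\<lambda>x. \<lambda>p\<in>S. x (?e p)) = PiM S (\<lambda>_. expm 1)"
    using distr_PiM_reindex[of UNIV "\<lambda>_. expm 1" ?e S] inje prob_space_expm[of 1] by simp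
  then have ind: "exp_field.indep_vars (\<lambda>_. expm 1) (\<lambda>p x. x (?e p)) S"
    using rv by (subst exp_field.indep_vars_iff_distr_eq_PiM'[OF S(2)]) (auto simp: comp)
  have "exp_field.indep_vars (\<lambda>_. borel) (\<lambda>p x. a p * x (?e p)) S"
    using exp_field.indep_vars_compose2[OF ind, of "\<lambda>p x. a p * x" "\<lambda>_. borel"] by simp
  moreover have rv': "(\<lambda>x. a p * x (?e p)) \<in> borel_measurable exp_field" for p
    using rv[of "?e p"] by simp
  ultimately have joint: "distr exp_field (PiM S (\<lambda>_. borel)) (\<lambda>x. \<lambda>p\<in>S. a p * x (?e p))
    = PiM S (\<lambda>p. distr exp_field borel (\<lambda>x. a p * x (?e p)))"
    by (subst (asm) exp_field.indep_vars_iff_distr_eq_PiM'[OF S(2)]) auto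
  have marg: "distr exp_field borel (\<lambda>x. a p * x (?e p)) = distr (expm 1) borel (\<lambda>x. a p * x)" for p
  proof -
    have "distr (expm 1) borel (\<lambda>x. a p * x) = distr (distr exp_field (expm 1) (\<lambda>x. x (?e p))) borel (\<lambda>x. a p * x)"
      by (simp only: comp)
    also have "\<dots> = distr exp_field borel (\<lambda>x. a p * x (?e p))"
      by (subst distr_distr) (use rv in \<open>auto simp: comp_def\<close>)
    finally show ?thesis by simp
  qed
  show ?thesis unfolding joint marg ..
qed

lemma typical_mono: "\<epsilon> \<le> \<epsilon>' \<Longrightarrow> typical \<epsilon> l b N x \<Longrightarrow> typical \<epsilon>' l b N x"
  unfolding typical_def by (meson mult_right_mono of_nat_0_le_iff order_trans)

context lpp_env
begin

text \<open>A union bound over all boxes with corners in the grid. Nonnegativity of all weights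
  holds only almost surely, hence the form with a bad event \<open>E\<close> and an almost sure
  implication.\<close>

lemma not_typical_tail:
  assumes "\<epsilon> > 0"
  shows "\<exists>c>0. \<exists>C>0. \<forall>N\<ge>1. \<exists>E\<in>sets exp_field. measure exp_field E \<le> C * exp (- c * real N) \<and>
    (AE x in exp_field. x \<notin> E \<longrightarrow> typical \<epsilon> l b N x)"
proof -
  obtain c C where c: "c > 0" "C > 0" and dev: "\<And>N m n. N \<ge> 1 \<Longrightarrow> real m \<le> l * real N \<Longrightarrow> real n \<le> l * real N \<Longrightarrow>
     measure (box_measure (Suc m) (Suc n)) {x \<in> space (box_measure (Suc m) (Suc n)). \<epsilon> * real N \<le> \<bar>lpt x (Suc m) (Suc n) - hshape m n\<bar>}
       \<le> C * exp (- c * real N)"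
    using lpt_deviation[OF assms l_pos] by blast
  obtain D where D: "D > 0" "\<And>N::nat. (1 + real N) ^ 4 * exp (- c * real N) \<le> D * exp (- (c / 2) * real N)"
    using polynomial_times_exp_le[OF c(1), of 4] by blast
  show ?thesis
  proof (rule exI[of _ "c / 2"], rule conjI, use c in simp, rule exI[of _ "C * (1 + l) ^ 4 * D"], intro conjI allI impI)
    show "0 < C * (1 + l) ^ 4 * D" using c D l_pos by simp
    fix N :: nat assume N: "1 \<le> N"
    let ?A = "gwidth l b N" and ?B = "gwidth l (-b) N"
    let ?I = "{(i, i', j, j'). i \<le> i' \<and> i' \<le> ?A \<and> j \<le> j' \<and> j' \<le> ?B}"
    let ?bad = "\<lambda>(i, i', j, j'). {x \<in> space exp_field. \<epsilon> * real N \<le> \<bar>lpt (shiftw (i, j) x) (Suc (i' - i)) (Suc (j' - j)) - hshape (real (i' - i)) (real (j' - j))\<bar>}"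
    have sub: "?I \<subseteq> {..?A} \<times> {..?A} \<times> {..?B} \<times> {..?B}" by auto
    have fin: "finite ?I" by (rule finite_subset[OF sub]) auto
    have "card ?I \<le> card ({..?A} \<times> {..?A} \<times> {..?B} \<times> {..?B})" by (rule card_mono[OF _ sub]) auto
    also have "\<dots> = Suc ?A * (Suc ?A * (Suc ?B * Suc ?B))" by (simp add: card_cartesian_product)
    finally have "real (card ?I) \<le> real (Suc ?A) * (real (Suc ?A) * (real (Suc ?B) * real (Suc ?B)))"
      by (simp only: of_nat_mult[symmetric] of_nat_le_iff)
    also have "\<dots> \<le> ((1 + l) * (1 + real N)) * (((1 + l) * (1 + real N)) * (((1 + l) * (1 + real N)) * ((1 + l) * (1 + real N))))"
    proof -
      have "real (Suc ?A) \<le> (1 + l) * (1 + real N)" "real (Suc ?B) \<le> (1 + l) * (1 + real N)"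
        using gwidth_sum_le(2,3)[of N] l_pos by (auto simp: algebra_simps)
      then show ?thesis using l_pos by (intro mult_mono mult_nonneg_nonneg) auto
    qed
    also have "\<dots> = (1 + l) ^ 4 * (1 + real N) ^ 4" by (simp add: power4_eq_xxxx mult_ac)
    finally have card: "real (card ?I) \<le> (1 + l) ^ 4 * (1 + real N) ^ 4" .
    have meas: "?bad q \<in> sets exp_field" for q
    proof (cases q)
      case (fields i i' j j')
      have [measurable]: "(\<lambda>x. lpt (shiftw (i, j) x) (Suc (i' - i)) (Suc (j' - j))) \<in> borel_measurable exp_field"
        using measurable_lpt_shiftw[of "Suc (i' - i)" "Suc (j' - j)" i j UNIV "\<lambda>_. 1"] by simp
      show ?thesis unfolding fields prod.case by measurable
    qed
    have prob: "measure exp_field (?bad q) \<le> C * exp (- c * real N)" if "q \<in> ?I" for q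
    proof (cases q)
      case (fields i i' j j')
      let ?m = "i' - i" and ?n = "j' - j"
      have "measure exp_field (?bad q) = measure (box_measure (Suc ?m) (Suc ?n)) {x \<in> space (box_measure (Suc ?m) (Suc ?n)). \<epsilon> * real N \<le> \<bar>lpt x (Suc ?m) (Suc ?n) - hshape ?m ?n\<bar>}"
        unfolding fields prod.case
        by (rule measure_lpt_shiftw[where K = UNIV and r = "\<lambda>_. 1" and Q = "\<lambda>t. \<epsilon> * real N \<le> \<bar>t - hshape (real (i' - i)) (real (j' - j))\<bar>"]) auto
      also have "\<dots> \<le> C * exp (- c * real N)"
      proof (rule dev[OF N])
        have "real ?m \<le> real ?A" "real ?n \<le> real ?B" using that fields by auto
        then show "real ?m \<le> l * real N" "real ?n \<le> l * real N" using gwidth_sum_le(2,3)[of N] by linarith+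
      qed
      finally show ?thesis .
    qed
    show "\<exists>E\<in>sets exp_field. measure exp_field E \<le> C * (1 + l) ^ 4 * D * exp (- (c / 2) * real N) \<and>
      (AE x in exp_field. x \<notin> E \<longrightarrow> typical \<epsilon> l b N x)"
    proof (intro bexI[of _ "\<Union>q\<in>?I. ?bad q"] conjI)
      have "measure exp_field (\<Union>q\<in>?I. ?bad q) \<le> (\<Sum>q\<in>?I. measure exp_field (?bad q))"
        by (rule measure_UNION_le[OF fin meas])
      also have "\<dots> \<le> (\<Sum>q\<in>?I. C * exp (- c * real N))" by (rule sum_mono[OF prob])
      also have "\<dots> = real (card ?I) * (C * exp (- c * real N))" by simp
      also have "\<dots> \<le> ((1 + l) ^ 4 * (1 + real N) ^ 4) * (C * exp (- c * real N))" using card c by (intro mult_right_mono) auto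
      also have "\<dots> = C * (1 + l) ^ 4 * ((1 + real N) ^ 4 * exp (- c * real N))" by (simp add: mult_ac)
      also have "\<dots> \<le> C * (1 + l) ^ 4 * (D * exp (- (c / 2) * real N))" using D(2)[of N] c l_pos by (intro mult_left_mono) auto
      finally show "measure exp_field (\<Union>q\<in>?I. ?bad q) \<le> C * (1 + l) ^ 4 * D * exp (- (c / 2) * real N)" by (simp add: mult_ac)
      have "AE x in exp_field. \<forall>k\<in>UNIV. x k \<ge> 0" by (rule AE_PiM_expm_nonneg[where r = "\<lambda>_. 1"]) auto
      then show "AE x in exp_field. x \<notin> (\<Union>q\<in>?I. ?bad q) \<longrightarrow> typical \<epsilon> l b N x"
      proof (rule AE_mp, intro AE_I2 impI)
        fix x assume x: "x \<in> space exp_field" "\<forall>k\<in>UNIV. x k \<ge> 0" "x \<notin> (\<Union>q\<in>?I. ?bad q)"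
        show "typical \<epsilon> l b N x" unfolding typical_def
        proof (intro conjI allI impI)
          show "x p \<ge> 0" for p using x(2) by blast
          fix i i' j j' assume "i \<le> i'" "i' \<le> ?A" "j \<le> j'" "j' \<le> ?B"
          then have "(i, i', j, j') \<in> ?I" by simp
          then have "x \<notin> ?bad (i, i', j, j')" using x(3) by (meson UN_I)
          then have "\<not> \<epsilon> * real N \<le> \<bar>lpt (shiftw (i, j) x) (Suc (i' - i)) (Suc (j' - j)) - hshape (real (i' - i)) (real (j' - j))\<bar>"
            using x(1) unfolding prod.case by blast
          then show "\<bar>lpt (shiftw (i, j) x) (Suc (i' - i)) (Suc (j' - j)) - hshape (real (i' - i)) (real (j' - j))\<bar> \<le> \<epsilon> * real N" by linarith
        qed
      qed
      show "(\<Union>q\<in>?I. ?bad q) \<in> sets exp_field" by (rule sets.finite_UN[OF fin meas])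
    qed
  qed
qed

lemma lpp_exp_field_tail:
  assumes "\<delta> > 0"
  shows "\<exists>c>0. \<exists>C>0. \<forall>N\<ge>1. measure exp_field {x \<in> space exp_field.
     \<delta> < \<bar>lpp l b N (\<lambda>p. \<alpha> p / real N * x (the_inv (emb N) p)) - Gstar \<alpha> l b\<bar>} \<le> C * exp (- c * real N)"
proof -
  obtain \<epsilon>1 N1 where e1: "\<epsilon>1 > 0" "\<And>N x. N \<ge> N1 \<Longrightarrow> typical \<epsilon>1 l b N x \<Longrightarrow>
    lpt (envw \<alpha> l b N x) (Suc (gwidth l b N)) (Suc (gwidth l (-b) N)) \<le> Gstar \<alpha> l b + \<delta>"
    using upper_deterministic[OF assms] by blast
  obtain \<epsilon>2 N2 where e2: "\<epsilon>2 > 0" "\<And>N x. N \<ge> N2 \<Longrightarrow> typical \<epsilon>2 l b N x \<Longrightarrow>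
    Gstar \<alpha> l b - \<delta> \<le> lpt (envw \<alpha> l b N x) (Suc (gwidth l b N)) (Suc (gwidth l (-b) N))"
    using lower_deterministic[OF assms] by blast
  define \<epsilon> where "\<epsilon> = min \<epsilon>1 \<epsilon>2"
  have eps: "\<epsilon> > 0" "\<epsilon> \<le> \<epsilon>1" "\<epsilon> \<le> \<epsilon>2" using e1 e2 by (auto simp: \<epsilon>_def)
  obtain c C where c: "c > 0" "C > 0" and tail: "\<And>N. N \<ge> 1 \<Longrightarrow> \<exists>E\<in>sets exp_field. measure exp_field E \<le> C * exp (- c * real N) \<and>
    (AE x in exp_field. x \<notin> E \<longrightarrow> typical \<epsilon> l b N x)"
    using not_typical_tail[OF eps(1)] by blast
  define N0 where "N0 = max N1 N2"
  \<comment> \<open>For \<open>N < N0\<close> the second entry makes the bound at least 1, hence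
    trivial.\<close>
  define C' where "C' = max C (exp (c * real N0))"
  show ?thesis
  proof (rule exI[of _ c], rule conjI[OF c(1)], rule exI[of _ C'], intro conjI allI impI)
    show "C' > 0" using c by (simp add: C'_def)
    fix N :: nat assume N: "1 \<le> N"
    let ?e = "the_inv (emb N)"
    let ?X = "{x \<in> space exp_field. \<delta> < \<bar>lpp l b N (\<lambda>p. \<alpha> p / real N * x (?e p)) - Gstar \<alpha> l b\<bar>}"
    show "measure exp_field ?X \<le> C' * exp (- c * real N)"
    proof (cases "N0 \<le> N")
      case False
      then have "1 \<le> exp (c * real N0) * exp (- c * real N)" using c unfolding exp_add[symmetric] by simp
      also have "\<dots> \<le> C' * exp (- c * real N)" unfolding C'_def by (intro mult_right_mono) auto
      finally show ?thesis using exp_field.prob_le_1 order_trans by blast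
    next
      case True
      obtain E where E: "E \<in> sets exp_field" "measure exp_field E \<le> C * exp (- c * real N)" "AE x in exp_field. x \<notin> E \<longrightarrow> typical \<epsilon> l b N x"
        using tail[OF N] by blast
      have "measure exp_field ?X \<le> measure exp_field E"
      proof (rule exp_field.finite_measure_mono_AE[OF _ E(1)])
        show "AE x in exp_field. x \<in> ?X \<longrightarrow> x \<in> E"
          using E(3)
        proof eventually_elim
          case (elim x)
          show ?case
          proof (intro impI, rule ccontr)
            assume xX: "x \<in> ?X" and "x \<notin> E"
            then have g: "typical \<epsilon> l b N x" using elim by blast
            have x0: "x p \<ge> 0" for p using g unfolding typical_def by blast
            let ?w = "\<lambda>p. \<alpha> p / real N * x (?e p)"
            have inj: "inj (emb N)" using emb_inj[OF N] by (auto simp: inj_def)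
            have "lpp l b N ?w = lpt (?w \<circ> emb N) (Suc (gwidth l b N)) (Suc (gwidth l (-b) N))"
              by (rule lpp_eq_lpt[OF N b]) (use nn x0 in \<open>auto simp: latS_def\<close>)
            also have "\<dots> = lpt (envw \<alpha> l b N x) (Suc (gwidth l b N)) (Suc (gwidth l (-b) N))"
              by (rule lpt_cong) (auto simp: envw_def emb_in_rectQ_iff[OF N b] the_inv_f_f[OF inj] less_Suc_eq_le)
            finally have eq: "lpp l b N ?w = lpt (envw \<alpha> l b N x) (Suc (gwidth l b N)) (Suc (gwidth l (-b) N))" .
            have "lpp l b N ?w \<le> Gstar \<alpha> l b + \<delta>" "Gstar \<alpha> l b - \<delta> \<le> lpp l b N ?w"
              unfolding eq using True e1(2)[of N x] e2(2)[of N x] typical_mono[OF eps(2) g] typical_mono[OF eps(3) g] by (auto simp: N0_def simp del: lpt.simps)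
            then have "\<bar>lpp l b N ?w - Gstar \<alpha> l b\<bar> \<le> \<delta>" by linarith
            then show False using xX by simp
          qed
        qed
      qed
      also have "\<dots> \<le> C * exp (- c * real N)" by (rule E(2))
      also have "\<dots> \<le> C' * exp (- c * real N)" unfolding C'_def by (intro mult_right_mono) auto
      finally show ?thesis .
    qed
  qed
qed

end

text \<open>The passage time is a measurable function of the weights on \<open>latS\<close>, whose
  joint law is the product with the same marginals as the scaled field.\<close>

lemma (in lpp_env) lpp_law:
  assumes "prob_space M" and N: "N \<ge> 1"
    and ind: "prob_space.indep_vars M (\<lambda>_. borel) X (latS l b N)"
    and law: "\<forall>p\<in>latS l b N. scaled_exp_distributed M (X p) (\<alpha> p / real N)"
  shows "(\<lambda>\<omega>. lpp l b N (\<lambda>p. X p \<omega>)) \<in> borel_measurable M"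
    "measure M {\<omega> \<in> space M. \<delta> < \<bar>lpp l b N (\<lambda>p. X p \<omega>) - g\<bar>} = measure exp_field {x \<in> space exp_field.
     \<delta> < \<bar>lpp l b N (\<lambda>p. \<alpha> p / real N * x (the_inv (emb N) p)) - g\<bar>}"
proof -
  interpret prob_space M by fact
  let ?S = "latS l b N"
  let ?P = "PiM ?S (\<lambda>_. borel :: real measure)"
  let ?T = "\<lambda>\<omega>. \<lambda>p\<in>?S. X p \<omega>" and ?U = "\<lambda>x. \<lambda>p\<in>?S. \<alpha> p / real N * x (the_inv (emb N) p)"
  let ?E = "{z \<in> space ?P. \<delta> < \<bar>lpp l b N z - g\<bar>}"
  have S: "?S \<subseteq> range (emb N)" "?S \<noteq> {}" unfolding latS_eq[OF N b] by auto
  note [measurable] = measurable_lpp[OF N b]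
  have X: "X p \<in> borel_measurable M" "distr M borel (X p) = distr (expm 1) borel (\<lambda>x. \<alpha> p / real N * x)" if "p \<in> ?S" for p
    using law that by (auto simp: scaled_exp_distributed_def)
  have T: "?T \<in> measurable M ?P" using X(1) by (rule measurable_restrict)
  have U: "?U \<in> measurable exp_field ?P"
  proof (rule measurable_restrict)
    fix p
    have "(\<lambda>x. x (the_inv (emb N) p)) \<in> borel_measurable exp_field"
      using measurable_coord_expm[of "the_inv (emb N) p" UNIV "\<lambda>_. 1"] by simp
    then show "(\<lambda>x. \<alpha> p / real N * x (the_inv (emb N) p)) \<in> borel_measurable exp_field" by simp
  qed
  have "distr M ?P ?T = PiM ?S (\<lambda>p. distr M borel (X p))"
    using indep_vars_iff_distr_eq_PiM'[OF S(2), where M' = "\<lambda>_. borel" and X = X] X(1) ind by simp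
  also have "\<dots> = PiM ?S (\<lambda>p. distr (expm 1) borel (\<lambda>x. \<alpha> p / real N * x))"
    by (intro PiM_cong X(2) refl)
  also have "\<dots> = distr exp_field ?P ?U" by (rule scaled_field_law[OF N S, symmetric])
  finally have same: "distr M ?P ?T = distr exp_field ?P ?U" .
  have lT: "lpp l b N (?T \<omega>) = lpp l b N (\<lambda>p. X p \<omega>)" for \<omega> by (rule lpp_cong) simp
  have lU: "lpp l b N (?U x) = lpp l b N (\<lambda>p. \<alpha> p / real N * x (the_inv (emb N) p))" for x by (rule lpp_cong) simp
  show "(\<lambda>\<omega>. lpp l b N (\<lambda>p. X p \<omega>)) \<in> borel_measurable M"
    using measurable_compose[OF T measurable_lpp[OF N b]] unfolding lT .
  have E: "?E \<in> sets ?P" by measurable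
  have "measure M {\<omega> \<in> space M. \<delta> < \<bar>lpp l b N (\<lambda>p. X p \<omega>) - g\<bar>} = measure M (?T -` ?E \<inter> space M)"
    using measurable_space[OF T] unfolding lT[symmetric] by (intro arg_cong[where f = "measure M"]) auto
  also have "\<dots> = measure (distr M ?P ?T) ?E" by (rule measure_distr[OF T E, symmetric])
  also have "\<dots> = measure (distr exp_field ?P ?U) ?E" unfolding same ..
  also have "\<dots> = measure exp_field (?U -` ?E \<inter> space exp_field)" by (rule measure_distr[OF U E])
  also have "?U -` ?E \<inter> space exp_field = {x \<in> space exp_field.
     \<delta> < \<bar>lpp l b N (\<lambda>p. \<alpha> p / real N * x (the_inv (emb N) p)) - g\<bar>}"
    using measurable_space[OF U] unfolding lU[symmetric] by auto
  finally show "measure M {\<omega> \<in> space M. \<delta> < \<bar>lpp l b N (\<lambda>p. X p \<omega>) - g\<bar>} = measure exp_field {x \<in> space exp_field.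
     \<delta> < \<bar>lpp l b N (\<lambda>p. \<alpha> p / real N * x (the_inv (emb N) p)) - g\<bar>}" .
qed

section \<open>From exponential tails to almost sure convergence\<close>

lemma AE_LIMSEQ_of_exponential_tails:
  fixes X :: "nat \<Rightarrow> 'a \<Rightarrow> real"
  assumes "prob_space M" and X: "\<And>N. N \<ge> 1 \<Longrightarrow> X N \<in> borel_measurable M"
    and tail: "\<And>\<delta>. \<delta> > 0 \<Longrightarrow> \<exists>c>0. \<exists>C>0. \<forall>N\<ge>1. measure M {\<omega> \<in> space M. \<delta> < \<bar>X N \<omega> - g\<bar>} \<le> C * exp (- c * real N)"
  shows "AE \<omega> in M. (\<lambda>N. X N \<omega>) \<longlonglongrightarrow> g"
proof -
  interpret prob_space M by fact
  have ev: "AE \<omega> in M. \<forall>\<^sub>F N in sequentially. \<bar>X N \<omega> - g\<bar> \<le> \<delta>" if "\<delta> > 0" for \<delta>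
  proof -
    obtain c C where c: "c > 0" "C > 0" and le: "\<And>N. N \<ge> 1 \<Longrightarrow> prob {\<omega> \<in> space M. \<delta> < \<bar>X N \<omega> - g\<bar>} \<le> C * exp (- c * real N)"
      using tail[OF \<open>\<delta> > 0\<close>] by blast
    \<comment> \<open>Shifted by one because the tail bounds start at \<open>N = 1\<close>.\<close>
    let ?A = "\<lambda>N. {\<omega> \<in> space M. \<delta> < \<bar>X (Suc N) \<omega> - g\<bar>}"
    have "summable (\<lambda>N. prob (?A N))"
    proof (rule summable_comparison_test')
      have e: "C * exp (- c * real (Suc N)) = (C * exp (- c)) * exp (- c) ^ N" for N
        by (simp add: exp_of_nat_mult[symmetric] exp_add[symmetric] algebra_simps)
      show "summable (\<lambda>N. C * exp (- c * real (Suc N)))"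
        unfolding e using c by (intro summable_mult summable_geometric) simp
      show "norm (prob (?A N)) \<le> C * exp (- c * real (Suc N))" for N using le[of "Suc N"] by simp
    qed
    moreover have "?A N \<in> events" for N
    proof -
      have [measurable]: "X (Suc N) \<in> borel_measurable M" by (rule X) simp
      show ?thesis by measurable
    qed
    ultimately have "AE \<omega> in M. \<forall>\<^sub>F N in sequentially. \<omega> \<in> space M - ?A N"
      by (intro borel_cantelli_AE1) (auto simp: emeasure_eq_measure)
    then show ?thesis
    proof eventually_elim
      case (elim \<omega>)
      then have "\<forall>\<^sub>F N in sequentially. \<bar>X (Suc N) \<omega> - g\<bar> \<le> \<delta>" by eventually_elim auto
      then show ?case by (rule eventually_sequentially_Suc[THEN iffD1])
    qed
  qed
  \<comment> \<open>Countably many tolerances suffice, so the exceptional null sets can be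
    united.\<close>
  have "AE \<omega> in M. \<forall>n::nat. \<forall>\<^sub>F N in sequentially. \<bar>X N \<omega> - g\<bar> \<le> 1 / real (Suc n)"
    unfolding AE_all_countable by (intro allI ev) simp
  then show ?thesis
  proof eventually_elim
    case (elim \<omega>)
    show ?case
    proof (rule tendstoI)
      fix e :: real assume "e > 0"
      then obtain n where n: "1 / real (Suc n) < e" using nat_approx_posE by blast
      from elim[rule_format, of n] show "\<forall>\<^sub>F N in sequentially. dist (X N \<omega>) g < e"
        by eventually_elim (use n in \<open>auto simp: dist_real_def\<close>)
    qed
  qed
qed

theorem theorem1:
  fixes M :: "'a measure" and l b :: real and \<alpha> :: "real \<times> real \<Rightarrow> real"
    and \<xi> :: "nat \<Rightarrow> real \<times> real \<Rightarrow> 'a \<Rightarrow> real"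
  assumes "prob_space M"
    and "l > 0" and "\<bar>b\<bar> < l"
    and "continuous_on (rectQ l b) \<alpha>" and "\<forall>p \<in> rectQ l b. \<alpha> p \<ge> 0"
    and "\<forall>N \<ge> 1. prob_space.indep_vars M (\<lambda>_. borel) (\<xi> N) (latS l b N)"
    and "\<forall>N \<ge> 1. \<forall>p \<in> latS l b N. scaled_exp_distributed M (\<xi> N p) (\<alpha> p / real N)"
  shows "(AE \<omega> in M. (\<lambda>N. lpp l b N (\<lambda>p. \<xi> N p \<omega>)) \<longlonglongrightarrow> Gstar \<alpha> l b)
    \<and> (\<forall>\<delta> > 0. \<exists>c C. c > 0 \<and> C > 0 \<and> (\<forall>N \<ge> 1.
           measure M {\<omega> \<in> space M. \<bar>lpp l b N (\<lambda>p. \<xi> N p \<omega>) - Gstar \<alpha> l b\<bar> > \<delta>}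
             < C * exp (- c * real N)))"
proof -
  interpret lpp_env l b \<alpha> by unfold_locales (use assms in auto)
  have law: "(\<lambda>\<omega>. lpp l b N (\<lambda>p. \<xi> N p \<omega>)) \<in> borel_measurable M"
    "measure M {\<omega> \<in> space M. \<delta> < \<bar>lpp l b N (\<lambda>p. \<xi> N p \<omega>) - g\<bar>} = measure exp_field {x \<in> space exp_field.
     \<delta> < \<bar>lpp l b N (\<lambda>p. \<alpha> p / real N * x (the_inv (emb N) p)) - g\<bar>}" if "N \<ge> 1" for N \<delta> g
    using lpp_law[OF assms(1) that, of "\<xi> N"] assms(6,7) that by auto
  have tail: "\<exists>c>0. \<exists>C>0. \<forall>N\<ge>1. measure M {\<omega> \<in> space M. \<delta> < \<bar>lpp l b N (\<lambda>p. \<xi> N p \<omega>) - Gstar \<alpha> l b\<bar>} \<le> C * exp (- c * real N)"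
    if "\<delta> > 0" for \<delta>
    using lpp_exp_field_tail[OF that] law(2) by simp
  show ?thesis
  proof (intro conjI allI impI)
    show "AE \<omega> in M. (\<lambda>N. lpp l b N (\<lambda>p. \<xi> N p \<omega>)) \<longlonglongrightarrow> Gstar \<alpha> l b"
      by (rule AE_LIMSEQ_of_exponential_tails[OF assms(1) law(1) tail])
    fix \<delta> :: real assume "\<delta> > 0"
    then obtain c C where c: "c > 0" "C > 0" and le: "\<And>N. N \<ge> 1 \<Longrightarrow>
      measure M {\<omega> \<in> space M. \<delta> < \<bar>lpp l b N (\<lambda>p. \<xi> N p \<omega>) - Gstar \<alpha> l b\<bar>} \<le> C * exp (- c * real N)"
      using tail by blast
    show "\<exists>c C. c > 0 \<and> C > 0 \<and> (\<forall>N \<ge> 1.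
           measure M {\<omega> \<in> space M. \<bar>lpp l b N (\<lambda>p. \<xi> N p \<omega>) - Gstar \<alpha> l b\<bar> > \<delta>} < C * exp (- c * real N))"
    \<comment> \<open>\<open>C + 1\<close> turns the weak inequality into the strict one.\<close>
    proof (rule exI[of _ c], rule exI[of _ "C + 1"], intro conjI allI impI)
      fix N :: nat assume "1 \<le> N"
      then have "measure M {\<omega> \<in> space M. \<delta> < \<bar>lpp l b N (\<lambda>p. \<xi> N p \<omega>) - Gstar \<alpha> l b\<bar>} \<le> C * exp (- c * real N)" by (rule le)
      also have "\<dots> < (C + 1) * exp (- c * real N)" by (intro mult_strict_right_mono) auto
      finally show "measure M {\<omega> \<in> space M. \<bar>lpp l b N (\<lambda>p. \<xi> N p \<omega>) - Gstar \<alpha> l b\<bar> > \<delta>} < (C + 1) * exp (- c * real N)" .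
    qed (use c in auto)
  qed
qed

end
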